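(* Let $n\ge 3$ and let $N\ge 1$ and $\widetilde\alpha_1\ge\widetilde\alpha_2\ge\dots\ge\widetilde\alpha_N\ge 2$ be integers with $\sum_{i=1}^N\widetilde\alpha_i\le n$. Put $\widetilde R=n-\sum_{i=1}^N\widetilde\alpha_i$ and let $(\mathcal A^J)_{1\le J\le J_{\max}}$, with $J_{\max}=\frac{n!}{\widetilde\alpha_1!\cdots\widetilde\alpha_N!\,\widetilde R!}$, be the balanced family of sets of vector fields of type $(\widetilde\alpha_1,\dots,\widetilde\alpha_N)$ (defined in the context). Let $\widetilde p$ be the number of occurrences of the most recurrent vector field among the complements $(\mathcal A^J)^c$, that is, $$\widetilde p=\max_{L\in\bigcup_{J}(\mathcal A^J)^c}\#\{J\in\{1,\dots,J_{\max}\}: L\in(\mathcal A^J)^c\},$$ which is an exponent such that the inequality $$\int_{\mathbb S^{n-1}}\prod_{J=1}^{J_{\max}} f_J\,d\sigma\le\prod_{J=1}^{J_{\max}}\|f_J\|_{L^{p_J}(\mathbb S^{n-1})}\qquad( * )$$ holds for all nonnegative functions $f_J$ on $\mathbb S^{n-1}$, with $f_J$ being $\mathcal A^J$-symmetric for each $J$, whenever $p_J\ge\widetilde p$ for all $J$. Then $$\widetilde{p}=\frac{(n-2)!\left(n(n-1)-\sum_{i=1}^N \widetilde\alpha_i(\widetilde\alpha_i-1)\right)}{\widetilde\alpha_1 !\cdots\widetilde\alpha_N !\,\widetilde R !}.$$ Moreover, this exponent is sharp, in the sense that it cannot be lowered: $\widetilde p$ is the lowest possible exponent $q$ for which the statement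 "$( * )$ holds for all nonnegative $\mathcal A^J$-symmetric functions $f_J$ $(J=1,\dots,J_{\max})$ whenever $p_J\ge q$ for all $J$" is true.
   Context: $\mathbb S^{n-1}\subset\mathbb R^n$ is the unit sphere and $d\sigma$ its normalized uniform (rotation invariant probability) measure; $L^p(\mathbb S^{n-1})$ is taken with respect to $d\sigma$. For $1\le i<j\le n$ let $L_{i,j}=x_i\partial_{x_j}-x_j\partial_{x_i}$, acting on functions on $\mathbb S^{n-1}$. For a subset $\mathcal A\subseteq\{L_{i,j}\}_{i<j}$, $\mathcal A^c$ denotes its complement in $\{L_{i,j}\}_{i<j}$. A function $f\in C^\infty(\mathbb S^{n-1})$ is called $\mathcal A$-symmetric if $Xf=0$ for all $X\in\mathcal A$. A multi-index is an element $\alpha\in\{0,1\}^n$ with components $(\alpha)_1,\dots,(\alpha)_n$; its length is $|\alpha|=\sum_i(\alpha)_i$. Two multi-indices $\alpha,\beta$ are orthogonal if $\sum_i(\alpha)_i(\beta)_i=0$. Balanced family of type $(\widetilde\alpha_1,\dots,\widetilde\alpha_N)$: let $(\alpha_1^J,\dots,\alpha_N^J)$, $J=1,\dots,J_{\max}$, be an enumeration, each occurring exactly once, of all ordered $N$-tuples of pairwise orthogonal multi-indices in $\{0,1\}^n$ with $|\alpha_i^J|=\widetilde\alpha_i$ for $i=1,\dots,N$; their number is $J_{\max}$. (Ordered tuples are counted separately even when they differ only by permuting multi-indices of equal length.) Set $$\mathcal A^J=\{L_{k,l}:k<l,\ (\alpha_i^J)_k=(\alpha_i^J)_l=1\text{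 for some }i\in\{1,\dots,N\}\}.$$ *)

theory Defs
  imports "HOL-Analysis.Analysis" "HOL-Probability.Probability_Measure"
    "HOL-Probability.Essential_Supremum"
begin

subsection \<open>The uniform measure on the unit sphere\<close>

text \<open>
  The push-forward of the uniform distribution on the unit ball under \<open>x \<mapsto> x / |x|\<close>
  (which is \<^const>\<open>sgn\<close>), viewed as a measure whose space is the sphere.  The lemmas below show
  that it is a rotation invariant probability measure on the Borel sets of the sphere.
\<close>

definition sphere_measure :: "(real ^ 'n) measure" where
  "sphere_measure =
     restrict_space (distr (uniform_measure lborel (ball 0 1)) borel sgn) (sphere 0 1)"

lemma space_sphere_measure: "space (sphere_measure :: (real ^ 'n) measure) = sphere 0 1"
  by (simp add: sphere_measure_def space_restrict_space)

lemma sets_sphere_measure: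
  "sets (sphere_measure :: (real ^ 'n) measure) = sets (restrict_space borel (sphere 0 1))"
  by (simp add: sphere_measure_def sets_restrict_space)

lemma emeasure_sphere_measure:
  fixes A :: "(real ^ 'n) set"
  assumes "A \<in> sets borel" "A \<subseteq> sphere 0 1"
  shows "emeasure sphere_measure A
       = emeasure lborel (ball 0 1 \<inter> sgn -` A) / emeasure lborel (ball (0 :: real ^ 'n) 1)"
proof -
  have [measurable]: "A \<in> sets borel" by fact
  have "sgn -` A \<in> sets (borel :: (real ^ 'n) measure)"
    using measurable_sets_borel[OF borel_measurable_sgn assms(1)] by simp
  moreover have "sgn \<in> measurable (uniform_measure lborel (ball (0 :: real ^ 'n) 1)) borel"
    by (simp cong: measurable_cong_sets)
  ultimately show ?thesis
    using assms unfolding sphere_measure_def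
    by (subst emeasure_restrict_space) (auto simp: emeasure_distr borel_closed)
qed

lemma prob_space_sphere_measure: "prob_space (sphere_measure :: (real ^ 'n) measure)"
proof
  let ?B = "ball (0 :: real ^ 'n) 1"
  have "emeasure lborel (?B - {0}) = emeasure lborel ?B"
    by (intro emeasure_Diff_null_set) (auto simp: null_sets_def)
  moreover have "?B \<inter> sgn -` sphere 0 1 = ?B - {0}"
    by (auto simp: norm_sgn split: if_splits)
  moreover have "emeasure lborel ?B = ennreal (measure lborel ?B)" "measure lborel ?B > 0"
    using emeasure_eq_ennreal_measure[of lborel ?B] emeasure_bounded_finite[of ?B]
    by (auto simp: content_ball_pos)
  ultimately show "emeasure (sphere_measure :: (real ^ 'n) measure) (space sphere_measure) = 1"
    by (simp add: space_sphere_measure emeasure_sphere_measure borel_closed ennreal_divide_self)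
qed

lemma sphere_measure_rotation_invariant:
  fixes T :: "real ^ ('n::{finite,wellorder}) \<Rightarrow> real ^ ('n::{finite,wellorder})"
  assumes T: "orthogonal_transformation T"
  shows "distr sphere_measure sphere_measure T = sphere_measure"
proof -
  let ?\<sigma> = "sphere_measure :: (real ^ ('n::{finite,wellorder})) measure"
  let ?B = "ball (0 :: real ^ ('n::{finite,wellorder})) 1"
  have nrm: "norm (T x) = norm x" for x
    by (rule orthogonal_transformation_norm[OF T])
  have linT: "linear T"
    by (rule orthogonal_transformation_linear[OF T])
  have Tborel: "T \<in> borel_measurable borel"
    by (intro borel_measurable_continuous_onI linear_continuous_on linear_conv_bounded_linear[THEN iffD1] linT)
  have sgnT: "sgn (T x) = T (sgn x)" for x
    by (simp add: sgn_div_norm nrm linear_cmul[OF linT])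
  have Tmeas: "T \<in> measurable ?\<sigma> ?\<sigma>"
    using Tborel
    by (simp cong: measurable_cong_sets add: sets_sphere_measure measurable_restrict_space3 nrm)
  have bijT: "bij T"
    by (rule orthogonal_transformation_bij[OF T])
  let ?S = "inv T"
  have S: "orthogonal_transformation ?S"
    by (rule orthogonal_transformation_inv[OF T])
  have vol: "emeasure lborel (T -` E) = emeasure lborel E"
    if E: "E \<in> sets borel" "bounded E" for E
  proof -
    have eq: "T -` E = ?S ` E" by (rule bij_vimage_eq_inv_image[OF bijT])
    have E': "E \<in> lmeasurable"
      using E by (intro bounded_set_imp_lmeasurable) auto
    have "T -` E \<in> sets borel"
      using measurable_sets_borel[OF Tborel E(1)] by simp
    then have "emeasure lborel (T -` E) = emeasure lebesgue (?S ` E)"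
      by (simp add: eq)
    also have "\<dots> = ennreal (measure lebesgue (?S ` E))"
      using measurable_orthogonal_image[OF S E'] by (simp add: emeasure_eq_measure2)
    also have "\<dots> = emeasure lebesgue E"
      using E' by (simp add: measure_orthogonal_image[OF S E'] emeasure_eq_measure2)
    finally show ?thesis using E by simp
  qed
  show ?thesis
  proof (rule measure_eqI)
    fix A assume "A \<in> sets (distr ?\<sigma> ?\<sigma> T)"
    then have "A \<in> sets ?\<sigma>" by simp
    then have A: "A \<in> sets borel" "A \<subseteq> sphere 0 1"
      by (auto simp: sets_sphere_measure sets_restrict_space borel_closed)
    have TA: "T -` A \<in> sets borel" "T -` A \<subseteq> sphere 0 1"
      using measurable_sets_borel[OF Tborel A(1)] A(2) nrm by auto
    have "sgn -` A \<in> sets (borel :: (real ^ ('n::{finite,wellorder})) measure)"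
      using measurable_sets_borel[OF borel_measurable_sgn A(1)] by simp
    then have "emeasure lborel (T -` (?B \<inter> sgn -` A)) = emeasure lborel (?B \<inter> sgn -` A)"
      by (intro vol) (auto intro: bounded_subset[OF bounded_ball])
    moreover have "T -` (?B \<inter> sgn -` A) = ?B \<inter> sgn -` (T -` A)"
      by (auto simp: nrm sgnT)
    moreover have "T -` A \<inter> space ?\<sigma> = T -` A"
      using TA(2) by (auto simp: space_sphere_measure)
    ultimately show "emeasure (distr ?\<sigma> ?\<sigma> T) A = emeasure ?\<sigma> A"
      using A TA \<open>A \<in> sets ?\<sigma>\<close>
      by (simp add: emeasure_distr[OF Tmeas] emeasure_sphere_measure)
  qed simp
qed

text \<open>For \<open>0 < p < 1\<close> this is only a quasi-norm; the value at \<open>p = 0\<close> is never used.\<close>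

definition Lp_norm :: "'a measure \<Rightarrow> ennreal \<Rightarrow> ('a \<Rightarrow> real) \<Rightarrow> real" where
  "Lp_norm M p f =
     (if p = \<infinity> then real_of_ereal (esssup M (\<lambda>x. ereal \<bar>f x\<bar>))
      else (\<integral>x. \<bar>f x\<bar> powr enn2real p \<partial>M) powr (1 / enn2real p))"

subsection \<open>Smooth functions and rotation vector fields on the sphere\<close>

definition partial_deriv :: "'n \<Rightarrow> (real ^ 'n \<Rightarrow> real) \<Rightarrow> real ^ 'n \<Rightarrow> real" where
  "partial_deriv i F x = frechet_derivative F (at x) (axis i 1)"

text \<open>Meant for open \<open>S\<close> only.\<close>

primrec Ck_on :: "nat \<Rightarrow> (real ^ 'n) set \<Rightarrow> (real ^ 'n \<Rightarrow> real) \<Rightarrow> bool" where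
  "Ck_on 0 S F \<longleftrightarrow> continuous_on S F"
| "Ck_on (Suc k) S F \<longleftrightarrow>
     (\<forall>x\<in>S. F differentiable (at x)) \<and> (\<forall>i. Ck_on k S (partial_deriv i F))"

text \<open>
  A function on the sphere is represented by a function on \<open>\<real>\<^sup>n\<close> of which only the values on the
  sphere matter.  To differentiate it, it is first replaced by its extension to
  \<open>\<real>\<^sup>n - {0}\<close> that is constant along rays.  This loses no generality: \<open>f\<close> is smooth on the
  sphere iff this extension is smooth, and \<open>x\<^sub>i \<partial>\<^sub>j - x\<^sub>j \<partial>\<^sub>i\<close> is tangent
  to the sphere, so that its action there does not depend on the chosen smooth extension.
\<close>

definition radial_extension :: "(real ^ 'n \<Rightarrow> real) \<Rightarrow> real ^ 'n \<Rightarrow> real" where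
  "radial_extension f = (\<lambda>x. f (sgn x))"

definition smooth_on_sphere :: "(real ^ 'n \<Rightarrow> real) \<Rightarrow> bool" where
  "smooth_on_sphere f \<longleftrightarrow> (\<forall>k. Ck_on k (- {0}) (radial_extension f))"

type_synonym 'n vfield = "(real ^ 'n \<Rightarrow> real) \<Rightarrow> real ^ 'n \<Rightarrow> real"

definition rotation_field :: "'n::finite \<Rightarrow> 'n \<Rightarrow> 'n vfield" where
  "rotation_field i j f x =
     x $ i * partial_deriv j (radial_extension f) x - x $ j * partial_deriv i (radial_extension f) x"

definition rotation_fields :: "('n::{finite,wellorder}) vfield set" where
  "rotation_fields = {rotation_field i j | i j. i < j}"

definition symmetric_wrt :: "('n::finite) vfield set \<Rightarrow> (real ^ 'n \<Rightarrow> real) \<Rightarrow> bool" where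
  "symmetric_wrt A f \<longleftrightarrow> smooth_on_sphere f \<and> (\<forall>X\<in>A. \<forall>x\<in>sphere 0 1. X f x = 0)"

subsection \<open>Balanced families\<close>

definition multi_index :: "nat ^ 'n \<Rightarrow> bool" where
  "multi_index \<alpha> \<longleftrightarrow> (\<forall>i. \<alpha> $ i \<in> {0, 1})"

definition mi_length :: "nat ^ 'n \<Rightarrow> nat" where
  "mi_length \<alpha> = (\<Sum>i\<in>UNIV. \<alpha> $ i)"

definition mi_orthogonal :: "nat ^ 'n \<Rightarrow> nat ^ 'n \<Rightarrow> bool" where
  "mi_orthogonal \<alpha> \<beta> \<longleftrightarrow> (\<Sum>i\<in>UNIV. \<alpha> $ i * \<beta> $ i) = 0"

definition orthogonal_tuples :: "nat list \<Rightarrow> (nat ^ 'n) list set" where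
  "orthogonal_tuples a =
     {\<alpha>s. length \<alpha>s = length a
        \<and> (\<forall>i<length a. multi_index (\<alpha>s ! i) \<and> mi_length (\<alpha>s ! i) = a ! i)
        \<and> (\<forall>i<length a. \<forall>j<length a. i \<noteq> j \<longrightarrow> mi_orthogonal (\<alpha>s ! i) (\<alpha>s ! j))}"

definition tuple_fields :: "(nat ^ ('n::{finite,wellorder})) list \<Rightarrow> 'n vfield set" where
  "tuple_fields \<alpha>s =
     {rotation_field k l | k l. k < l \<and> (\<exists>i<length \<alpha>s. (\<alpha>s ! i) $ k = 1 \<and> (\<alpha>s ! i) $ l = 1)}"

definition balanced_family ::
    "nat list \<Rightarrow> nat \<Rightarrow> (nat \<Rightarrow> ('n::{finite,wellorder}) vfield set) \<Rightarrow> bool" where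
  "balanced_family a Jmax A \<longleftrightarrow>
     (\<exists>\<alpha>. bij_betw \<alpha> {1..Jmax} (orthogonal_tuples a) \<and> (\<forall>J\<in>{1..Jmax}. A J = tuple_fields (\<alpha> J)))"

text \<open>
  Since \<^term>\<open>Sup ({} :: nat set) = 0\<close>, the supremum is the maximum if some complement is
  nonempty, and \<open>0\<close> otherwise.  The latter happens only for the one-element type \<open>(n)\<close>.
\<close>

definition max_recurrence :: "nat \<Rightarrow> (nat \<Rightarrow> ('n::{finite,wellorder}) vfield set) \<Rightarrow> nat" where
  "max_recurrence Jmax A =
     (SUP L \<in> (\<Union>J\<in>{1..Jmax}. rotation_fields - A J).
        card {J\<in>{1..Jmax}. L \<in> rotation_fields - A J})"

subsection \<open>The inequality\<close>

definition product_inequality ::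
    "nat \<Rightarrow> (nat \<Rightarrow> ('n::finite) vfield set) \<Rightarrow> (nat \<Rightarrow> ennreal) \<Rightarrow> bool" where
  "product_inequality Jmax A p \<longleftrightarrow>
     (\<forall>f. (\<forall>J\<in>{1..Jmax}. symmetric_wrt (A J) (f J) \<and> (\<forall>x\<in>sphere 0 1. 0 \<le> f J x)) \<longrightarrow>
        (\<integral>x. (\<Prod>J=1..Jmax. f J x) \<partial>sphere_measure)
          \<le> (\<Prod>J=1..Jmax. Lp_norm sphere_measure (p J) (f J)))"

text \<open>The exponents \<open>p\<^sub>J\<close> range over \<open>(0, \<infinity>]\<close>.\<close>

definition admissible_exponent :: "nat \<Rightarrow> (nat \<Rightarrow> ('n::finite) vfield set) \<Rightarrow> ennreal \<Rightarrow> bool" where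
  "admissible_exponent Jmax A q \<longleftrightarrow>
     (\<forall>p. (\<forall>J\<in>{1..Jmax}. 0 < p J \<and> q \<le> p J) \<longrightarrow> product_inequality Jmax A p)"

end

theory Submission
  imports Defs "HOL-Probability.Distributions"
begin

text \<open>
  By monotonicity of the norms and a limit it suffices to take all exponents equal to a number \<open>p\<close>
  larger than the recurrence number \<open>c\<close>, and to bound \<open>\<integral> \<Prod> F\<^sub>J\<^bsup>1/p\<^esup>\<close> by 1 for positive
  symmetric polynomials \<open>F\<^sub>J\<close> of degree at most \<open>d\<close> with \<open>F\<^sub>J \<ge> \<epsilon>\<close> and \<open>\<integral> F\<^sub>J = 1\<close>; the general
  case follows by the Stone--Weierstrass theorem on a section of the block rotations.  For fixed
  \<open>d\<close> and \<open>\<epsilon>\<close> these tuples form a compact set, so the integral has a maximiser.  An infinitesimal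
  step of the heat flow \<open>F\<^sub>J + s \<Delta> F\<^sub>J\<close> almost preserves the constraints, hence cannot increase the
  integral to first order.  Integration by parts along the rotation fields \<open>X\<close> turns this into
  \<open>\<Sum>\<^sub>X \<integral> H (\<Sum>\<^sub>J v\<^sub>J\<^sup>2 - (\<Sum>\<^sub>J v\<^sub>J)\<^sup>2 / p) \<le> 0\<close> with \<open>v\<^sub>J = X F\<^sub>J / F\<^sub>J\<close> and \<open>H = \<Prod> F\<^sub>J\<^bsup>1/p\<^esup>\<close>.
  Since for each \<open>X\<close> at most \<open>c < p\<close> of the \<open>v\<^sub>J\<close> are nonzero, the Cauchy--Schwarz inequality forces
  all of them to vanish: the maximiser is constant and the maximum is 1.

  Sharpness is seen from \<open>f\<^sub>J = exp (- s |x - \<pi>\<^sub>J x|\<^sup>2)\<close>, where \<open>\<pi>\<^sub>J\<close> projects to the coordinates in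
  the block of a fixed index \<open>m\<close>, as \<open>s \<rightarrow> \<infinity>\<close>: the product concentrates at the points
  \<open>\<plusminus>e\<^sub>m\<close>, of codimension \<open>n - 1\<close>, and the codimensions of the spheres at which the factors
  concentrate add up to \<open>(n - 1) c\<close>.
\<close>

subsection \<open>Plane rotations\<close>

text \<open>Running the heat flow for all time would require existence and regularity of the heat
  semigroup. Maximising over polynomials replaces it: the rotation fields have linear coefficients,
  so the Laplacian does not raise the degree, and one small explicit step stays in a
  finite-dimensional space. The obstacle is the constraint F_J \<ge> \<epsilon>, which keeps the
  logarithms smooth but which a heat step may violate. At a minimum of F_J the Laplacian is
  nonnegative, so the step costs only o(s); adding a constant \<kappa> s and renormalising repairs
  this for \<epsilon> \<le> 1/2, and \<kappa> tends to 0 at the end. The step must also respect the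
  blocks: the Laplacian commutes with every rotation, although the single fields do not. Strictness
  of p > c matters, since at p = c Cauchy--Schwarz leaves no positive remainder to force rigidity.
  The number c is the same for all pairs of coordinates because permuting coordinates permutes the
  tuples; this yields the closed formula by double counting and lets a single index m serve for
  sharpness.\<close>

definition rot :: "'n::finite \<Rightarrow> 'n \<Rightarrow> real \<Rightarrow> real ^ 'n \<Rightarrow> real ^ 'n" where
  "rot k l t x = x + ((cos t - 1) * x $ k - sin t * x $ l) *\<^sub>R axis k 1
                   + (sin t * x $ k + (cos t - 1) * x $ l) *\<^sub>R axis l 1"

text \<open>The generator of \<open>rot k l\<close>; differentiating along it is the field x_k d_l -
  x_l d_k. At \<open>k = l\<close> it is 0, so sums over all pairs may include the diagonal, whereas
  \<open>rot k k\<close> is no rotation; hence the assumptions \<open>k \<noteq> l\<close>.\<close>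

definition rot_gen :: "'n::finite \<Rightarrow> 'n \<Rightarrow> real ^ 'n \<Rightarrow> real ^ 'n" where
  "rot_gen k l x = x $ k *\<^sub>R axis l 1 - x $ l *\<^sub>R axis k 1"

lemma rot_nth:
  assumes "k \<noteq> l"
  shows "rot k l t x $ i = (if i = k then cos t * x $ k - sin t * x $ l
           else if i = l then sin t * x $ k + cos t * x $ l else x $ i)"
  using assms by (auto simp: rot_def axis_def algebra_simps)

lemma rot_zero [simp]: "rot k l 0 x = x"
  by (simp add: rot_def)

lemma rot_add: "k \<noteq> l \<Longrightarrow> rot k l s (rot k l t x) = rot k l (s + t) x"
  by (simp add: vec_eq_iff rot_nth cos_add sin_add) (auto simp: algebra_simps)

lemma rot_swap: "k \<noteq> l \<Longrightarrow> rot l k t x = rot k l (- t) x"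
  by (auto simp add: vec_eq_iff rot_nth)

lemma linear_rot: "linear (rot k l t)"
  by (rule linearI) (simp_all add: rot_def algebra_simps)

lemma bounded_linear_rot: "bounded_linear (rot k l t)"
  using linear_rot linear_conv_bounded_linear by blast

text \<open>The rotation acts on the pair (x_k, x_l), and \<open>C\<close> contains both indices or
  neither. \<open>C = UNIV\<close> gives norm preservation; other sets supply the block invariants
  for the approximation and the Gaussian test functions.\<close>

lemma sum_squares_rot:
  assumes kl: "k \<noteq> l" and C: "k \<in> C \<longleftrightarrow> l \<in> C"
  shows "(\<Sum>i\<in>C. (rot k l t x $ i)\<^sup>2) = (\<Sum>i\<in>C. (x $ i)\<^sup>2)"
proof (cases "k \<in> C")
  case True
  have *: "(\<Sum>i\<in>C. (y $ i)\<^sup>2) = (y $ k)\<^sup>2 + (y $ l)\<^sup>2 + (\<Sum>i\<in>C - {k, l}. (y $ i)\<^sup>2)" for y :: "real ^ 'a"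
  proof -
    have "(\<Sum>i\<in>C. (y $ i)\<^sup>2) = (\<Sum>i\<in>C - {k, l}. (y $ i)\<^sup>2) + (\<Sum>i\<in>{k, l}. (y $ i)\<^sup>2)"
      using True C by (intro sum.subset_diff) auto
    then show ?thesis using kl by simp
  qed
  have "(\<Sum>i\<in>C - {k, l}. (rot k l t x $ i)\<^sup>2) = (\<Sum>i\<in>C - {k, l}. (x $ i)\<^sup>2)"
    by (rule sum.cong) (auto simp: rot_nth kl)
  moreover have "(rot k l t x $ k)\<^sup>2 + (rot k l t x $ l)\<^sup>2 = ((cos t)\<^sup>2 + (sin t)\<^sup>2) * ((x $ k)\<^sup>2 + (x $ l)\<^sup>2)"
  proof -
    have "(c * a - s * b)\<^sup>2 + (s * a + c * b)\<^sup>2 = (c\<^sup>2 + s\<^sup>2) * (a\<^sup>2 + b\<^sup>2)" for a b c s :: real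
      by (simp add: algebra_simps power2_eq_square)
    moreover have "rot k l t x $ k = cos t * x $ k - sin t * x $ l" "rot k l t x $ l = sin t * x $ k + cos t * x $ l"
      using kl by (simp_all add: rot_nth)
    ultimately show ?thesis by simp
  qed
  ultimately show ?thesis by (simp add: *)
next
  case False
  then show ?thesis using C by (intro sum.cong) (auto simp: rot_nth kl)
qed

lemma norm_rot: "k \<noteq> l \<Longrightarrow> norm (rot k l t x) = norm x"
  using sum_squares_rot[of k l UNIV t x] by (simp add: norm_vec_def L2_set_def)

lemma orthogonal_transformation_rot: "k \<noteq> l \<Longrightarrow> orthogonal_transformation (rot k l t)"
  by (simp add: orthogonal_transformation linear_rot norm_rot)

lemma rot_in_sphere: "k \<noteq> l \<Longrightarrow> x \<in> sphere 0 1 \<Longrightarrow> rot k l t x \<in> sphere 0 1"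
  by (simp add: norm_rot)

lemma rot_has_vector_derivative:
  assumes "k \<noteq> l"
  shows "((\<lambda>t. rot k l t x) has_vector_derivative rot_gen k l (rot k l t x)) (at t)"
proof -
  have "((\<lambda>t. rot k l t x) has_vector_derivative
      (- sin t * x $ k - cos t * x $ l) *\<^sub>R axis k 1 + (cos t * x $ k - sin t * x $ l) *\<^sub>R axis l 1) (at t)"
    unfolding rot_def has_vector_derivative_def
    by (auto intro!: derivative_eq_intros simp: algebra_simps)
  moreover have "(- sin t * x $ k - cos t * x $ l) *\<^sub>R axis k 1 + (cos t * x $ k - sin t * x $ l) *\<^sub>R axis l 1
      = rot_gen k l (rot k l t x)"
    using assms by (simp add: rot_gen_def rot_nth algebra_simps)
  ultimately show ?thesis by simp
qed

subsection \<open>Integration on the sphere\<close>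

lemma space_sphere [simp]: "space (sphere_measure :: (real ^ 'n) measure) = sphere 0 1"
  by (rule space_sphere_measure)

lemma measurable_continuous_sphere:
  "continuous_on (sphere 0 1) f \<Longrightarrow> f \<in> borel_measurable (sphere_measure :: (real ^ 'n) measure)"
  for f :: "real ^ 'n \<Rightarrow> 'b::topological_space"
  using borel_measurable_continuous_on_restrict[of "sphere 0 1" f]
  by (simp add: measurable_cong_sets[OF sets_sphere_measure refl])

lemma continuous_sphere_bounded:
  fixes f :: "real ^ 'n \<Rightarrow> real"
  assumes "continuous_on (sphere 0 1) f"
  obtains B where "B \<ge> 0" "\<And>x. x \<in> sphere 0 1 \<Longrightarrow> \<bar>f x\<bar> \<le> B"
proof -
  have "bounded (f ` sphere 0 1)"
    by (intro compact_imp_bounded compact_continuous_image assms) simp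
  then obtain B where B: "\<forall>y\<in>f ` sphere 0 1. norm y \<le> B"
    unfolding bounded_iff by blast
  show ?thesis
  proof
    show "max B 0 \<ge> 0" by simp
    show "\<bar>f x\<bar> \<le> max B 0" if "x \<in> sphere 0 1" for x
      using B that by (fastforce simp: le_max_iff_disj)
  qed
qed

interpretation sph: prob_space "sphere_measure :: (real ^ 'n) measure"
  by (rule prob_space_sphere_measure)

lemma prob_sphere [simp]: "measure (sphere_measure :: (real ^ 'n) measure) (sphere 0 1) = 1"
  using sph.prob_space by simp

lemma integrable_continuous_sphere:
  fixes f :: "real ^ 'n \<Rightarrow> real"
  assumes "continuous_on (sphere 0 1) f"
  shows "integrable sphere_measure f"
proof -
  obtain B where "\<And>x. x \<in> sphere 0 1 \<Longrightarrow> \<bar>f x\<bar> \<le> B"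
    using continuous_sphere_bounded[OF assms] by metis
  then show ?thesis
    by (intro sph.integrable_const_bound[of _ B] measurable_continuous_sphere assms AE_I2) auto
qed

lemma sphere_integral_mono:
  fixes f g :: "real ^ 'n \<Rightarrow> real"
  assumes "continuous_on (sphere 0 1) f" "continuous_on (sphere 0 1) g"
    "\<And>x. x \<in> sphere 0 1 \<Longrightarrow> f x \<le> g x"
  shows "(\<integral>x. f x \<partial>sphere_measure) \<le> (\<integral>x. g x \<partial>sphere_measure)"
  using assms by (intro integral_mono integrable_continuous_sphere) auto

lemma sphere_integral_cong:
  fixes f g :: "real ^ 'n \<Rightarrow> real"
  assumes "\<And>x. x \<in> sphere 0 1 \<Longrightarrow> f x = g x"
  shows "(\<integral>x. f x \<partial>sphere_measure) = (\<integral>x. g x \<partial>sphere_measure)"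
  using assms by (intro Bochner_Integration.integral_cong) auto

lemma sphere_integral_const [simp]: "(\<integral>x. c \<partial>(sphere_measure :: (real ^ 'n) measure)) = (c::real)"
  by (simp add: sph.prob_space del: space_sphere)

lemma sphere_integral_rot:
  fixes f :: "real ^ ('n::{finite,wellorder}) \<Rightarrow> real"
  assumes "continuous_on (sphere 0 1) f" "k \<noteq> l"
  shows "(\<integral>x. f (rot k l t x) \<partial>sphere_measure) = (\<integral>x. f x \<partial>sphere_measure)"
proof -
  let ?\<sigma> = "sphere_measure :: (real ^ ('n::{finite,wellorder})) measure"
  have "rot k l t \<in> measurable ?\<sigma> ?\<sigma>"
  proof -
    have "rot k l t \<in> borel_measurable borel"
      by (intro borel_measurable_continuous_onI linear_continuous_on linear_conv_bounded_linear[THEN iffD1] linear_rot)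
    then show ?thesis
      by (simp cong: measurable_cong_sets add: sets_sphere_measure measurable_restrict_space3 norm_rot assms)
  qed
  from integral_distr[OF this measurable_continuous_sphere[OF assms(1)]]
  show ?thesis
    by (simp add: sphere_measure_rotation_invariant[OF orthogonal_transformation_rot[OF assms(2)]])
qed

text \<open>Full support of the measure: the preimage under \<open>sgn\<close> is open in the ball
  and contains x / 2. The origin is removed because \<open>sgn\<close> is discontinuous
  there.\<close>

lemma sphere_open_positive:
  fixes x :: "real ^ 'n"
  assumes "x \<in> sphere 0 1" "r > 0"
  shows "emeasure sphere_measure (sphere 0 1 \<inter> ball x r) > 0"
proof -
  let ?A = "sphere 0 1 \<inter> ball x r"
  let ?U = "(ball 0 1 - {0}) \<inter> sgn -` ball x r"
  have eq: "ball 0 1 \<inter> sgn -` ?A = ?U"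
    by (auto simp: norm_sgn)
  have "open ?U"
    by (rule continuous_open_preimage) (auto intro!: continuous_intros)
  moreover have "x /\<^sub>R 2 \<in> ?U"
    using assms by (auto simp: sgn_div_norm)
  ultimately have "\<not> negligible ?U"
    using open_not_negligible by blast
  moreover have "?U \<in> sets borel" using \<open>open ?U\<close> by simp
  ultimately have "emeasure lborel ?U \<noteq> 0"
    using null_sets_completionI[of ?U lborel] by (auto simp: negligible_iff_null_sets null_sets_def)
  moreover have "emeasure lborel (ball (0::real^'n) 1) < \<infinity>"
    using emeasure_bounded_finite[of "ball (0::real^'n) 1"] by simp
  ultimately have "emeasure lborel ?U / emeasure lborel (ball (0::real^'n) 1) > 0"
    by (simp add: zero_less_iff_neq_zero ennreal_divide_eq_0_iff less_top[symmetric])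
  moreover have "emeasure sphere_measure ?A = emeasure lborel ?U / emeasure lborel (ball (0 :: real ^ 'n) 1)"
    unfolding eq[symmetric] by (rule emeasure_sphere_measure) (auto simp: borel_closed)
  ultimately show ?thesis by simp
qed

lemma sphere_integral_eq_0:
  fixes f :: "real ^ 'n \<Rightarrow> real"
  assumes c: "continuous_on (sphere 0 1) f" and nn: "\<And>x. x \<in> sphere 0 1 \<Longrightarrow> 0 \<le> f x"
    and int: "(\<integral>x. f x \<partial>sphere_measure) \<le> 0" and x: "x \<in> sphere 0 1"
  shows "f x = 0"
proof (rule ccontr)
  assume "f x \<noteq> 0"
  with nn[OF x] have pos: "f x > 0" by simp
  obtain r where r: "r > 0" "\<And>y. y \<in> sphere 0 1 \<Longrightarrow> dist y x < r \<Longrightarrow> dist (f y) (f x) < f x"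
    using c x pos unfolding continuous_on_iff by meson
  have "(\<integral>x. f x \<partial>sphere_measure) = 0"
    using int by (intro antisym int integral_nonneg_AE AE_I2) (auto simp: nn)
  then have "AE y in sphere_measure. f y = 0"
    by (subst (asm) integral_nonneg_eq_0_iff_AE[OF integrable_continuous_sphere[OF c]])
       (use nn in \<open>auto intro!: AE_I2\<close>)
  then have "AE y in sphere_measure. y \<notin> sphere 0 1 \<inter> ball x r"
    by (rule AE_mp) (rule AE_I2, use r pos in \<open>force simp: dist_commute dist_real_def\<close>)
  moreover have "sphere 0 1 \<inter> ball x r \<in> sets (sphere_measure :: (real ^ 'n) measure)"
    by (auto simp: sets_sphere_measure sets_restrict_space)
  ultimately have "emeasure sphere_measure (sphere 0 1 \<inter> ball x r) = 0"
    using AE_iff_null_sets by (blast dest: null_setsD1)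
  with sphere_open_positive[OF x r(1)] show False by simp
qed

subsection \<open>Derivatives along plane rotations\<close>

text \<open>By the one-parameter group law, derivatives at time 0 at all points of the sphere
  determine the derivative at every time.\<close>

lemma rot_derivative_everywhere:
  assumes "k \<noteq> l" and "x \<in> sphere 0 1"
    and d: "\<And>x. x \<in> sphere 0 1 \<Longrightarrow> ((\<lambda>t. F (rot k l t x)) has_real_derivative G x) (at 0)"
  shows "((\<lambda>t. F (rot k l t x)) has_real_derivative G (rot k l t x)) (at t)"
proof -
  have "((\<lambda>s. F (rot k l s (rot k l t x))) has_real_derivative G (rot k l t x)) (at 0)"
    using rot_in_sphere[OF assms(1,2)] by (rule d)
  then have "((\<lambda>s. F (rot k l (s + t) x)) has_real_derivative G (rot k l t x)) (at 0)"
    by (simp add: rot_add assms)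
  then show ?thesis
    using DERIV_shift[of "\<lambda>s. F (rot k l s x)" "G (rot k l t x)" 0 t] by simp
qed

text \<open>Integration by parts in its basic form. Rotation invariance gives every difference
  quotient integral 0; the mean value theorem bounds the quotients by the supremum of |G|, so
  dominated convergence applies.\<close>

lemma sphere_integral_rot_derivative:
  fixes F G :: "real ^ ('n::{finite,wellorder}) \<Rightarrow> real"
  assumes kl: "k \<noteq> l" and F: "continuous_on (sphere 0 1) F" and G: "continuous_on (sphere 0 1) G"
    and d: "\<And>x. x \<in> sphere 0 1 \<Longrightarrow> ((\<lambda>t. F (rot k l t x)) has_real_derivative G x) (at 0)"
  shows "(\<integral>x. G x \<partial>sphere_measure) = 0"
proof -
  let ?\<sigma> = "sphere_measure :: (real ^ ('n::{finite,wellorder})) measure"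
  define h where "h n = 1 / real (Suc n)" for n
  have hpos: "h n > 0" for n by (simp add: h_def)
  define Q where "Q n x = (F (rot k l (h n) x) - F x) / h n" for n x
  obtain B where B: "\<And>x. x \<in> sphere 0 1 \<Longrightarrow> \<bar>G x\<bar> \<le> B"
    using continuous_sphere_bounded[OF G] by metis
  have crot: "continuous_on (sphere 0 1) (\<lambda>x. F (rot k l t x))" for t
    by (rule continuous_on_compose2[OF F linear_continuous_on[OF bounded_linear_rot]])
       (use rot_in_sphere[OF kl] in auto)
  have cQ: "continuous_on (sphere 0 1) (Q n)" for n
    unfolding Q_def using hpos[of n] by (intro continuous_intros crot F) auto
  have bQ: "\<bar>Q n x\<bar> \<le> B" if x: "x \<in> sphere 0 1" for n x
  proof -
    have "\<exists>z>0. z < h n \<and> F (rot k l (h n) x) - F (rot k l 0 x) = (h n - 0) * G (rot k l z x)"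
      using hpos by (intro MVT2 rot_derivative_everywhere[OF kl x d]) auto
    then obtain z where "Q n x = G (rot k l z x)"
      using hpos[of n] by (auto simp: Q_def)
    then show ?thesis using B[OF rot_in_sphere[OF kl x]] by simp
  qed
  have lim: "(\<lambda>n. Q n x) \<longlonglongrightarrow> G x" if x: "x \<in> sphere 0 1" for x
  proof -
    have "((\<lambda>s. (F (rot k l (0 + s) x) - F (rot k l 0 x)) / s) \<longlongrightarrow> G x) (at 0)"
      using d[OF x] by (simp add: DERIV_def)
    moreover have "h \<longlonglongrightarrow> 0"
      unfolding h_def using LIMSEQ_inverse_real_of_nat by (simp add: inverse_eq_divide)
    then have "filterlim h (at 0) sequentially"
      unfolding filterlim_at using hpos by (auto simp: less_imp_neq[THEN not_sym])
    ultimately show ?thesis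
      unfolding Q_def by (auto dest: filterlim_compose)
  qed
  have "(\<lambda>n. \<integral>x. Q n x \<partial>?\<sigma>) \<longlonglongrightarrow> (\<integral>x. G x \<partial>?\<sigma>)"
    by (rule integral_dominated_convergence[where w="\<lambda>_. B"])
       (auto intro!: measurable_continuous_sphere cQ G AE_I2 lim bQ simp: bQ)
  moreover have "(\<integral>x. Q n x \<partial>?\<sigma>) = 0" for n
    unfolding Q_def using sphere_integral_rot[OF F kl, of "h n"]
    by (simp add: Bochner_Integration.integral_diff integrable_continuous_sphere crot F)
  ultimately show ?thesis
    by (simp add: LIMSEQ_const_iff)
qed

lemma rot_invariantI:
  assumes "k \<noteq> l" "x \<in> sphere 0 1"
    and "\<And>x. x \<in> sphere 0 1 \<Longrightarrow> ((\<lambda>t. F (rot k l t x)) has_real_derivative 0) (at 0)"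
  shows "F (rot k l t x) = F x"
  using DERIV_isconst_all[of "\<lambda>t. F (rot k l t x)" t 0]
    rot_derivative_everywhere[OF assms(1,2), of F "\<lambda>_. 0"] assms(3) by simp

subsection \<open>Polynomial functions\<close>

text \<open>Functions on the whole space rather than on the sphere, so that Frechet derivatives
  apply. As \<open>const\<close> is available at every \<open>d\<close>, the index is only an upper
  bound for the degree.\<close>

inductive spoly :: "nat \<Rightarrow> (real ^ 'n::finite \<Rightarrow> real) \<Rightarrow> bool" where
  const: "spoly d (\<lambda>x. c)"
| add: "spoly d F \<Longrightarrow> spoly d G \<Longrightarrow> spoly d (\<lambda>x. F x + G x)"
| mult: "spoly d F \<Longrightarrow> spoly (Suc d) (\<lambda>x. x $ i * F x)"

lemma spoly_cmult: "spoly d F \<Longrightarrow> spoly d (\<lambda>x. c * F x)"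
proof (induction rule: spoly.induct)
  case (mult d F i)
  then show ?case using spoly.mult[OF mult.IH, of i] by (simp add: mult_ac)
qed (auto intro: spoly.intros simp: algebra_simps)

lemma spoly_diff: "spoly d F \<Longrightarrow> spoly d G \<Longrightarrow> spoly d (\<lambda>x. F x - G x)"
  using spoly.add[of d F "\<lambda>x. -1 * G x"] spoly_cmult[of d G "-1"] by simp

lemma spoly_sum: "finite A \<Longrightarrow> (\<And>i. i \<in> A \<Longrightarrow> spoly d (F i)) \<Longrightarrow> spoly d (\<lambda>x. \<Sum>i\<in>A. F i x)"
  by (induction A rule: finite_induct) (auto intro: spoly.intros)

lemma spoly_Suc: "spoly d F \<Longrightarrow> spoly (Suc d) F"
  by (induction rule: spoly.induct) (auto intro: spoly.intros)

lemma spoly_mono: "d \<le> e \<Longrightarrow> spoly d F \<Longrightarrow> spoly e F"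
  by (induction e rule: dec_induct) (auto intro: spoly_Suc)

lemma spoly_mult: "spoly d F \<Longrightarrow> spoly e G \<Longrightarrow> spoly (d + e) (\<lambda>x. F x * G x)"
proof (induction rule: spoly.induct)
  case (const d c)
  then show ?case by (intro spoly_cmult) (rule spoly_mono[of e], auto)
next
  case (add d F G)
  then show ?case by (simp add: distrib_right spoly.add)
next
  case (mult d F i)
  then show ?case using spoly.mult[OF mult.IH, of i] by (simp add: mult_ac)
qed

lemma spoly_nth: "spoly 1 (\<lambda>x. x $ i)"
  using spoly.mult[OF spoly.const[of 0 1], of i] by simp

lemma spoly_linear:
  assumes "linear (f :: real ^ 'n \<Rightarrow> real)"
  shows "spoly 1 f"
proof -
  have "f = (\<lambda>x. \<Sum>i\<in>UNIV. x $ i * f (axis i 1))"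
  proof
    fix x
    have "f x = f (\<Sum>i\<in>UNIV. x $ i *\<^sub>R axis i 1)"
      using basis_expansion[of x] by (simp add: scalar_mult_eq_scaleR)
    then show "f x = (\<Sum>i\<in>UNIV. x $ i * f (axis i 1))"
      by (simp add: linear_sum[OF assms] linear_cmul[OF assms])
  qed
  moreover have "spoly 1 (\<lambda>x. \<Sum>i\<in>UNIV. x $ i * f (axis i 1))"
    using spoly.mult[OF spoly.const[of 0]] by (intro spoly_sum) auto
  ultimately show ?thesis by metis
qed

lemma spoly_linear_compose:
  assumes "linear (R :: real ^ 'n \<Rightarrow> real ^ 'n)"
  shows "spoly d F \<Longrightarrow> spoly d (\<lambda>x. F (R x))"
proof (induction rule: spoly.induct)
  case (mult d F i)
  have "linear (\<lambda>x. R x $ i)"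
    by (rule linearI) (simp_all add: linear_add[OF assms] linear_cmul[OF assms])
  from spoly_mult[OF spoly_linear[OF this] mult.IH] show ?case by simp
qed (auto intro: spoly.intros)

lemma spoly_continuous: "spoly d F \<Longrightarrow> continuous_on A F"
  by (induction rule: spoly.induct) (auto intro!: continuous_intros)

lemma spoly_differentiable: "spoly d F \<Longrightarrow> F differentiable (at x)"
proof (induction rule: spoly.induct)
  case (mult d F i)
  moreover have "(\<lambda>x. x $ i) differentiable (at x)" for x :: "real ^ 'a"
    using bounded_linear_vec_nth bounded_linear_imp_differentiable by blast
  ultimately show ?case by (intro differentiable_mult) auto
qed (auto intro: differentiable_add)

subsection \<open>The rotation derivatives of a polynomial\<close>

text \<open>The rotation field applied to an ambient function, without the radial extension used in
  \<open>rotation_field\<close>. The generator is tangent to the sphere, so both give the same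
  derivative there.\<close>

definition rd :: "'n::finite \<Rightarrow> 'n \<Rightarrow> (real ^ 'n \<Rightarrow> real) \<Rightarrow> real ^ 'n \<Rightarrow> real" where
  "rd k l F x = frechet_derivative F (at x) (rot_gen k l x)"

lemma rot_differentiable:
  assumes "k \<noteq> l" "F differentiable (at x)"
  shows "((\<lambda>t. F (rot k l t x)) has_real_derivative frechet_derivative F (at x) (rot_gen k l x)) (at 0)"
proof -
  have "(F has_derivative frechet_derivative F (at x)) (at (rot k l 0 x))"
    using frechet_derivative_works[THEN iffD1, OF assms(2)] by simp
  from vector_derivative_diff_chain_within[OF rot_has_vector_derivative[OF assms(1), of x 0, folded has_vector_derivative_def] has_derivative_at_withinI[OF this]]
  show ?thesis
    by (simp add: o_def has_real_derivative_iff_has_vector_derivative)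
qed

lemma rd_rot_derivative:
  "k \<noteq> l \<Longrightarrow> spoly d F \<Longrightarrow> ((\<lambda>t. F (rot k l t x)) has_real_derivative rd k l F x) (at 0)"
  unfolding rd_def by (intro rot_differentiable spoly_differentiable)

lemma rd_same [simp]: "rd k k F x = 0" if "spoly d F"
  using linear_0[OF linear_frechet_derivative[OF spoly_differentiable[OF that]]]
  by (simp add: rd_def rot_gen_def)

lemma rd_const [simp]: "rd k l (\<lambda>x. c) x = 0"
  by (simp add: rd_def)

lemma rd_add:
  assumes "spoly d F" "spoly e G"
  shows "rd k l (\<lambda>x. F x + G x) x = rd k l F x + rd k l G x"
proof -
  have "(F has_derivative frechet_derivative F (at x)) (at x)" "(G has_derivative frechet_derivative G (at x)) (at x)"
    using assms spoly_differentiable frechet_derivative_works by blast+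
  from frechet_derivative_at[OF has_derivative_add[OF this]] show ?thesis
    unfolding rd_def by metis
qed

lemma rd_mult:
  assumes "spoly d F" "spoly e G"
  shows "rd k l (\<lambda>x. F x * G x) x = F x * rd k l G x + rd k l F x * G x"
proof -
  have "(F has_derivative frechet_derivative F (at x)) (at x)" "(G has_derivative frechet_derivative G (at x)) (at x)"
    using assms spoly_differentiable frechet_derivative_works by blast+
  from has_derivative_mult[OF this]
  have "((\<lambda>x. F x * G x) has_derivative (\<lambda>h. F x * frechet_derivative G (at x) h + frechet_derivative F (at x) h * G x)) (at x)" .
  from frechet_derivative_at[OF this] show ?thesis
    unfolding rd_def by metis
qed

lemma rd_linear:
  assumes "linear (f :: real ^ 'n \<Rightarrow> real)"
  shows "rd k l f x = f (rot_gen k l x)"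
proof -
  have "(f has_derivative f) (at x)"
    using assms linear_conv_bounded_linear bounded_linear_imp_has_derivative by blast
  from frechet_derivative_at[OF this] show ?thesis unfolding rd_def by metis
qed

lemma linear_rot_gen: "linear (rot_gen k l)"
  by (rule linearI) (simp_all add: rot_gen_def algebra_simps)

lemma linear_rot_gen_compose: "linear f \<Longrightarrow> linear (\<lambda>x. f (rot_gen k l x))"
  using linear_compose[OF linear_rot_gen] by (simp add: o_def)

lemma linear_vec_nth: "linear (\<lambda>x :: real ^ 'n. x $ i)"
  by (rule linearI) simp_all

text \<open>Differentiation turns a factor \<open>x $ i\<close> into a linear form, so the degree
  does not grow. This keeps the heat step among the polynomials of degree at most
  \<open>d\<close>.\<close>

lemma spoly_rd: "spoly d F \<Longrightarrow> spoly d (rd k l F)"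
proof (induction rule: spoly.induct)
  case (const d c)
  have "rd k l (\<lambda>x. c) = (\<lambda>x. 0)" by (simp add: fun_eq_iff)
  then show ?case by (simp add: spoly.const)
next
  case (add d F G)
  have "rd k l (\<lambda>x. F x + G x) = (\<lambda>x. rd k l F x + rd k l G x)"
    using rd_add[OF add.hyps] by (simp add: fun_eq_iff)
  then show ?case using add.IH by (simp add: spoly.add)
next
  case (mult d F i)
  have "rd k l (\<lambda>x. x $ i * F x) = (\<lambda>x. x $ i * rd k l F x + rot_gen k l x $ i * F x)"
    by (simp only: fun_eq_iff rd_mult[OF spoly_nth mult.hyps] rd_linear[OF linear_vec_nth] simp_thms)
  moreover have "spoly (Suc d) (\<lambda>x. rot_gen k l x $ i * F x)"
    using spoly_mult[OF spoly_linear[OF linear_rot_gen_compose[OF linear_vec_nth]] mult.hyps] by simp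
  ultimately show ?case using mult.IH by (simp add: spoly.intros)
qed

text \<open>The curve \<open>rot k l t x\<close> stays on the sphere, so only the values there
  enter.\<close>

lemma rd_cong_sphere:
  assumes "spoly d F" "spoly e G" "\<And>x. x \<in> sphere 0 1 \<Longrightarrow> F x = G x" "x \<in> sphere 0 1"
  shows "rd k l F x = rd k l G x"
proof (cases "k = l")
  case False
  have "(\<lambda>t. F (rot k l t x)) = (\<lambda>t. G (rot k l t x))"
    using assms(3) rot_in_sphere[OF False assms(4)] by auto
  with rd_rot_derivative[OF False assms(1), of x] rd_rot_derivative[OF False assms(2), of x]
  show ?thesis by (metis DERIV_unique)
qed (use assms rd_same in metis)

lemma sphere_integral_rd:
  fixes F :: "real ^ ('n::{finite,wellorder}) \<Rightarrow> real"
  assumes "spoly d F"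
  shows "(\<integral>x. rd k l F x \<partial>sphere_measure) = 0"
proof (cases "k = l")
  case False
  then show ?thesis
    by (intro sphere_integral_rot_derivative[of k l F] rd_rot_derivative[OF _ assms] spoly_continuous[OF assms]
        spoly_continuous[OF spoly_rd[OF assms]] assms)
qed (use rd_same[OF assms] in simp)

text \<open>The sum runs over all ordered pairs, so this is twice the spherical Laplacian.\<close>

definition lap :: "(real ^ 'n::finite \<Rightarrow> real) \<Rightarrow> real ^ 'n \<Rightarrow> real" where
  "lap F x = (\<Sum>k\<in>UNIV. \<Sum>l\<in>UNIV. rd k l (rd k l F) x)"

lemma spoly_lap: "spoly d F \<Longrightarrow> spoly d (lap F)"
  unfolding lap_def by (intro spoly_sum spoly_rd) auto

lemma sphere_integral_lap:
  fixes F :: "real ^ ('n::{finite,wellorder}) \<Rightarrow> real"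
  assumes "spoly d F"
  shows "(\<integral>x. lap F x \<partial>sphere_measure) = 0"
  unfolding lap_def
  by (simp add: Bochner_Integration.integral_sum integrable_continuous_sphere spoly_continuous[OF spoly_rd[OF spoly_rd[OF assms]]]
      sphere_integral_rd[OF spoly_rd[OF assms]])

lemma lap_cong_sphere:
  assumes "spoly d F" "spoly e G" "\<And>x. x \<in> sphere 0 1 \<Longrightarrow> F x = G x" "x \<in> sphere 0 1"
  shows "lap F x = lap G x"
  unfolding lap_def
  by (intro sum.cong refl rd_cong_sphere[OF spoly_rd[OF assms(1)] spoly_rd[OF assms(2)]]
      rd_cong_sphere[OF assms(1,2)] assms(3,4))

lemma lap_add:
  assumes "spoly d F" "spoly e G"
  shows "lap (\<lambda>x. F x + G x) x = lap F x + lap G x"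
proof -
  have "rd k l (\<lambda>x. F x + G x) = (\<lambda>x. rd k l F x + rd k l G x)" for k l
    using rd_add[OF assms] by auto
  then show ?thesis
    by (simp add: lap_def rd_add[OF spoly_rd[OF assms(1)] spoly_rd[OF assms(2)]] sum.distrib)
qed

lemma lap_mult:
  assumes F: "spoly d F" and G: "spoly e G"
  shows "lap (\<lambda>x. F x * G x) x = F x * lap G x + lap F x * G x
           + 2 * (\<Sum>k\<in>UNIV. \<Sum>l\<in>UNIV. rd k l F x * rd k l G x)"
proof -
  have "rd k l (\<lambda>x. F x * G x) = (\<lambda>x. F x * rd k l G x + rd k l F x * G x)" for k l
    using rd_mult[OF F G] by auto
  then have "rd k l (rd k l (\<lambda>x. F x * G x)) x
      = F x * rd k l (rd k l G) x + rd k l (rd k l F) x * G x + 2 * (rd k l F x * rd k l G x)" for k l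
    by (simp add: rd_add[OF spoly_mult[OF F spoly_rd[OF G]] spoly_mult[OF spoly_rd[OF F] G]]
        rd_mult[OF F spoly_rd[OF G]] rd_mult[OF spoly_rd[OF F] G])
  then show ?thesis
    by (simp add: lap_def sum.distrib sum_distrib_left sum_distrib_right)
qed

text \<open>The Gram matrix of the rotation fields at \<open>x\<close> is twice |x|^2 I - x x^T. The
  right-hand side involves only inner products and \<open>f\<close>, so it is visibly compatible
  with orthogonal maps, unlike the individual fields.\<close>

lemma rot_gen_gram:
  assumes "linear (f :: real ^ 'n \<Rightarrow> real)"
  shows "(\<Sum>k\<in>UNIV. \<Sum>l\<in>UNIV. (r \<bullet> rot_gen k l x) * f (rot_gen k l x))
       = 2 * ((x \<bullet> x) * f r - (r \<bullet> x) * f x)"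
proof -
  have e: "f y = (\<Sum>i\<in>UNIV. y $ i * f (axis i 1))" for y
  proof -
    have "f y = f (\<Sum>i\<in>UNIV. y $ i *\<^sub>R axis i 1)"
      using basis_expansion[of y] by (simp add: scalar_mult_eq_scaleR)
    then show ?thesis
      by (simp add: linear_sum[OF assms] linear_cmul[OF assms])
  qed
  let ?f = "\<lambda>i. f (axis i 1)"
  have 1: "r \<bullet> rot_gen k l x = x $ k * r $ l - x $ l * r $ k" for k l
    by (simp add: rot_gen_def inner_diff_right inner_axis)
  have 2: "f (rot_gen k l x) = x $ k * ?f l - x $ l * ?f k" for k l
    by (simp add: rot_gen_def linear_diff[OF assms] linear_cmul[OF assms])
  have "(\<Sum>k\<in>UNIV. \<Sum>l\<in>UNIV. (r \<bullet> rot_gen k l x) * f (rot_gen k l x))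
     = (\<Sum>k\<in>UNIV. \<Sum>l\<in>UNIV. (x $ k * x $ k) * (r $ l * ?f l)) + (\<Sum>k\<in>UNIV. \<Sum>l\<in>UNIV. (r $ k * ?f k) * (x $ l * x $ l))
       - (\<Sum>k\<in>UNIV. \<Sum>l\<in>UNIV. (r $ k * x $ k) * (x $ l * ?f l)) - (\<Sum>k\<in>UNIV. \<Sum>l\<in>UNIV. (x $ k * ?f k) * (r $ l * x $ l))"
    unfolding 1 2 by (simp add: sum.distrib[symmetric] sum_subtractf[symmetric] algebra_simps)
  also have "\<dots> = 2 * ((x \<bullet> x) * f r - (r \<bullet> x) * f x)"
    unfolding e[of r] e[of x] inner_vec_def inner_real_def sum_product[symmetric] by (simp add: algebra_simps)
  finally show ?thesis .
qed

text \<open>Linear functions are spherical harmonics of degree 1, with eigenvalue -(n - 1) of the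
  Laplacian; the factor 2 comes from summing over ordered pairs.\<close>

lemma lap_inner: "lap (\<lambda>x. r \<bullet> x) x = - 2 * (real CARD('n) - 1) * (r \<bullet> x)" for x :: "real ^ 'n"
proof -
  have lin: "linear ((\<bullet>) r)" by (rule bounded_linear.linear[OF bounded_linear_inner_right])
  have "rd k l ((\<bullet>) r) = (\<lambda>x. r \<bullet> rot_gen k l x)" for k l
    using rd_linear[OF lin] by auto
  then have *: "rd k l (rd k l ((\<bullet>) r)) x = r \<bullet> rot_gen k l (rot_gen k l x)" for k l
    using rd_linear[OF linear_rot_gen_compose[OF lin]] by auto
  \<comment> \<open>The conditional restores 0 on the diagonal, where \<open>rot_gen k k\<close>
    vanishes.\<close>
  have **: "r \<bullet> rot_gen k l (rot_gen k l x) = (if k = l then x $ k * r $ k + x $ l * r $ l else 0) - x $ l * r $ l - x $ k * r $ k" for k l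
    by (simp add: rot_gen_def inner_diff_right inner_axis) (simp add: axis_def algebra_simps)
  have "lap ((\<bullet>) r) x = (\<Sum>k\<in>UNIV. 2 * (r $ k * x $ k)) - (\<Sum>k::'n\<in>UNIV. \<Sum>l\<in>UNIV. r $ l * x $ l)
      - (\<Sum>k\<in>UNIV. \<Sum>l::'n\<in>UNIV. r $ k * x $ k)"
    unfolding lap_def * ** by (simp add: sum_subtractf mult.commute)
  also have "\<dots> = 2 * (r \<bullet> x) - real CARD('n) * (r \<bullet> x) - real CARD('n) * (r \<bullet> x)"
    by (simp add: inner_vec_def sum_distrib_left)
  finally show ?thesis by (simp add: algebra_simps)
qed

text \<open>Induction over the construction of \<open>F\<close>. For a product with a coordinate,
  \<open>lap_mult\<close> leaves a mixed term, which \<open>rot_gen_gram\<close> expresses through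
  quantities preserved by \<open>R\<close>.\<close>

lemma lap_orthogonal:
  fixes R :: "real ^ 'n \<Rightarrow> real ^ 'n"
  assumes R: "orthogonal_transformation R"
  shows "spoly d F \<Longrightarrow> lap (\<lambda>x. F (R x)) x = lap F (R x)"
proof (induction arbitrary: x rule: spoly.induct)
  case (const d c)
  have "rd k l (\<lambda>x. c) = (\<lambda>x. 0)" for k l :: 'n by (simp add: fun_eq_iff)
  then show ?case by (simp add: lap_def)
next
  case (add d F G)
  have lin: "linear R" by (rule orthogonal_transformation_linear[OF R])
  show ?case
    by (subst lap_add[OF spoly_linear_compose[OF lin add.hyps(1)] spoly_linear_compose[OF lin add.hyps(2)]])
       (simp add: lap_add[OF add.hyps] add.IH)
next
  case (mult d F i)
  have lin: "linear R" by (rule orthogonal_transformation_linear[OF R])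
  \<comment> \<open>The vector representing the functional \<open>R x $ i\<close>; orthogonality
    gives \<open>R r = axis i 1\<close>.\<close>
  define r where "r = adjoint R (axis i 1)"
  have r: "R y $ i = r \<bullet> y" for y
    using adjoint_works[OF lin, of y "axis i 1"] by (simp add: r_def inner_axis inner_commute)
  have Rr: "R (adjoint R y) = y" for y
  proof -
    have "inj R" "surj R" using orthogonal_transformation_inj[OF R] orthogonal_transformation_surj[OF R] by auto
    then obtain z where z: "y = R z" by (metis surjD)
    have "adjoint R (R z) = z"
      by (rule vector_eq_rdot[THEN iffD1]) (simp add: adjoint_works[OF lin] inner_commute R[unfolded orthogonal_transformation_def])
    then show ?thesis using z by simp
  qed
  have lin_i: "linear (\<lambda>x. r \<bullet> x)" for r :: "real ^ 'n" by (rule bounded_linear.linear[OF bounded_linear_inner_right])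
  define f where "f = frechet_derivative F (at (R x))"
  have f: "linear f" unfolding f_def by (intro linear_frechet_derivative spoly_differentiable[OF mult.hyps])
  have "((\<lambda>x. F (R x)) has_derivative (\<lambda>h. f (R h))) (at x)"
    using has_derivative_compose[of R R x UNIV F f] linear_imp_has_derivative[OF lin, of "at x"]
      spoly_differentiable[OF mult.hyps] frechet_derivative_works by (auto simp: f_def o_def)
  then have rdF: "rd k l (\<lambda>x. F (R x)) x = f (R (rot_gen k l x))" for k l
    unfolding rd_def using frechet_derivative_at by metis
  have lfR: "linear (\<lambda>h. f (R h))" using linear_compose[OF lin f] by (simp add: o_def)
  have "(\<Sum>k\<in>UNIV. \<Sum>l\<in>UNIV. rd k l (\<lambda>x. r \<bullet> x) x * rd k l (\<lambda>x. F (R x)) x)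
      = 2 * ((x \<bullet> x) * f (R r) - (r \<bullet> x) * f (R x))"
    by (simp add: rdF rd_linear[OF lin_i] rot_gen_gram[OF lfR])
  also have "R r = axis i 1" by (simp add: r_def Rr)
  also have "x \<bullet> x = R x \<bullet> R x" using R by (simp add: orthogonal_transformation_def)
  also have "r \<bullet> x = axis i 1 \<bullet> R x" using r[of x] by (simp add: inner_axis')
  also have "2 * ((R x \<bullet> R x) * f (axis i 1) - (axis i 1 \<bullet> R x) * f (R x))
      = (\<Sum>k\<in>UNIV. \<Sum>l\<in>UNIV. rd k l (\<lambda>x. axis i 1 \<bullet> x) (R x) * rd k l F (R x))"
    unfolding rd_linear[OF lin_i] rot_gen_gram[OF f, symmetric] by (simp only: rd_def f_def)
  finally have gram: "(\<Sum>k\<in>UNIV. \<Sum>l\<in>UNIV. rd k l (\<lambda>x. r \<bullet> x) x * rd k l (\<lambda>x. F (R x)) x)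
      = (\<Sum>k\<in>UNIV. \<Sum>l\<in>UNIV. rd k l (\<lambda>x. axis i 1 \<bullet> x) (R x) * rd k l F (R x))" .
  have ax: "y $ i = axis i 1 \<bullet> y" for y :: "real ^ 'n" by (simp add: inner_axis')
  have "lap (\<lambda>x. R x $ i * F (R x)) x = lap (\<lambda>x. (r \<bullet> x) * F (R x)) x"
    by (simp only: r)
  also have "\<dots> = (r \<bullet> x) * lap F (R x) - 2 * (real CARD('n) - 1) * (r \<bullet> x) * F (R x)
      + 2 * (\<Sum>k\<in>UNIV. \<Sum>l\<in>UNIV. rd k l (\<lambda>x. r \<bullet> x) x * rd k l (\<lambda>x. F (R x)) x)"
    unfolding lap_mult[OF spoly_linear[OF lin_i] spoly_linear_compose[OF lin mult.hyps]] mult.IH lap_inner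
    by (simp add: algebra_simps)
  also have "\<dots> = lap (\<lambda>x. (axis i 1 \<bullet> x) * F x) (R x)"
    unfolding gram lap_mult[OF spoly_linear[OF lin_i] mult.hyps] lap_inner r[of x, symmetric] ax[of "R x", symmetric]
    by (simp add: algebra_simps)
  finally show ?case by (simp only: ax)
qed

subsection \<open>Functions invariant under block rotations\<close>

text \<open>\<open>E\<close> is the relation of lying in the same block. Invariance under finite
  rotations, in place of vanishing derivatives, also makes sense for functions that are only
  continuous, such as \<open>f J x powr p\<close>.\<close>

definition rot_invariant :: "('n::finite \<Rightarrow> 'n \<Rightarrow> bool) \<Rightarrow> (real ^ 'n \<Rightarrow> real) \<Rightarrow> bool" where
  "rot_invariant E F \<longleftrightarrow> (\<forall>k l t. \<forall>x\<in>sphere 0 1. k \<noteq> l \<longrightarrow> E k l \<longrightarrow> F (rot k l t x) = F x)"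

lemma rot_invariantD:
  "rot_invariant E F \<Longrightarrow> k \<noteq> l \<Longrightarrow> E k l \<Longrightarrow> x \<in> sphere 0 1 \<Longrightarrow> F (rot k l t x) = F x"
  by (simp add: rot_invariant_def)

lemma rot_to_axis:
  assumes "k \<noteq> l"
  obtains t where "rot k l t x $ l = 0" "rot k l t x $ k \<ge> 0"
proof -
  let ?z = "Complex (x $ k) (x $ l)"
  let ?\<theta> = "Arg ?z"
  have k: "x $ k = cmod ?z * cos ?\<theta>" and l: "x $ l = cmod ?z * sin ?\<theta>"
    using Re_rcis[of "cmod ?z" ?\<theta>] Im_rcis[of "cmod ?z" ?\<theta>] rcis_cmod_Arg[of ?z] by simp_all
  have "rot k l (- ?\<theta>) x $ l = 0"
    using assms by (simp add: rot_nth) (subst (1) k, subst (2) l, simp)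
  moreover have "rot k l (- ?\<theta>) x $ k \<ge> 0"
  proof -
    have "rot k l (- ?\<theta>) x $ k = cos ?\<theta> * x $ k + sin ?\<theta> * x $ l"
      using assms by (simp add: rot_nth)
    also have "\<dots> = cmod ?z * ((cos ?\<theta>)\<^sup>2 + (sin ?\<theta>)\<^sup>2)"
      by (subst (1) k, subst (2) l) (simp only: power2_eq_square algebra_simps)
    finally show ?thesis by simp
  qed
  ultimately show ?thesis using that by blast
qed

text \<open>Within each block the coordinates are rotated one after another into a chosen
  representative. The points so reached form a section of the action of the block rotations. The
  coordinate of a singleton block, including its sign, stays untouched.\<close>

lemma rot_reduce:
  fixes E :: "'n::finite \<Rightarrow> 'n \<Rightarrow> bool"
  assumes E: "equivp E" and rep: "\<And>i. E i (rep i)" "\<And>i j. E i j \<Longrightarrow> rep i = rep j"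
    and x: "x \<in> sphere 0 1"
  shows "\<exists>y\<in>sphere 0 1. (\<forall>i. rep i \<noteq> i \<longrightarrow> y $ i = 0 \<and> 0 \<le> y $ rep i)
           \<and> (\<forall>F. rot_invariant E F \<longrightarrow> F y = F x)"
proof -
  \<comment> \<open>Collects the coordinates still to be cleared and the representatives that are
    still negative. A rotation in the plane of \<open>rep i\<close> and \<open>i\<close> repairs
    these two and alters no other coordinate, so \<open>W\<close> shrinks.\<close>
  define W where "W x = {i. rep i \<noteq> i \<and> x $ i \<noteq> 0} \<union> {rep i | i. rep i \<noteq> i \<and> x $ rep i < 0}" for x :: "real ^ 'n"
  have rr: "rep (rep i) = rep i" for i using rep by metis
  show ?thesis using x
  proof (induction "card (W x)" arbitrary: x rule: less_induct)
    case less
    show ?case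
    proof (cases "\<exists>i. rep i \<noteq> i \<and> (x $ i \<noteq> 0 \<or> x $ rep i < 0)")
      case False
      then show ?thesis using less.prems by (intro bexI[of _ x]) (auto simp: not_less)
    next
      case True
      then obtain i where i: "rep i \<noteq> i" "x $ i \<noteq> 0 \<or> x $ rep i < 0" by blast
      obtain t where t: "rot (rep i) i t x $ i = 0" "rot (rep i) i t x $ rep i \<ge> 0"
        using rot_to_axis[OF i(1)] by blast
      let ?y = "rot (rep i) i t x"
      have y: "?y \<in> sphere 0 1" by (rule rot_in_sphere[OF i(1) less.prems])
      have other: "?y $ j = x $ j" if "j \<noteq> i" "j \<noteq> rep i" for j
        using that i(1) by (simp add: rot_nth)
      have "j \<noteq> i \<and> j \<noteq> rep i \<and> j \<in> W x" if j: "j \<in> W ?y" for j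
      proof -
        have ji: "j \<noteq> i" using j t i rr unfolding W_def by (auto; metis)
        have jr: "j \<noteq> rep i" using j t rr unfolding W_def by (auto; metis not_less)
        show ?thesis using ji jr j other unfolding W_def by (auto; metis)
      qed
      moreover have "i \<in> W x \<or> rep i \<in> W x" using i unfolding W_def by blast
      ultimately have "W ?y \<subset> W x" by blast
      then have "card (W ?y) < card (W x)" by (intro psubset_card_mono) auto
      from less.hyps[OF this y] obtain z where z: "z \<in> sphere 0 1"
        "\<forall>i. rep i \<noteq> i \<longrightarrow> z $ i = 0 \<and> 0 \<le> z $ rep i" "\<forall>F. rot_invariant E F \<longrightarrow> F z = F ?y" by blast
      have "E (rep i) i" using E rep(1) by (metis equivp_symp)
      then have "F ?y = F x" if "rot_invariant E F" for F
        using rot_invariantD[OF that i(1)] less.prems by blast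
      with z show ?thesis by (intro bexI[of _ z]) auto
    qed
  qed
qed

text \<open>With a single block every point reduces to \<open>axis a 1\<close>. The second
  coordinate is what allows the sign of the first to be made positive; in dimension 1 the sphere
  consists of two points.\<close>

lemma rot_invariant_all_constant:
  fixes F :: "real ^ 'n \<Rightarrow> real"
  assumes "CARD('n) \<ge> 2" "rot_invariant (\<lambda>_ _. True) F"
  obtains c where "\<And>x. x \<in> sphere 0 1 \<Longrightarrow> F x = c"
proof -
  obtain a b :: 'n where ab: "a \<noteq> b"
    using assms(1) by (metis (full_types) card_2_iff' ex_card top_greatest UNIV_I subset_UNIV)
  have "F x = F (axis a 1)" if x: "x \<in> sphere 0 1" for x
  proof -
    obtain y where y: "y \<in> sphere 0 1" "\<forall>i. a \<noteq> i \<longrightarrow> y $ i = 0 \<and> 0 \<le> y $ a" "F y = F x"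
      using rot_reduce[of "\<lambda>_ _. True" "\<lambda>_. a" x] assms(2) x by (auto simp: equivp_def)
    have e: "y = y $ a *\<^sub>R axis a 1" using y(2) by (auto simp: vec_eq_iff axis_def)
    then have "norm y = \<bar>y $ a\<bar>" by (metis norm_axis_1 norm_scaleR mult.right_neutral)
    with y(1,2) ab have "y $ a = 1" by auto
    with e y show ?thesis by simp
  qed
  then show ?thesis using that by blast
qed

subsection \<open>Orthonormal bases of polynomial spaces\<close>

abbreviation ip :: "(real ^ 'n::finite \<Rightarrow> real) \<Rightarrow> (real ^ 'n \<Rightarrow> real) \<Rightarrow> real" where
  "ip F G \<equiv> \<integral>x. F x * G x \<partial>sphere_measure"

text \<open>Monomials are indexed by words, so the same monomial occurs for several words. What
  matters later is that the spanning family is finite.\<close>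

lemma spoly_span:
  "spoly d F \<Longrightarrow> \<exists>c. \<forall>x. F x = (\<Sum>w\<in>{w. length w \<le> d}. c w * (\<Prod>i\<leftarrow>w. x $ i))"
proof (induction rule: spoly.induct)
  case (const d c)
  have "(\<Sum>w\<in>{w::'a list. length w \<le> d}. (if w = [] then c else 0) * (\<Prod>i\<leftarrow>w. x $ i)) = c" for x :: "real ^ 'a"
  proof -
    have "(\<Sum>w\<in>{w::'a list. length w \<le> d}. (if w = [] then c else 0) * (\<Prod>i\<leftarrow>w. x $ i))
      = (\<Sum>w\<in>{[]}. (if w = [] then c else 0) * (\<Prod>i\<leftarrow>w. x $ i))"
      using finite_lists_length_le[of "UNIV :: 'a set" d] by (intro sum.mono_neutral_right) auto
    then show ?thesis by simp
  qed
  then show ?case by (intro exI[of _ "\<lambda>w. if w = [] then c else 0"]) simp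
next
  case (add d F G)
  then obtain c c' where "\<forall>x. F x = (\<Sum>w\<in>{w. length w \<le> d}. c w * (\<Prod>i\<leftarrow>w. x $ i))"
    "\<forall>x. G x = (\<Sum>w\<in>{w. length w \<le> d}. c' w * (\<Prod>i\<leftarrow>w. x $ i))" by blast
  then show ?case
    by (intro exI[of _ "\<lambda>w. c w + c' w"]) (simp add: sum.distrib distrib_right)
next
  case (mult d F i)
  then obtain c where c: "\<And>x. F x = (\<Sum>w\<in>{w. length w \<le> d}. c w * (\<Prod>i\<leftarrow>w. x $ i))" by blast
  define c' where "c' w = (if w \<noteq> [] \<and> hd w = i then c (tl w) else 0)" for w
  have "x $ i * F x = (\<Sum>w\<in>{w. length w \<le> Suc d}. c' w * (\<Prod>i\<leftarrow>w. x $ i))" for x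
  proof -
    have "x $ i * F x = (\<Sum>w\<in>{w. length w \<le> d}. c' (i # w) * (\<Prod>j\<leftarrow>i # w. x $ j))"
      unfolding c by (simp add: sum_distrib_left c'_def mult_ac)
    also have "\<dots> = (\<Sum>w\<in>(#) i ` {w. length w \<le> d}. c' w * (\<Prod>j\<leftarrow>w. x $ j))"
      by (subst sum.reindex) (auto simp: o_def)
    also have "\<dots> = (\<Sum>w\<in>{w. length w \<le> Suc d}. c' w * (\<Prod>j\<leftarrow>w. x $ j))"
    proof (rule sum.mono_neutral_left)
      show "finite {w::'a list. length w \<le> Suc d}"
        using finite_lists_length_le[of "UNIV :: 'a set" "Suc d"] by simp
      show "\<forall>w\<in>{w. length w \<le> Suc d} - (#) i ` {w. length w \<le> d}. c' w * (\<Prod>j\<leftarrow>w. x $ j) = 0"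
      proof
        fix w assume w: "w \<in> {w. length w \<le> Suc d} - (#) i ` {w. length w \<le> d}"
        have "c' w = 0"
        proof (cases w)
          case (Cons j v)
          then show ?thesis using w by (auto simp: c'_def)
        qed (simp add: c'_def)
        then show "c' w * (\<Prod>j\<leftarrow>w. x $ j) = 0" by simp
      qed
    qed auto
    finally show ?thesis .
  qed
  then show ?case by blast
qed

lemma integrable_spoly: "spoly d F \<Longrightarrow> integrable sphere_measure F"
  by (intro integrable_continuous_sphere spoly_continuous)

text \<open>Gram--Schmidt modulo functions vanishing on the sphere, where the family may be linearly
  dependent. The coefficients are pinned down as inner products, which later bounds them.\<close>

lemma gram_schmidt_sphere:
  fixes b :: "'i \<Rightarrow> real ^ 'n \<Rightarrow> real"
  assumes "finite I" "\<forall>i\<in>I. spoly d (b i)"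
  shows "\<exists>(m::nat) e. (\<forall>i<m. spoly d (e i)) \<and> (\<forall>i<m. \<forall>j<m. ip (e i) (e j) = (if i = j then 1 else 0))
    \<and> (\<forall>F c. (\<forall>x\<in>sphere 0 1. F x = (\<Sum>i\<in>I. c i * b i x))
          \<longrightarrow> (\<forall>x\<in>sphere 0 1. F x = (\<Sum>i<m. ip F (e i) * e i x)))"
  using assms
proof (induction I rule: finite_induct)
  case empty
  then show ?case by (intro exI[of _ "0::nat"]) auto
next
  case (insert a I)
  have "\<forall>i\<in>I. spoly d (b i)" using insert.prems by simp
  from insert.IH[OF this] obtain m :: nat and e :: "nat \<Rightarrow> real ^ 'n \<Rightarrow> real" where e0: "\<forall>i<m. spoly d (e i)"
    and on0: "\<forall>i<m. \<forall>j<m. ip (e i) (e j) = (if i = j then 1 else 0)"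
    and span0: "\<forall>F c. (\<forall>x\<in>sphere 0 1. F x = (\<Sum>i\<in>I. c i * b i x))
          \<longrightarrow> (\<forall>x\<in>sphere 0 1. F x = (\<Sum>i<m. ip F (e i) * e i x))"
    by (elim exE conjE)
  have e: "spoly d (e i)" if "i < m" for i using e0 that by blast
  have on: "ip (e i) (e j) = (if i = j then 1 else 0)" if "i < m" "j < m" for i j
    using on0 that by blast
  have span: "F x = (\<Sum>i<m. ip F (e i) * e i x)"
    if "\<And>x. x \<in> sphere 0 1 \<Longrightarrow> F x = (\<Sum>i\<in>I. c i * b i x)" "x \<in> sphere 0 1" for F c x
    using span0 that by blast
  have ba: "spoly d (b a)" using insert.prems by simp
  define b' where "b' x = b a x - (\<Sum>i<m. ip (b a) (e i) * e i x)" for x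
  have b': "spoly d b'"
    unfolding b'_def[abs_def] by (intro spoly_diff spoly_sum spoly_cmult ba e) auto
  have int: "integrable sphere_measure (\<lambda>x. F x * G x)" if "spoly d F" "spoly d G" for F G
    by (rule integrable_spoly[OF spoly_mult[OF that]])
  have b'e: "ip b' (e j) = 0" if j: "j < m" for j
  proof -
    have "ip b' (e j) = (\<integral>x. b a x * e j x - (\<Sum>i<m. ip (b a) (e i) * (e i x * e j x)) \<partial>sphere_measure)"
      by (simp add: b'_def left_diff_distrib sum_distrib_right mult.assoc)
    also have "\<dots> = ip (b a) (e j) - (\<Sum>i<m. ip (b a) (e i) * ip (e i) (e j))"
    proof -
      have *: "integrable sphere_measure (\<lambda>x. ip (b a) (e i) * (e i x * e j x))" if "i < m" for i
        by (intro integrable_mult_right int e that j)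
      have "(\<integral>x. (\<Sum>i<m. ip (b a) (e i) * (e i x * e j x)) \<partial>sphere_measure)
          = (\<Sum>i<m. ip (b a) (e i) * ip (e i) (e j))"
        using * by (subst Bochner_Integration.integral_sum) auto
      moreover have "integrable sphere_measure (\<lambda>x. \<Sum>i<m. ip (b a) (e i) * (e i x * e j x))"
        using * by (intro Bochner_Integration.integrable_sum) auto
      ultimately show ?thesis using int[OF ba e[OF j]] by simp
    qed
    also have "(\<Sum>i<m. ip (b a) (e i) * ip (e i) (e j)) = (\<Sum>i<m. if i = j then ip (b a) (e j) else 0)"
      by (rule sum.cong) (auto simp: on j)
    finally show ?thesis using j by simp
  qed
  have split: "(\<forall>x\<in>sphere 0 1. G x = (\<Sum>i<m. ip G (e i) * e i x)) \<and> (\<forall>x\<in>sphere 0 1. F x = G x + c a * b a x)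
       \<and> spoly d G"
    if "\<forall>x\<in>sphere 0 1. F x = (\<Sum>i\<in>insert a I. c i * b i x)" "G = (\<lambda>x. \<Sum>i\<in>I. c i * b i x)" for F G c
  proof (intro conjI ballI)
    show "G x = (\<Sum>i<m. ip G (e i) * e i x)" if "x \<in> sphere 0 1" for x
      using span[of G c x] that \<open>G = _\<close> by blast
    show "F x = G x + c a * b a x" if "x \<in> sphere 0 1" for x
      using \<open>\<forall>x\<in>sphere 0 1. F x = _\<close> that \<open>G = _\<close> insert.hyps by simp
    show "spoly d G"
      unfolding \<open>G = _\<close> using insert by (intro spoly_sum spoly_cmult) auto
  qed
  have ipF: "ip F h = ip G h + s * ip (b a) h"
    if "\<forall>x\<in>sphere 0 1. F x = G x + s * b a x" "spoly d G" "spoly d h" for F G h s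
  proof -
    have "ip F h = (\<integral>x. G x * h x + s * (b a x * h x) \<partial>sphere_measure)"
      using that(1) by (intro sphere_integral_cong) (simp add: algebra_simps)
    then show ?thesis using that ba by (simp add: int)
  qed
  \<comment> \<open>If the residual \<open>b'\<close> has norm 0, it vanishes on the sphere and
    \<open>b a\<close> adds nothing; otherwise its normalisation \<open>h\<close> joins the
    basis.\<close>
  show ?case
  proof (cases "ip b' b' \<le> 0")
    case True
    have z: "b' x = 0" if "x \<in> sphere 0 1" for x
      using sphere_integral_eq_0[OF spoly_continuous[OF spoly_mult[OF b' b']] _ True that] by simp
    show ?thesis
    proof (intro exI[of _ m] exI[of _ e] conjI allI impI ballI)
      fix F c and x :: "real ^ 'n" assume F: "\<forall>x\<in>sphere 0 1. F x = (\<Sum>i\<in>insert a I. c i * b i x)" and x: "x \<in> sphere 0 1"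
      define G where "G = (\<lambda>x. \<Sum>i\<in>I. c i * b i x)"
      note s = split[OF F G_def]
      have "(\<Sum>i<m. ip F (e i) * e i x) = (\<Sum>i<m. ip G (e i) * e i x) + c a * (\<Sum>i<m. ip (b a) (e i) * e i x)"
        by (simp add: ipF[of F G "c a"] s e sum.distrib[symmetric] sum_distrib_left algebra_simps)
      also have "\<dots> = G x + c a * b a x"
        using s x z[OF x] by (simp add: b'_def)
      finally show "F x = (\<Sum>i<m. ip F (e i) * e i x)" using s x by simp
    qed (use e on in auto)
  next
    case False
    define N where "N = ip b' b'"
    have N: "N > 0" using False by (simp add: N_def)
    define h where "h x = b' x / sqrt N" for x
    have h: "spoly d h"
      unfolding h_def[abs_def] using spoly_cmult[OF b', of "1 / sqrt N"] by simp
    have ip_h: "ip F h = ip F b' / sqrt N" for F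
    proof -
      have "(\<lambda>x. F x * h x) = (\<lambda>x. F x * b' x / sqrt N)" by (simp add: h_def fun_eq_iff)
      then show ?thesis by simp
    qed
    have ip_comm: "ip F G = ip G F" for F G :: "real ^ 'n \<Rightarrow> real"
      by (rule sphere_integral_cong) (rule mult.commute)
    have he: "ip (e i) h = 0" "ip h (e i) = 0" if "i < m" for i
      using b'e[OF that] ip_h[of "e i"] ip_comm[of "e i" b'] ip_comm[of "e i" h] by simp_all
    have hh: "ip h h = 1"
      using N ip_h[of h] ip_comm[of h b'] ip_h[of b'] by (simp add: N_def[symmetric])
    have ge: "ip G h = 0" if "\<forall>x\<in>sphere 0 1. G x = (\<Sum>i<m. g i * e i x)" for G g
    proof -
      have "ip G h = (\<integral>x. (\<Sum>i<m. g i * (e i x * h x)) \<partial>sphere_measure)"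
        using that by (intro sphere_integral_cong) (simp add: sum_distrib_right mult.assoc)
      then show ?thesis by (simp add: Bochner_Integration.integral_sum int e h he)
    qed
    have bh: "ip (b a) h = sqrt N"
    proof -
      have "ip (b a) h = (\<integral>x. b' x * h x + (\<Sum>i<m. ip (b a) (e i) * e i x) * h x \<partial>sphere_measure)"
        by (rule sphere_integral_cong) (simp add: b'_def algebra_simps)
      also have "\<dots> = ip b' h + ip (\<lambda>x. \<Sum>i<m. ip (b a) (e i) * e i x) h"
        by (intro Bochner_Integration.integral_add int b' h spoly_sum spoly_cmult) (auto simp: e)
      also have "\<dots> = ip b' h"
        using ge[of "\<lambda>x :: real ^ 'n. \<Sum>i<m. ip (b a) (e i) * e i x" "\<lambda>i. ip (b a) (e i)"] by simp
      finally show ?thesis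
        using N ip_h[of b'] by (simp add: N_def[symmetric] real_div_sqrt)
    qed
    show ?thesis
    proof (intro exI[of _ "Suc m"] exI[of _ "e(m := h)"] conjI allI impI ballI)
      show "spoly d ((e(m := h)) i)" if "i < Suc m" for i using that e h by (auto simp: less_Suc_eq)
      show "ip ((e(m := h)) i) ((e(m := h)) j) = (if i = j then 1 else 0)" if "i < Suc m" "j < Suc m" for i j
        using that by (auto simp: less_Suc_eq on he hh)
    next
      fix F c and x :: "real ^ 'n" assume F: "\<forall>x\<in>sphere 0 1. F x = (\<Sum>i\<in>insert a I. c i * b i x)" and x: "x \<in> sphere 0 1"
      define G where "G = (\<lambda>x. \<Sum>i\<in>I. c i * b i x)"
      note s = split[OF F G_def]
      have "ip G h = 0" using s by (intro ge[of G "\<lambda>i. ip G (e i)"]) blast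
      moreover have "ip F h = ip G h + c a * ip (b a) h" using s h by (intro ipF) blast+
      ultimately have Fh: "ip F h = c a * sqrt N" by (simp only: bh)
      have "(\<Sum>i<Suc m. ip F ((e(m := h)) i) * (e(m := h)) i x)
          = (\<Sum>i<m. ip F (e i) * e i x) + ip F h * h x" by simp
      also note Fh
      also have "c a * sqrt N * h x = c a * b' x" using N by (simp add: h_def)
      also have "(\<Sum>i<m. ip F (e i) * e i x) = (\<Sum>i<m. ip G (e i) * e i x) + c a * (\<Sum>i<m. ip (b a) (e i) * e i x)"
        by (simp add: ipF[of F G "c a"] s e sum.distrib[symmetric] sum_distrib_left algebra_simps)
      also have "\<dots> + c a * b' x = F x"
        using s x by (simp add: b'_def algebra_simps)
      finally show "F x = (\<Sum>i<Suc m. ip F ((e(m := h)) i) * (e(m := h)) i x)" by simp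
    qed
  qed
qed

lemma spoly_basis:
  "\<exists>(m::nat) e :: nat \<Rightarrow> real ^ 'n \<Rightarrow> real. (\<forall>i<m. spoly d (e i)) \<and>
     (\<forall>F. spoly d F \<longrightarrow> (\<forall>x\<in>sphere 0 1. F x = (\<Sum>i<m. ip F (e i) * e i x)))"
proof -
  have fin: "finite {w :: 'n list. length w \<le> d}"
    using finite_lists_length_le[of "UNIV :: 'n set" d] by simp
  have mono: "spoly (length w) (\<lambda>x. \<Prod>i\<leftarrow>w. x $ i)" for w :: "'n list"
    by (induction w) (auto intro: spoly.intros)
  have "\<forall>w\<in>{w :: 'n list. length w \<le> d}. spoly d (\<lambda>x. \<Prod>i\<leftarrow>w. x $ i)"
    using spoly_mono[OF _ mono] by auto
  from gram_schmidt_sphere[of _ d "\<lambda>w x. \<Prod>i\<leftarrow>w. x $ i", OF fin this] obtain m :: nat and e :: "nat \<Rightarrow> real ^ 'n \<Rightarrow> real"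
    where e: "\<forall>i<m. spoly d (e i)" and s: "\<forall>F c. (\<forall>x\<in>sphere 0 1. F x = (\<Sum>w\<in>{w. length w \<le> d}. c w * (\<Prod>i\<leftarrow>w. x $ i)))
          \<longrightarrow> (\<forall>x\<in>sphere 0 1. F x = (\<Sum>i<m. ip F (e i) * e i x))" by blast
  show ?thesis
  proof (intro exI conjI allI impI)
    show "\<forall>x\<in>sphere 0 1. F x = (\<Sum>i<m. ip F (e i) * e i x)" if "spoly d F" for F
      using spoly_span[OF that] s by blast
  qed (use e in blast)
qed

subsection \<open>A maximiser among polynomials\<close>

text \<open>\<open>F\<close> plays the role of the p-th power of a given function, normalised to
  integral 1. A positive \<epsilon> keeps the logarithms in \<open>geo\<close> under
  control.\<close>

definition feasible :: "nat \<Rightarrow> real \<Rightarrow> ('n::finite \<Rightarrow> 'n \<Rightarrow> bool) \<Rightarrow> (real ^ 'n \<Rightarrow> real) \<Rightarrow> bool" where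
  "feasible d \<epsilon> E F \<longleftrightarrow> spoly d F \<and> (\<forall>x\<in>sphere 0 1. \<epsilon> \<le> F x) \<and> (\<integral>x. F x \<partial>sphere_measure) = 1 \<and> rot_invariant E F"

text \<open>For positive \<open>F\<close> the product of the \<open>F J\<close> to the power 1/p;
  the logarithmic form turns perturbations and derivatives of the product into sums.\<close>

definition geo :: "'j set \<Rightarrow> real \<Rightarrow> ('j \<Rightarrow> 'a \<Rightarrow> real) \<Rightarrow> 'a \<Rightarrow> real" where
  "geo Js p F x = exp ((\<Sum>J\<in>Js. ln (F J x)) / p)"

lemma continuous_on_geo:
  assumes "\<And>J. J \<in> Js \<Longrightarrow> continuous_on A (F J)" "\<And>J x. J \<in> Js \<Longrightarrow> x \<in> A \<Longrightarrow> F J x > 0"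
  shows "continuous_on A (geo Js p F)"
  unfolding geo_def[abs_def]
  by (cases "p = 0"; auto intro!: continuous_intros assms less_imp_neq[THEN not_sym])

lemma feasible_cong:
  assumes "feasible d \<epsilon> E F" "spoly d G" "\<And>x. x \<in> sphere 0 1 \<Longrightarrow> G x = F x"
  shows "feasible d \<epsilon> E G"
proof -
  have "(\<integral>x. G x \<partial>sphere_measure) = (\<integral>x. F x \<partial>sphere_measure)"
    by (rule sphere_integral_cong) (rule assms(3))
  moreover have "rot_invariant E G"
    using assms unfolding rot_invariant_def feasible_def by (metis rot_in_sphere)
  ultimately show ?thesis using assms by (simp add: feasible_def)
qed

text \<open>Tychonoff's theorem. The index type may be infinite: the coefficient families below are
  functions on all of \<open>nat \<times> nat\<close>, and all their entries are confined to the
  box.\<close>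

lemma compact_box: "compact {c :: 'i \<Rightarrow> real. \<forall>q. \<bar>c q\<bar> \<le> B}"
proof -
  have "compactin (product_topology (\<lambda>_. euclidean) UNIV) (PiE (UNIV :: 'i set) (\<lambda>_. {-B..B}))"
    by (simp add: compactin_PiE)
  then have "compact (PiE (UNIV :: 'i set) (\<lambda>_. {-B..B}))"
    by (simp add: euclidean_product_topology)
  moreover have "y \<in> {-B..B} \<longleftrightarrow> \<bar>y\<bar> \<le> B" for y by auto
  then have "PiE (UNIV :: 'i set) (\<lambda>_. {-B..B}) = {c. \<forall>q. \<bar>c q\<bar> \<le> B}"
    by (simp add: PiE_UNIV_domain Pi_def)
  ultimately show ?thesis by simp
qed

text \<open>Tuples are parametrised by coefficients in a box: feasibility is a closed condition on
  them, and the integral depends on them continuously by dominated convergence. \<open>F0\<close>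
  shows that the set is nonempty.\<close>

lemma maximiser_exists:
  fixes F0 :: "nat \<Rightarrow> real ^ 'n \<Rightarrow> real"
  assumes fin: "finite Js" and \<epsilon>: "\<epsilon> > 0" and p: "p > 0"
    and F0: "\<And>J. J \<in> Js \<Longrightarrow> feasible d \<epsilon> (E J) (F0 J)"
  shows "\<exists>F. (\<forall>J\<in>Js. feasible d \<epsilon> (E J) (F J)) \<and>
    (\<forall>G. (\<forall>J\<in>Js. feasible d \<epsilon> (E J) (G J)) \<longrightarrow>
        (\<integral>x. geo Js p G x \<partial>sphere_measure) \<le> (\<integral>x. geo Js p F x \<partial>sphere_measure))"
proof -
  obtain m :: nat and e :: "nat \<Rightarrow> real ^ 'n \<Rightarrow> real" where e0: "\<forall>i<m. spoly d (e i)"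
    and span0: "\<forall>F. spoly d F \<longrightarrow> (\<forall>x\<in>sphere 0 1. F x = (\<Sum>i<m. ip F (e i) * e i x))"
    using spoly_basis[of d] by (elim exE conjE)
  have e: "spoly d (e i)" if "i < m" for i using e0 that by blast
  have span: "F x = (\<Sum>i<m. ip F (e i) * e i x)" if "spoly d F" "x \<in> sphere 0 1" for F x
    using span0 that by blast
  have "\<exists>b\<ge>0. \<forall>x\<in>sphere 0 1. \<bar>e i x\<bar> \<le> b" if "i < m" for i
    using continuous_sphere_bounded[OF spoly_continuous[OF e[OF that]]] by metis
  then obtain b where b: "\<And>i. i < m \<Longrightarrow> b i \<ge> 0" "\<And>i x. i < m \<Longrightarrow> x \<in> sphere 0 1 \<Longrightarrow> \<bar>e i x\<bar> \<le> b i"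
    by metis
  \<comment> \<open>Bounds all basis functions on the sphere and hence all coefficients, since a
    feasible \<open>G\<close> is nonnegative with integral 1.\<close>
  define B where "B = (\<Sum>i<m. b i)"
  have B0: "B \<ge> 0" unfolding B_def by (intro sum_nonneg b) auto
  have B: "\<bar>e i x\<bar> \<le> B" if "i < m" "x \<in> sphere 0 1" for i x
    using b(2)[OF that] member_le_sum[of i "{..<m}" b] b(1) that unfolding B_def by force
  define T where "T c J x = (\<Sum>i<m. c (J, i) * e i x)" for c :: "nat \<times> nat \<Rightarrow> real" and J x
  have T: "spoly d (T c J)" for c J
    unfolding T_def[abs_def] by (intro spoly_sum spoly_cmult e) auto
  define box where "box = {c :: nat \<times> nat \<Rightarrow> real. \<forall>q. \<bar>c q\<bar> \<le> B}"
  have coord: "continuous_on UNIV (\<lambda>c :: nat \<times> nat \<Rightarrow> real. c q)" for q by simp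
  have cT: "continuous_on UNIV (\<lambda>c. T c J x)" for J x
    unfolding T_def by (intro continuous_intros coord)
  have intT: "(\<integral>x. T c J x \<partial>sphere_measure) = (\<Sum>i<m. c (J, i) * (\<integral>x. e i x \<partial>sphere_measure))" for c J
    unfolding T_def using integrable_spoly[OF e]
    by (subst Bochner_Integration.integral_sum) auto
  have cI: "continuous_on UNIV (\<lambda>c. (\<integral>x. T c J x \<partial>sphere_measure))" for J
    unfolding intT by (intro continuous_intros coord)
  define K where "K = box \<inter> {c. \<forall>J\<in>Js. feasible d \<epsilon> (E J) (T c J)}"
  have "{c. \<forall>J\<in>Js. feasible d \<epsilon> (E J) (T c J)}
      = (\<Inter>J\<in>Js. (\<Inter>x\<in>sphere 0 1. {c. \<epsilon> \<le> T c J x}) \<inter> {c. (\<integral>x. T c J x \<partial>sphere_measure) = 1}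
           \<inter> (\<Inter>(k, l, t, x)\<in>{(k, l, t, x). k \<noteq> l \<and> E J k l \<and> x \<in> sphere 0 1}. {c. T c J (rot k l t x) = T c J x}))"
    by (auto simp: feasible_def rot_invariant_def T)
  also have "closed \<dots>"
    by (intro closed_INT ballI closed_Int closed_Collect_le closed_Collect_eq cT cI continuous_on_const)
       (auto intro!: closed_Collect_eq cT)
  finally have "compact K"
    unfolding K_def box_def by (intro compact_Int_closed compact_box)
  have proj: "\<exists>c\<in>K. \<forall>J\<in>Js. \<forall>x\<in>sphere 0 1. T c J x = G J x" if G: "\<forall>J\<in>Js. feasible d \<epsilon> (E J) (G J)" for G
  proof -
    define c where "c = (\<lambda>(J, i). if J \<in> Js \<and> i < m then ip (G J) (e i) else 0)"
    have TG: "T c J x = G J x" if "J \<in> Js" "x \<in> sphere 0 1" for J x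
      using span[of "G J" x] G that by (simp add: T_def c_def feasible_def)
    have "\<bar>c (J, i)\<bar> \<le> B" for J i
    proof (cases "J \<in> Js \<and> i < m")
      case True
      have g: "spoly d (G J)" "\<And>x. x \<in> sphere 0 1 \<Longrightarrow> 0 \<le> G J x" "(\<integral>x. G J x \<partial>sphere_measure) = 1"
      proof -
        have f: "feasible d \<epsilon> (E J) (G J)" using G True by blast
        then show "spoly d (G J)" "(\<integral>x. G J x \<partial>sphere_measure) = 1" by (simp_all add: feasible_def)
        show "0 \<le> G J x" if "x \<in> sphere 0 1" for x
          using f that \<epsilon> unfolding feasible_def by (meson less_imp_le order_trans)
      qed
      have "\<bar>ip (G J) (e i)\<bar> \<le> (\<integral>x. \<bar>G J x * e i x\<bar> \<partial>sphere_measure)"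
        by (rule integral_abs_bound)
      also have "\<dots> \<le> (\<integral>x. B * G J x \<partial>sphere_measure)"
      proof (rule sphere_integral_mono)
        show "\<bar>G J x * e i x\<bar> \<le> B * G J x" if x: "x \<in> sphere 0 1" for x
          using mult_left_mono[OF B[of i x] g(2)[OF x]] True x g(2)[OF x] by (simp add: abs_mult mult.commute)
      qed (use True in \<open>auto intro!: continuous_intros spoly_continuous[OF g(1)] spoly_continuous[OF e]\<close>)
      also have "\<dots> = B" using g by simp
      finally show ?thesis using True by (simp add: c_def)
    qed (use B0 in \<open>auto simp: c_def\<close>)
    moreover have "feasible d \<epsilon> (E J) (T c J)" if "J \<in> Js" for J
      using feasible_cong[OF _ T] G TG that by blast
    ultimately have "c \<in> K" by (auto simp: K_def box_def)
    then show ?thesis using TG by blast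
  qed
  define M where "M = real m * (B * B) + 1"
  have M1: "M \<ge> 1" using B0 by (simp add: M_def)
  have TM: "T c J x \<le> M" if "c \<in> box" "x \<in> sphere 0 1" for c J x
  proof -
    have "c (J, i) * e i x \<le> B * B" if "i < m" for i
    proof -
      have "\<bar>c (J, i)\<bar> * \<bar>e i x\<bar> \<le> B * B"
        using \<open>c \<in> box\<close> B[OF that \<open>x \<in> sphere 0 1\<close>] B0 by (intro mult_mono) (auto simp: box_def)
      then show ?thesis
        using abs_ge_self[of "c (J, i) * e i x"] unfolding abs_mult by linarith
    qed
    then have "T c J x \<le> (\<Sum>i<m. B * B)" unfolding T_def by (intro sum_mono) auto
    then show ?thesis by (simp add: M_def)
  qed
  have Tpos: "T c J x > 0" if "c \<in> K" "J \<in> Js" "x \<in> sphere 0 1" for c J x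
    using that \<epsilon> by (force simp: K_def feasible_def)
  have cgeo: "continuous_on (sphere 0 1) (geo Js p (T c))" if "c \<in> K" for c
    by (intro continuous_on_geo spoly_continuous[OF T] Tpos that)
  have "continuous_on K (\<lambda>c. \<integral>x. geo Js p (T c) x \<partial>sphere_measure)"
  proof (rule continuous_on_sequentiallyI)
    fix u a assume u: "\<forall>n. u n \<in> K" and a: "a \<in> K" and lim: "u \<longlonglongrightarrow> a"
    have limT: "(\<lambda>n. T (u n) J x) \<longlonglongrightarrow> T a J x" for J x
      using continuous_on_tendsto_compose[OF cT lim] by simp
    show "(\<lambda>n. \<integral>x. geo Js p (T (u n)) x \<partial>sphere_measure) \<longlonglongrightarrow> (\<integral>x. geo Js p (T a) x \<partial>sphere_measure)"
    proof (rule integral_dominated_convergence[where w = "\<lambda>_. exp (real (card Js) * ln M / p)"])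
      show "geo Js p (T a) \<in> borel_measurable sphere_measure"
        by (intro measurable_continuous_sphere cgeo a)
      show "geo Js p (T (u n)) \<in> borel_measurable sphere_measure" for n
        using u by (intro measurable_continuous_sphere cgeo) auto
      show "AE x in sphere_measure. (\<lambda>n. geo Js p (T (u n)) x) \<longlonglongrightarrow> geo Js p (T a) x"
      proof (rule AE_I2)
        fix x assume "x \<in> space (sphere_measure :: (real ^ 'n) measure)"
        then have x: "x \<in> sphere 0 1" by simp
        show "(\<lambda>n. geo Js p (T (u n)) x) \<longlonglongrightarrow> geo Js p (T a) x"
          unfolding geo_def
          by (intro tendsto_exp tendsto_divide tendsto_sum tendsto_ln limT tendsto_const)
             (use p Tpos[OF a _ x] in force)+
      qed
      show "AE x in sphere_measure. norm (geo Js p (T (u n)) x) \<le> exp (real (card Js) * ln M / p)" for n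
      proof (rule AE_I2)
        fix x assume "x \<in> space (sphere_measure :: (real ^ 'n) measure)"
        then have x: "x \<in> sphere 0 1" by simp
        have "(\<Sum>J\<in>Js. ln (T (u n) J x)) \<le> (\<Sum>J\<in>Js. ln M)"
          using u x M1 TM[of "u n" x] Tpos[of "u n" _ x] by (intro sum_mono) (auto simp: K_def)
        then show "norm (geo Js p (T (u n)) x) \<le> exp (real (card Js) * ln M / p)"
          using p by (simp add: geo_def divide_right_mono)
      qed
    qed simp
  qed
  moreover have "K \<noteq> {}" using proj[of F0] F0 by blast
  ultimately obtain c where c: "c \<in> K"
    "\<And>c'. c' \<in> K \<Longrightarrow> (\<integral>x. geo Js p (T c') x \<partial>sphere_measure) \<le> (\<integral>x. geo Js p (T c) x \<partial>sphere_measure)"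
    using continuous_attains_sup[OF \<open>compact K\<close>, of "\<lambda>c. \<integral>x. geo Js p (T c) x \<partial>sphere_measure"] by blast
  show ?thesis
  proof (intro exI[of _ "T c"] conjI allI impI)
    show "\<forall>J\<in>Js. feasible d \<epsilon> (E J) (T c J)" using c(1) by (simp add: K_def)
    fix G assume "\<forall>J\<in>Js. feasible d \<epsilon> (E J) (G J)"
    then obtain c' where c': "c' \<in> K" "\<forall>J\<in>Js. \<forall>x\<in>sphere 0 1. T c' J x = G J x"
      using proj by blast
    have "(\<integral>x. geo Js p G x \<partial>sphere_measure) = (\<integral>x. geo Js p (T c') x \<partial>sphere_measure)"
      using c'(2) by (intro sphere_integral_cong) (auto simp: geo_def intro!: sum.cong)
    then show "(\<integral>x. geo Js p G x \<partial>sphere_measure) \<le> (\<integral>x. geo Js p (T c) x \<partial>sphere_measure)"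
      using c(2)[OF c'(1)] by simp
  qed
qed

subsection \<open>The first-order condition\<close>

text \<open>Second derivative test along the orbit \<open>rot k l t x\<close>.\<close>

lemma rd_rd_nonneg_at_min:
  assumes F: "spoly d F" and x: "x \<in> sphere 0 1" and min: "\<And>y. y \<in> sphere 0 1 \<Longrightarrow> F x \<le> F y"
  shows "0 \<le> rd k l (rd k l F) x"
proof (cases "k = l")
  case False
  define \<phi> where "\<phi> t = F (rot k l t x)" for t
  define \<psi> where "\<psi> t = rd k l F (rot k l t x)" for t
  have d1: "(\<phi> has_real_derivative \<psi> t) (at t)" for t
    unfolding \<phi>_def[abs_def] \<psi>_def by (rule rot_derivative_everywhere[OF False x rd_rot_derivative[OF False F]])
  have d2: "(\<psi> has_real_derivative rd k l (rd k l F) x) (at 0)"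
    unfolding \<psi>_def[abs_def] by (rule rd_rot_derivative[OF False spoly_rd[OF F]])
  have min\<phi>: "\<phi> 0 \<le> \<phi> t" for t
    using min[OF rot_in_sphere[OF False x]] by (simp add: \<phi>_def)
  have \<psi>0: "\<psi> 0 = 0"
    using DERIV_local_min[OF d1[of 0], of 1] min\<phi> by simp
  show ?thesis
  proof (rule ccontr)
    assume "\<not> 0 \<le> rd k l (rd k l F) x"
    then obtain h where h: "h > 0" "\<And>t. 0 < t \<Longrightarrow> t < h \<Longrightarrow> \<psi> t < 0"
      using DERIV_neg_dec_right[OF d2] \<psi>0 by auto
    obtain z where z: "0 < z" "z < h / 2" "\<phi> (h / 2) - \<phi> 0 = (h / 2 - 0) * \<psi> z"
      using MVT2[of 0 "h / 2" \<phi> \<psi>] d1 h(1) by auto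
    then have "\<phi> (h / 2) < \<phi> 0"
      using h(2)[of z] h(1) mult_pos_neg[of "h / 2" "\<psi> z"] by auto
    with min\<phi>[of "h / 2"] show False by simp
  qed
qed (use rd_same[OF spoly_rd[OF F]] in simp)

text \<open>Otherwise points violating the bound for ever smaller \<open>s\<close> accumulate at
  some \<open>a\<close> with F a = \<epsilon>, a minimum of \<open>F\<close>. There the Laplacian is
  nonnegative, yet the violations force it to be at most -\<delta>.\<close>

lemma lap_step_lower_bound:
  assumes F: "spoly d F" and lo: "\<And>x. x \<in> sphere 0 1 \<Longrightarrow> \<epsilon> \<le> F x" and \<delta>: "\<delta> > 0"
  shows "\<exists>s0>0. \<forall>s. 0 < s \<and> s < s0 \<longrightarrow> (\<forall>x\<in>sphere 0 1. \<epsilon> - \<delta> * s \<le> F x + s * lap F x)"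
proof (rule ccontr)
  assume neg: "\<not> ?thesis"
  have "\<exists>s x. 0 < s \<and> s < 1 / real (Suc n) \<and> x \<in> sphere 0 1 \<and> F x + s * lap F x < \<epsilon> - \<delta> * s" for n
  proof -
    have "(0::real) < 1 / real (Suc n)" by simp
    with neg show ?thesis by (metis not_le)
  qed
  then obtain s x where s: "\<And>n. 0 < s n" "\<And>n. s n < 1 / real (Suc n)"
    and x: "\<And>n. x n \<in> sphere 0 1" and bad: "\<And>n. F (x n) + s n * lap F (x n) < \<epsilon> - \<delta> * s n" by metis
  have "\<forall>n. x n \<in> sphere 0 1" using x by blast
  then obtain a r where a: "a \<in> sphere 0 1" "strict_mono r" "(x \<circ> r) \<longlonglongrightarrow> a"
    using compact_sphere[of "0 :: real ^ 'a" 1] unfolding compact_def by metis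
  have s0: "s \<longlonglongrightarrow> 0"
  proof (rule tendsto_sandwich[of "\<lambda>_. 0"])
    show "(\<lambda>n. 1 / real (Suc n)) \<longlonglongrightarrow> 0"
      using LIMSEQ_inverse_real_of_nat by (simp add: inverse_eq_divide)
    show "\<forall>\<^sub>F n in sequentially. s n \<le> 1 / real (Suc n)"
      by (intro always_eventually allI less_imp_le s(2))
    show "\<forall>\<^sub>F n in sequentially. 0 \<le> s n"
      by (intro always_eventually allI less_imp_le s(1))
  qed simp
  have sr: "(\<lambda>n. s (r n)) \<longlonglongrightarrow> 0"
    using LIMSEQ_subseq_LIMSEQ[OF s0 a(2)] by (simp add: o_def)
  have xr: "(\<lambda>n. x (r n)) \<longlonglongrightarrow> a" using a(3) by (simp add: o_def)
  have F_lim: "(\<lambda>n. F (x (r n))) \<longlonglongrightarrow> F a"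
    using continuous_on_tendsto_compose[OF spoly_continuous[OF F, of UNIV] xr] by simp
  have L_lim: "(\<lambda>n. lap F (x (r n))) \<longlonglongrightarrow> lap F a"
    using continuous_on_tendsto_compose[OF spoly_continuous[OF spoly_lap[OF F], of UNIV] xr] by simp
  have "(\<lambda>n. F (x (r n)) + s (r n) * lap F (x (r n))) \<longlonglongrightarrow> F a + 0 * lap F a"
    by (intro tendsto_intros F_lim L_lim sr)
  moreover have "(\<lambda>n. \<epsilon> - \<delta> * s (r n)) \<longlonglongrightarrow> \<epsilon> - \<delta> * 0"
    by (intro tendsto_intros sr)
  ultimately have "F a + 0 * lap F a \<le> \<epsilon> - \<delta> * 0"
    by (rule LIMSEQ_le) (use bad in \<open>auto intro: less_imp_le\<close>)
  then have "F a \<le> F y" if "y \<in> sphere 0 1" for y using lo[OF that] by simp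
  then have "0 \<le> lap F a"
    unfolding lap_def by (intro sum_nonneg rd_rd_nonneg_at_min[OF F a(1)])
  have "lap F (x n) \<le> - \<delta>" for n
  proof -
    have "s n * lap F (x n) < s n * (- \<delta>)" using bad[of n] lo[OF x, of n] by (simp add: mult.commute)
    then show ?thesis by (subst (asm) mult_less_cancel_left_pos[OF s(1)]) simp
  qed
  then have "lap F a \<le> - \<delta>" by (intro LIMSEQ_le_const2[OF L_lim]) auto
  with \<open>0 \<le> lap F a\<close> \<delta> show False by simp
qed

text \<open>\<open>F\<close> and its rotate agree only on the sphere, so
  \<open>lap_orthogonal\<close> has to be combined with \<open>lap_cong_sphere\<close>.\<close>

lemma rot_invariant_lap:
  assumes F: "spoly d F" and inv: "rot_invariant E F"
  shows "rot_invariant E (lap F)"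
  unfolding rot_invariant_def
proof (intro allI ballI impI)
  fix k l :: 'a and t and x :: "real ^ 'a" assume kl: "k \<noteq> l" "E k l" and x: "x \<in> sphere 0 1"
  have "lap F (rot k l t x) = lap (\<lambda>x. F (rot k l t x)) x"
    by (rule lap_orthogonal[OF orthogonal_transformation_rot[OF kl(1)] F, symmetric])
  also have "\<dots> = lap F x"
    by (rule lap_cong_sphere[OF spoly_linear_compose[OF linear_rot F] F rot_invariantD[OF inv kl] x])
  finally show "lap F (rot k l t x) = lap F x" .
qed

lemma geo_pos: "geo Js p F x > 0"
  by (simp add: geo_def)

text \<open>The maximiser is compared with a corrected heat step of size \<open>s\<close>; to first
  order the integral grows by s / p times the left-hand side, up to a multiple of \<kappa> caused by
  the correction. Finally \<kappa> tends to 0.\<close>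

lemma maximiser_first_order:
  fixes F :: "nat \<Rightarrow> real ^ ('n::{finite,wellorder}) \<Rightarrow> real"
  assumes fin: "finite Js" and \<epsilon>: "0 < \<epsilon>" "\<epsilon> \<le> 1 / 2" and p: "p > 0"
    and F: "\<And>J. J \<in> Js \<Longrightarrow> feasible d \<epsilon> (E J) (F J)"
    and max: "\<And>G. (\<And>J. J \<in> Js \<Longrightarrow> feasible d \<epsilon> (E J) (G J)) \<Longrightarrow>
        (\<integral>x. geo Js p G x \<partial>sphere_measure) \<le> (\<integral>x. geo Js p F x \<partial>sphere_measure)"
  shows "(\<integral>x. geo Js p F x * (\<Sum>J\<in>Js. lap (F J) x / F J x) \<partial>sphere_measure) \<le> 0"
proof -
  have sF: "spoly d (F J)" and inv: "rot_invariant (E J) (F J)" and iF: "(\<integral>x. F J x \<partial>sphere_measure) = 1"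
    if "J \<in> Js" for J using F[OF that] by (auto simp: feasible_def)
  have Flo: "\<epsilon> \<le> F J x" if "J \<in> Js" "x \<in> sphere 0 1" for J x using F[OF that(1)] that(2) by (auto simp: feasible_def)
  have Fpos: "F J x > 0" if "J \<in> Js" "x \<in> sphere 0 1" for J x using Flo[OF that] \<epsilon>(1) by simp
  have cF: "continuous_on (sphere 0 1) (F J)" "continuous_on (sphere 0 1) (lap (F J))" if "J \<in> Js" for J
    by (intro spoly_continuous[OF sF[OF that]] spoly_continuous[OF spoly_lap[OF sF[OF that]]])+
  have Fne: "F J x \<noteq> 0" if "J \<in> Js" "x \<in> sphere 0 1" for J x using Fpos[OF that] by simp
  have cgeo: "continuous_on (sphere 0 1) (geo Js p F)"
    by (intro continuous_on_geo cF Fpos)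
  define S where "S x = (\<Sum>J\<in>Js. lap (F J) x / F J x)" for x
  have cS: "continuous_on (sphere 0 1) S"
    unfolding S_def[abs_def] by (intro continuous_on_sum continuous_on_divide cF ballI Fne)
  define I where "I = (\<integral>x. geo Js p F x * S x \<partial>sphere_measure)"
  define \<Phi> where "\<Phi> = (\<integral>x. geo Js p F x \<partial>sphere_measure)"
  have \<Phi>0: "\<Phi> \<ge> 0" unfolding \<Phi>_def by (intro integral_nonneg_AE AE_I2 less_imp_le geo_pos)
  define N where "N = real (card Js)"
  have key: "I \<le> 2 * N * \<kappa> * \<Phi>" if \<kappa>: "\<kappa> > 0" for \<kappa>
  proof -
    \<comment> \<open>Half of \<kappa> is kept in reserve: the loss \<kappa> s / 2 here and the loss
      \<epsilon> \<kappa> s by renormalisation together do not exceed the added \<kappa> s, because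
      \<epsilon> \<le> 1/2.\<close>
    have "\<exists>s0>0. \<forall>s. 0 < s \<and> s < s0 \<longrightarrow> (\<forall>x\<in>sphere 0 1. \<epsilon> - \<kappa> / 2 * s \<le> F J x + s * lap (F J) x)" if "J \<in> Js" for J
      using lap_step_lower_bound[OF sF[OF that] Flo[OF that], of "\<kappa> / 2"] \<kappa> by simp
    then obtain \<sigma> where \<sigma>: "\<And>J. J \<in> Js \<Longrightarrow> \<sigma> J > (0::real)"
      "\<And>J s x. J \<in> Js \<Longrightarrow> 0 < s \<Longrightarrow> s < \<sigma> J \<Longrightarrow> x \<in> sphere 0 1 \<Longrightarrow> \<epsilon> - \<kappa> / 2 * s \<le> F J x + s * lap (F J) x"
      by metis
    define s0 where "s0 = Min (insert 1 (\<sigma> ` Js))"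
    have s0: "s0 > 0" "\<And>J. J \<in> Js \<Longrightarrow> s0 \<le> \<sigma> J" using fin \<sigma>(1) by (auto simp: s0_def)
    \<comment> \<open>The relative increment: \<open>F J x * (1 + s * w J x)\<close> is the
      corrected step before renormalisation.\<close>
    define w where "w J x = (lap (F J) x + \<kappa>) / F J x" for J x
    have "\<exists>b\<ge>0. \<forall>x\<in>sphere 0 1. \<bar>w J x\<bar> \<le> b" if "J \<in> Js" for J
    proof -
      have "continuous_on (sphere 0 1) (w J)"
        unfolding w_def[abs_def] by (intro continuous_intros cF that ballI Fne)
      from continuous_sphere_bounded[OF this] show ?thesis by metis
    qed
    then obtain b where b: "\<And>J. J \<in> Js \<Longrightarrow> b J \<ge> 0" "\<And>J x. J \<in> Js \<Longrightarrow> x \<in> sphere 0 1 \<Longrightarrow> \<bar>w J x\<bar> \<le> b J"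
      by metis
    define B where "B = sum b Js"
    have B0: "B \<ge> 0" unfolding B_def by (intro sum_nonneg b)
    have B: "\<bar>w J x\<bar> \<le> B" if "J \<in> Js" "x \<in> sphere 0 1" for J x
      using b(2)[OF that] member_le_sum[of J Js b] b(1) that(1) fin unfolding B_def by force
    \<comment> \<open>The three bounds serve feasibility, the range of the estimate for ln (1 + y),
      and the absorption of its quadratic error into \<kappa>.\<close>
    define s where "s = min (s0 / 2) (min (1 / (2 * B + 2)) (\<kappa> / (2 * B\<^sup>2 + 1)))"
    have s: "s > 0" "s < s0" "s * B \<le> 1 / 2" "2 * B\<^sup>2 * s \<le> \<kappa>"
    proof -
      show "s > 0" using s0(1) B0 \<kappa> by (auto simp: s_def intro!: divide_pos_pos add_nonneg_pos)
      show "s < s0" using s0(1) by (simp add: s_def min_def)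
      have "s \<le> 1 / (2 * B + 2)" by (simp add: s_def)
      then have "s * (2 * B + 2) \<le> 1" using B0 by (simp add: pos_le_divide_eq)
      then show "s * B \<le> 1 / 2" using \<open>s > 0\<close> by (simp add: algebra_simps)
      have "s \<le> \<kappa> / (2 * B\<^sup>2 + 1)" by (simp add: s_def)
      moreover have "2 * B\<^sup>2 + 1 > 0" by (simp add: add_nonneg_pos)
      ultimately have "s * (2 * B\<^sup>2 + 1) \<le> \<kappa>" by (simp add: pos_le_divide_eq)
      then show "2 * B\<^sup>2 * s \<le> \<kappa>" using \<open>s > 0\<close> by (simp add: algebra_simps)
    qed
    have \<kappa>s: "1 + \<kappa> * s > 0" "\<kappa> * s > 0" using \<kappa> s(1) by (simp_all add: add_pos_pos)
    \<comment> \<open>The added constant raises the minimum back to \<epsilon>; the factor restores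
      integral 1, as the Laplacian has integral 0.\<close>
    define G where "G J x = (1 / (1 + \<kappa> * s)) * (F J x + s * lap (F J) x + \<kappa> * s)" for J x
    have sG: "spoly d (G J)" if "J \<in> Js" for J
      unfolding G_def[abs_def]
      by (intro spoly_cmult spoly.add spoly.const sF spoly_lap that)
    have feas: "feasible d \<epsilon> (E J) (G J)" if J: "J \<in> Js" for J
      unfolding feasible_def
    proof (intro conjI ballI sG J)
      show "\<epsilon> \<le> G J x" if x: "x \<in> sphere 0 1" for x
      proof -
        have "\<epsilon> - \<kappa> / 2 * s \<le> F J x + s * lap (F J) x"
          using \<sigma>(2)[OF J s(1) _ x] s(2) s0(2)[OF J] by simp
        moreover have "\<epsilon> * (\<kappa> * s) \<le> 1 / 2 * (\<kappa> * s)" using \<epsilon>(2) \<kappa>s(2) by (intro mult_right_mono) auto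
        ultimately have "\<epsilon> * (1 + \<kappa> * s) \<le> F J x + s * lap (F J) x + \<kappa> * s" by (simp add: algebra_simps)
        then show ?thesis using \<kappa>s(1) by (simp add: G_def pos_le_divide_eq)
      qed
      have "(\<integral>x. F J x + s * lap (F J) x + \<kappa> * s \<partial>sphere_measure) = 1 + \<kappa> * s"
        using integrable_spoly[OF sF[OF J]] integrable_spoly[OF spoly_lap[OF sF[OF J]]]
        by (simp add: iF[OF J] sphere_integral_lap[OF sF[OF J]])
      then show "(\<integral>x. G J x \<partial>sphere_measure) = 1" using \<kappa>s(1) unfolding G_def by simp
      show "rot_invariant (E J) (G J)"
        using inv[OF J] rot_invariant_lap[OF sF[OF J] inv[OF J]] by (simp add: rot_invariant_def G_def)
    qed
    have Gpos: "G J x > 0" if "J \<in> Js" "x \<in> sphere 0 1" for J x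
      using feas[OF that(1)] that(2) \<epsilon>(1) by (force simp: feasible_def)
    \<comment> \<open>One \<kappa> pays for the quadratic error of the logarithm, the other for
      \<open>ln (1 + \<kappa> * s)\<close>.\<close>
    have lnG: "ln (F J x) + s * (lap (F J) x / F J x - 2 * \<kappa>) \<le> ln (G J x)"
      if J: "J \<in> Js" and x: "x \<in> sphere 0 1" for J x
    proof -
      have sw: "\<bar>s * w J x\<bar> \<le> s * B" using B[OF J x] s(1) by (simp add: abs_mult)
      then have sw2: "\<bar>s * w J x\<bar> \<le> 1 / 2" using s(3) by simp
      have pos: "1 + s * w J x > 0" using sw2 by (simp add: abs_le_iff)
      have "(s * w J x)\<^sup>2 \<le> (s * B)\<^sup>2" using power_mono[OF sw, of 2] by simp
      also have "\<dots> = s * (B\<^sup>2 * s)" by (simp add: power2_eq_square)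
      finally have "2 * (s * w J x)\<^sup>2 \<le> s * (2 * B\<^sup>2 * s)" by simp
      also have "\<dots> \<le> s * \<kappa>" using s by (intro mult_left_mono) auto
      finally have "s * w J x - s * \<kappa> \<le> ln (1 + s * w J x)"
        using abs_ln_one_plus_x_minus_x_bound[OF sw2] by linarith
      moreover have "s * (lap (F J) x / F J x) \<le> s * w J x"
        using s(1) \<kappa> Fpos[OF J x] by (simp add: w_def add_divide_distrib distrib_left)
      moreover have "ln (1 + \<kappa> * s) \<le> \<kappa> * s" using ln_add_one_self_le_self[of "\<kappa> * s"] \<kappa>s by simp
      moreover have "F J x * (1 + s * w J x) = F J x + s * lap (F J) x + \<kappa> * s"
        using Fpos[OF J x] by (simp add: w_def field_simps)
      then have "G J x = F J x * (1 + s * w J x) / (1 + \<kappa> * s)"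
        by (simp add: G_def)
      then have "ln (G J x) = ln (F J x) + ln (1 + s * w J x) - ln (1 + \<kappa> * s)"
        using pos \<kappa>s(1) Fpos[OF J x] by (simp add: ln_mult ln_div)
      ultimately show ?thesis by (simp add: algebra_simps)
    qed
    have "geo Js p F x + (s / p) * (geo Js p F x * S x - 2 * N * \<kappa> * geo Js p F x) \<le> geo Js p G x"
      if x: "x \<in> sphere 0 1" for x
    proof -
      let ?y = "(s / p) * (S x - 2 * N * \<kappa>)"
      have "(\<Sum>J\<in>Js. ln (F J x) + s * (lap (F J) x / F J x - 2 * \<kappa>)) \<le> (\<Sum>J\<in>Js. ln (G J x))"
        by (intro sum_mono lnG x)
      moreover have "(\<Sum>J\<in>Js. ln (F J x) + s * (lap (F J) x / F J x - 2 * \<kappa>)) = (\<Sum>J\<in>Js. ln (F J x)) + s * (S x - 2 * N * \<kappa>)"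
        by (simp add: S_def N_def sum.distrib sum_distrib_left[symmetric] sum_subtractf)
      ultimately have le: "(\<Sum>J\<in>Js. ln (F J x)) + s * (S x - 2 * N * \<kappa>) \<le> (\<Sum>J\<in>Js. ln (G J x))" by simp
      have "(\<Sum>J\<in>Js. ln (F J x)) / p + ?y \<le> (\<Sum>J\<in>Js. ln (G J x)) / p"
        using divide_right_mono[OF le, of p] p by (simp add: add_divide_distrib)
      then have "geo Js p F x * exp ?y \<le> geo Js p G x"
        unfolding geo_def exp_add[symmetric] by simp
      moreover have "geo Js p F x * (1 + ?y) \<le> geo Js p F x * exp ?y"
        by (intro mult_left_mono exp_ge_add_one_self less_imp_le[OF geo_pos])
      ultimately show ?thesis by (simp add: algebra_simps)
    qed
    then have "(\<integral>x. geo Js p F x + (s / p) * (geo Js p F x * S x - 2 * N * \<kappa> * geo Js p F x) \<partial>sphere_measure)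
        \<le> (\<integral>x. geo Js p G x \<partial>sphere_measure)"
      by (intro sphere_integral_mono continuous_intros cgeo cS continuous_on_geo spoly_continuous[OF sG] Gpos)
    also have "\<dots> \<le> \<Phi>" unfolding \<Phi>_def by (intro max feas)
    also have "(\<integral>x. geo Js p F x + (s / p) * (geo Js p F x * S x - 2 * N * \<kappa> * geo Js p F x) \<partial>sphere_measure)
        = \<Phi> + (s / p) * (I - 2 * N * \<kappa> * \<Phi>)"
      using integrable_continuous_sphere[OF cgeo] integrable_continuous_sphere[OF continuous_on_mult[OF cgeo cS]]
      by (simp add: \<Phi>_def I_def)
    finally have "(s / p) * (I - 2 * N * \<kappa> * \<Phi>) \<le> 0" by simp
    moreover have "s / p > 0" using s(1) p by simp
    ultimately have "I - 2 * N * \<kappa> * \<Phi> \<le> 0" by (metis mult_le_cancel_left_pos mult_zero_right)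
    then show ?thesis by simp
  qed
  have "I \<le> 0"
  proof (rule field_le_epsilon)
    fix r :: real assume r: "r > 0"
    have N0: "2 * N * \<Phi> + 1 > 0" using \<Phi>0 by (simp add: N_def add_nonneg_pos)
    have "I \<le> 2 * N * (r / (2 * N * \<Phi> + 1)) * \<Phi>" using r N0 by (intro key) simp
    also have "\<dots> \<le> r" using r N0 by (simp add: field_simps)
    finally show "I \<le> 0 + r" by simp
  qed
  then show ?thesis by (simp add: I_def S_def)
qed

subsection \<open>The inequality for polynomials\<close>

text \<open>The rotation derivative X of \<open>geo Js p F x * v k l J x\<close> has integral 0. By
  the product rule the first factor contributes \<open>v k l J x\<close> times the sum of all
  \<open>v k l I x\<close> over p, and the second X X F / F - v^2.\<close>

lemma energy_identity:
  fixes F :: "nat \<Rightarrow> real ^ ('n::{finite,wellorder}) \<Rightarrow> real"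
  assumes fin: "finite Js" and J: "J \<in> Js" and F: "\<And>J. J \<in> Js \<Longrightarrow> spoly d (F J)"
    and pos: "\<And>J x. J \<in> Js \<Longrightarrow> x \<in> sphere 0 1 \<Longrightarrow> F J x > 0"
  defines "v \<equiv> \<lambda>k l J x. rd k l (F J) x / F J x"
  shows "(\<integral>x. geo Js p F x * (rd k l (rd k l (F J)) x / F J x) \<partial>sphere_measure)
       = (\<integral>x. geo Js p F x * ((v k l J x)\<^sup>2 - v k l J x * (\<Sum>I\<in>Js. v k l I x) / p) \<partial>sphere_measure)"
proof (cases "k = l")
  case True
  then show ?thesis
    using rd_same[OF F[OF J]] rd_same[OF spoly_rd[OF F[OF J]]] by (simp add: v_def)
next
  case False
  let ?H = "geo Js p F"
  have ne: "F I x \<noteq> 0" if "I \<in> Js" "x \<in> sphere 0 1" for I x using pos[OF that] by simp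
  have cF: "continuous_on (sphere 0 1) (F I)" "continuous_on (sphere 0 1) (rd k l (F I))"
      "continuous_on (sphere 0 1) (rd k l (rd k l (F I)))" if "I \<in> Js" for I
    using F[OF that] by (auto intro: spoly_continuous spoly_rd)
  have cH: "continuous_on (sphere 0 1) ?H" by (intro continuous_on_geo cF pos)
  have cv: "continuous_on (sphere 0 1) (v k l I)" if "I \<in> Js" for I
    unfolding v_def by (intro continuous_on_divide cF ballI ne that)
  have cq: "continuous_on (sphere 0 1) (\<lambda>x. rd k l (rd k l (F J)) x / F J x)"
    by (intro continuous_on_divide cF ballI ne J)
  have csum: "continuous_on (sphere 0 1) (\<lambda>x. v k l J x * (\<Sum>I\<in>Js. v k l I x) / p)"
    unfolding divide_inverse by (intro continuous_intros cv J)
  have "(\<integral>x. ?H x * (rd k l (rd k l (F J)) x / F J x)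
       - ?H x * ((v k l J x)\<^sup>2 - v k l J x * (\<Sum>I\<in>Js. v k l I x) / p) \<partial>sphere_measure) = 0"
  proof (rule sphere_integral_rot_derivative[OF False, of "\<lambda>x. ?H x * v k l J x"])
    show "continuous_on (sphere 0 1) (\<lambda>x. ?H x * v k l J x)" by (intro continuous_intros cH cv J)
    show "continuous_on (sphere 0 1) (\<lambda>x. ?H x * (rd k l (rd k l (F J)) x / F J x)
       - ?H x * ((v k l J x)\<^sup>2 - v k l J x * (\<Sum>I\<in>Js. v k l I x) / p))"
      by (intro continuous_intros cH cq csum cv J)
    fix x :: "real ^ ('n::{finite,wellorder})" assume x: "x \<in> sphere 0 1"
    have dln: "((\<lambda>t. ln (F I (rot k l t x))) has_real_derivative v k l I x) (at 0)" if "I \<in> Js" for I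
      using DERIV_chain2[of ln _ "\<lambda>t. F I (rot k l t x)" 0, OF DERIV_ln_divide rd_rot_derivative[OF False F[OF that], of x]]
        pos[OF that x] by (simp add: v_def)
    have dH: "((\<lambda>t. ?H (rot k l t x)) has_real_derivative ?H x * ((\<Sum>I\<in>Js. v k l I x) / p)) (at 0)"
    proof -
      have "((\<lambda>t. (\<Sum>I\<in>Js. ln (F I (rot k l t x))) / p) has_real_derivative (\<Sum>I\<in>Js. v k l I x) / p) (at 0)"
        by (intro DERIV_cdivide DERIV_sum dln)
      from DERIV_fun_exp[OF this] show ?thesis by (simp add: geo_def)
    qed
    have dv: "((\<lambda>t. v k l J (rot k l t x)) has_real_derivative rd k l (rd k l (F J)) x / F J x - (v k l J x)\<^sup>2) (at 0)"
    proof -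
      have d2: "((\<lambda>t. rd k l (F J) (rot k l t x)) has_real_derivative rd k l (rd k l (F J)) x) (at 0)"
        by (rule rd_rot_derivative[OF False spoly_rd[OF F[OF J]]])
      show ?thesis
        unfolding v_def
        using DERIV_divide[OF d2 rd_rot_derivative[OF False F[OF J], of x]] ne[OF J x]
        by (simp add: field_simps power2_eq_square)
    qed
    show "((\<lambda>t. ?H (rot k l t x) * v k l J (rot k l t x)) has_real_derivative
       ?H x * (rd k l (rd k l (F J)) x / F J x)
       - ?H x * ((v k l J x)\<^sup>2 - v k l J x * (\<Sum>I\<in>Js. v k l I x) / p)) (at 0)"
      using DERIV_mult[OF dH dv] by (simp add: algebra_simps)
  qed
  moreover have "integrable sphere_measure (\<lambda>x. ?H x * (rd k l (rd k l (F J)) x / F J x))"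
    by (intro integrable_continuous_sphere continuous_on_mult cH cq)
  moreover have "integrable sphere_measure (\<lambda>x. ?H x * ((v k l J x)\<^sup>2 - v k l J x * (\<Sum>I\<in>Js. v k l I x) / p))"
    by (intro integrable_continuous_sphere continuous_intros cH csum cv J)
  ultimately show ?thesis
    by (subst (asm) Bochner_Integration.integral_diff) auto
qed

lemma rd_zero_of_rot_invariant:
  assumes "spoly d F" "rot_invariant E F" "E k l" "x \<in> sphere 0 1"
  shows "rd k l F x = 0"
proof (cases "k = l")
  case False
  have "(\<lambda>t. F (rot k l t x)) = (\<lambda>t. F x)"
    using rot_invariantD[OF assms(2) False assms(3,4)] by auto
  with rd_rot_derivative[OF False assms(1), of x] show ?thesis
    using DERIV_unique[OF _ DERIV_const] by metis
qed (use rd_same[OF assms(1)] in simp)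

lemma block_inequality_feasible:
  fixes F0 :: "nat \<Rightarrow> real ^ ('n::{finite,wellorder}) \<Rightarrow> real"
  assumes fin: "finite Js" and \<epsilon>: "0 < \<epsilon>" "\<epsilon> \<le> 1 / 2" and p: "p > 0" and n2: "CARD('n) \<ge> 2"
    and count: "\<And>k l. k \<noteq> l \<Longrightarrow> card {J\<in>Js. \<not> E J k l} \<le> c" and cp: "real c < p"
    and F0: "\<And>J. J \<in> Js \<Longrightarrow> feasible d \<epsilon> (E J) (F0 J)"
  shows "(\<integral>x. geo Js p F0 x \<partial>sphere_measure) \<le> 1"
proof -
  obtain F where F: "\<forall>J\<in>Js. feasible d \<epsilon> (E J) (F J)"
    and max: "\<forall>G. (\<forall>J\<in>Js. feasible d \<epsilon> (E J) (G J)) \<longrightarrow>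
        (\<integral>x. geo Js p G x \<partial>sphere_measure) \<le> (\<integral>x. geo Js p F x \<partial>sphere_measure)"
    using maximiser_exists[OF fin \<epsilon>(1) p, of d E F0] F0 by blast
  have sF: "spoly d (F J)" and inv: "rot_invariant (E J) (F J)" and iF: "(\<integral>x. F J x \<partial>sphere_measure) = 1"
    if "J \<in> Js" for J using F that by (auto simp: feasible_def)
  have Fpos: "F J x > 0" if "J \<in> Js" "x \<in> sphere 0 1" for J x
    using F that \<epsilon>(1) by (force simp: feasible_def)
  have Fne: "F J x \<noteq> 0" if "J \<in> Js" "x \<in> sphere 0 1" for J x using Fpos[OF that] by simp
  let ?H = "geo Js p F"
  define v where "v k l J x = rd k l (F J) x / F J x" for k l J x
  have cF: "continuous_on (sphere 0 1) (F I)" "continuous_on (sphere 0 1) (rd k l (F I))"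
      "continuous_on (sphere 0 1) (rd k l (rd k l (F I)))" if "I \<in> Js" for I k l
    using sF[OF that] by (auto intro: spoly_continuous spoly_rd)
  have cH: "continuous_on (sphere 0 1) ?H" by (intro continuous_on_geo cF Fpos)
  have cv: "continuous_on (sphere 0 1) (v k l I)" if "I \<in> Js" for I k l
    unfolding v_def[abs_def] by (intro continuous_on_divide cF ballI Fne that)
  have cq: "continuous_on (sphere 0 1) (\<lambda>x. rd k l (rd k l (F I)) x / F I x)" if "I \<in> Js" for I k l
    by (intro continuous_on_divide cF ballI Fne that)
  define Q where "Q k l x = ?H x * (\<Sum>J\<in>Js. (v k l J x)\<^sup>2)" for k l x
  have cQ: "continuous_on (sphere 0 1) (Q k l)" for k l
    unfolding Q_def[abs_def] by (intro continuous_intros cH cv)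
  have Q0: "Q k l x \<ge> 0" for k l x
    unfolding Q_def by (intro mult_nonneg_nonneg sum_nonneg less_imp_le[OF geo_pos]) auto
  \<comment> \<open>What Cauchy--Schwarz leaves over; it is positive because \<open>c < p\<close> is
    strict. The case of equality is recovered by a limit in
    \<open>product_inequality_holds\<close>.\<close>
  define \<theta> where "\<theta> = 1 - real c / p"
  have \<theta>: "\<theta> > 0" using cp p by (simp add: \<theta>_def)
  have vzero: "v k l J x = 0" if "J \<in> Js" "k = l \<or> E J k l" "x \<in> sphere 0 1" for k l J x
    using rd_zero_of_rot_invariant[OF sF inv] rd_same[OF sF] that by (auto simp: v_def)
  \<comment> \<open>Cauchy--Schwarz over the at most \<open>c\<close> indices \<open>J\<close> for which \<open>v k l J\<close> can be nonzero\<close>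
  have cs: "(\<Sum>J\<in>Js. v k l J x)\<^sup>2 \<le> real c * (\<Sum>J\<in>Js. (v k l J x)\<^sup>2)" if x: "x \<in> sphere 0 1" for k l x
  proof (cases "k = l")
    case False
    let ?R = "{J\<in>Js. \<not> E J k l}"
    have "(\<Sum>J\<in>Js. v k l J x) = (\<Sum>J\<in>?R. v k l J x)" "(\<Sum>J\<in>Js. (v k l J x)\<^sup>2) = (\<Sum>J\<in>?R. (v k l J x)\<^sup>2)"
      using fin vzero[OF _ _ x] by (auto intro!: sum.mono_neutral_right)
    moreover have "(\<Sum>J\<in>?R. v k l J x)\<^sup>2 \<le> (\<Sum>J\<in>?R. (v k l J x)\<^sup>2) * real (card ?R)"
      by (rule sum_squared_le_sum_of_squares)
    moreover have "\<dots> \<le> (\<Sum>J\<in>?R. (v k l J x)\<^sup>2) * real c"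
      using count[OF False] by (intro mult_left_mono sum_nonneg) auto
    ultimately show ?thesis by (simp add: mult.commute)
  next
    case True
    have "(\<Sum>J\<in>Js. v k l J x) = 0" by (rule sum.neutral) (use True vzero x in auto)
    then show ?thesis by (simp add: sum_nonneg)
  qed
  have lower: "\<theta> * (\<integral>x. Q k l x \<partial>sphere_measure)
      \<le> (\<Sum>J\<in>Js. \<integral>x. ?H x * (rd k l (rd k l (F J)) x / F J x) \<partial>sphere_measure)" for k l
  proof -
    have c1: "continuous_on (sphere 0 1) (\<lambda>x. ?H x * ((v k l J x)\<^sup>2 - v k l J x * (\<Sum>I\<in>Js. v k l I x) / p))" if "J \<in> Js" for J
      unfolding divide_inverse by (intro continuous_intros cH cv that)
    have "\<theta> * (\<integral>x. Q k l x \<partial>sphere_measure) = (\<integral>x. \<theta> * Q k l x \<partial>sphere_measure)" by simp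
    also have "\<dots> \<le> (\<integral>x. (\<Sum>J\<in>Js. ?H x * ((v k l J x)\<^sup>2 - v k l J x * (\<Sum>I\<in>Js. v k l I x) / p)) \<partial>sphere_measure)"
    proof (rule sphere_integral_mono)
      fix x :: "real ^ ('n::{finite,wellorder})" assume x: "x \<in> sphere 0 1"
      have "(\<Sum>J\<in>Js. v k l J x)\<^sup>2 / p \<le> real c * (\<Sum>J\<in>Js. (v k l J x)\<^sup>2) / p"
        using cs[OF x, of k l] p by (intro divide_right_mono) auto
      then have "\<theta> * (\<Sum>J\<in>Js. (v k l J x)\<^sup>2) \<le> (\<Sum>J\<in>Js. (v k l J x)\<^sup>2) - (\<Sum>J\<in>Js. v k l J x)\<^sup>2 / p"
        by (simp add: \<theta>_def left_diff_distrib)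
      then have "?H x * (\<theta> * (\<Sum>J\<in>Js. (v k l J x)\<^sup>2)) \<le> ?H x * ((\<Sum>J\<in>Js. (v k l J x)\<^sup>2) - (\<Sum>J\<in>Js. v k l J x)\<^sup>2 / p)"
        by (rule mult_left_mono[OF _ less_imp_le[OF geo_pos]])
      moreover have "(\<Sum>J\<in>Js. ?H x * ((v k l J x)\<^sup>2 - v k l J x * (\<Sum>I\<in>Js. v k l I x) / p))
          = ?H x * ((\<Sum>J\<in>Js. (v k l J x)\<^sup>2) - (\<Sum>J\<in>Js. v k l J x)\<^sup>2 / p)"
        by (simp add: sum_distrib_left[symmetric] sum_subtractf sum_divide_distrib[symmetric] sum_distrib_right[symmetric] power2_eq_square)
      ultimately show "\<theta> * Q k l x \<le> (\<Sum>J\<in>Js. ?H x * ((v k l J x)\<^sup>2 - v k l J x * (\<Sum>I\<in>Js. v k l I x) / p))"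
        by (simp add: Q_def mult_ac)
    qed (intro continuous_intros cQ c1)+
    also have "\<dots> = (\<Sum>J\<in>Js. \<integral>x. ?H x * ((v k l J x)\<^sup>2 - v k l J x * (\<Sum>I\<in>Js. v k l I x) / p) \<partial>sphere_measure)"
      by (intro Bochner_Integration.integral_sum integrable_continuous_sphere c1)
    also have "\<dots> = (\<Sum>J\<in>Js. \<integral>x. ?H x * (rd k l (rd k l (F J)) x / F J x) \<partial>sphere_measure)"
      unfolding v_def by (intro sum.cong refl energy_identity[OF fin _ sF Fpos, symmetric])
    finally show ?thesis .
  qed
  have "(\<Sum>k\<in>UNIV. \<Sum>l\<in>UNIV. \<theta> * (\<integral>x. Q k l x \<partial>sphere_measure))
      \<le> (\<Sum>k\<in>UNIV. \<Sum>l\<in>UNIV. \<Sum>J\<in>Js. \<integral>x. ?H x * (rd k l (rd k l (F J)) x / F J x) \<partial>sphere_measure)"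
    by (intro sum_mono lower)
  also have "\<dots> = (\<integral>x. (\<Sum>k\<in>UNIV. \<Sum>l\<in>UNIV. \<Sum>J\<in>Js. ?H x * (rd k l (rd k l (F J)) x / F J x)) \<partial>sphere_measure)"
  proof -
    define W where "W k l J x = ?H x * (rd k l (rd k l (F J)) x / F J x)" for k l J x
    have W: "integrable sphere_measure (W k l J)" if "J \<in> Js" for k l J
      unfolding W_def[abs_def] by (intro integrable_continuous_sphere continuous_on_mult cH cq that)
    have "(\<Sum>k\<in>UNIV. \<Sum>l\<in>UNIV. \<Sum>J\<in>Js. \<integral>x. W k l J x \<partial>sphere_measure)
        = (\<integral>x. (\<Sum>k\<in>UNIV. \<Sum>l\<in>UNIV. \<Sum>J\<in>Js. W k l J x) \<partial>sphere_measure)"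
      by (simp add: Bochner_Integration.integral_sum Bochner_Integration.integrable_sum W)
    then show ?thesis by (simp only: W_def)
  qed
  also have "\<dots> = (\<integral>x. ?H x * (\<Sum>J\<in>Js. lap (F J) x / F J x) \<partial>sphere_measure)"
  proof (rule sphere_integral_cong)
    fix x
    have "(\<Sum>k\<in>UNIV. \<Sum>l\<in>UNIV. \<Sum>J\<in>Js. ?H x * (rd k l (rd k l (F J)) x / F J x))
        = (\<Sum>J\<in>Js. \<Sum>k\<in>UNIV. \<Sum>l\<in>UNIV. ?H x * (rd k l (rd k l (F J)) x / F J x))"
      by (simp only: sum.swap[of _ UNIV Js])
    then show "(\<Sum>k\<in>UNIV. \<Sum>l\<in>UNIV. \<Sum>J\<in>Js. ?H x * (rd k l (rd k l (F J)) x / F J x))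
        = ?H x * (\<Sum>J\<in>Js. lap (F J) x / F J x)"
      by (simp add: lap_def sum_distrib_left sum_divide_distrib)
  qed
  also have "\<dots> \<le> 0"
    using F max by (intro maximiser_first_order[OF fin \<epsilon> p]) blast+
  finally have total: "(\<Sum>k\<in>UNIV. \<Sum>l\<in>UNIV. \<theta> * (\<integral>x. Q k l x \<partial>sphere_measure)) \<le> 0" .
  have iQ: "(\<integral>x. Q k l x \<partial>sphere_measure) \<ge> 0" for k l
    by (intro integral_nonneg_AE AE_I2 Q0)
  have "(\<integral>x. Q k l x \<partial>sphere_measure) \<le> 0" for k l
  proof -
    have "\<theta> * (\<integral>x. Q k l x \<partial>sphere_measure) \<le> (\<Sum>l\<in>UNIV. \<theta> * (\<integral>x. Q k l x \<partial>sphere_measure))"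
      by (rule member_le_sum) (use \<theta> iQ in auto)
    also have "\<dots> \<le> (\<Sum>k\<in>UNIV. \<Sum>l\<in>UNIV. \<theta> * (\<integral>x. Q k l x \<partial>sphere_measure))"
      by (rule member_le_sum[of k UNIV "\<lambda>k. \<Sum>l\<in>UNIV. \<theta> * (\<integral>x. Q k l x \<partial>sphere_measure)"])
         (use \<theta> iQ in \<open>auto intro!: sum_nonneg\<close>)
    finally have "\<theta> * (\<integral>x. Q k l x \<partial>sphere_measure) \<le> 0" using total by simp
    then show ?thesis using \<theta> by (simp add: mult_le_0_iff)
  qed
  then have Qz: "Q k l x = 0" if "x \<in> sphere 0 1" for k l x
    using sphere_integral_eq_0[OF cQ Q0] that by blast
  have rdz: "rd k l (F J) x = 0" if J: "J \<in> Js" and x: "x \<in> sphere 0 1" for k l J x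
  proof -
    have "(\<Sum>J\<in>Js. (v k l J x)\<^sup>2) = 0" using Qz[OF x, of k l] geo_pos[of Js p F x] by (simp add: Q_def)
    then have "v k l J x = 0" using J fin by (simp add: sum_nonneg_eq_0_iff)
    then show ?thesis using Fne[OF J x] by (simp add: v_def)
  qed
  have one: "F J x = 1" if J: "J \<in> Js" and x: "x \<in> sphere 0 1" for J x
  proof -
    have "rot_invariant (\<lambda>_ _. True) (F J)"
      unfolding rot_invariant_def
    proof (intro allI ballI impI)
      fix k l :: 'n and t and x :: "real ^ ('n::{finite,wellorder})" assume kl: "k \<noteq> l" and x: "x \<in> sphere 0 1"
      show "F J (rot k l t x) = F J x"
        using rd_rot_derivative[OF kl sF[OF J]] rdz[OF J]
        by (intro rot_invariantI[OF kl x]) metis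
    qed
    then obtain a where a: "\<And>x. x \<in> sphere 0 1 \<Longrightarrow> F J x = a"
      using rot_invariant_all_constant[OF n2] by metis
    have "(\<integral>x. F J x \<partial>sphere_measure) = (\<integral>x. a \<partial>(sphere_measure :: (real ^ ('n::{finite,wellorder})) measure))"
      by (rule sphere_integral_cong) (rule a)
    with iF[OF J] have "a = 1" by simp
    with a[OF x] show ?thesis by simp
  qed
  have "(\<integral>x. ?H x \<partial>sphere_measure) = (\<integral>x. 1 \<partial>(sphere_measure :: (real ^ ('n::{finite,wellorder})) measure))"
    by (rule sphere_integral_cong) (simp add: geo_def one)
  moreover have "(\<integral>x. geo Js p F0 x \<partial>sphere_measure) \<le> (\<integral>x. ?H x \<partial>sphere_measure)"
    using max F0 by blast
  ultimately show ?thesis by simp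
qed

subsection \<open>Approximation by invariant polynomials\<close>

text \<open>Invariant polynomials cannot separate points of one orbit, so Stone--Weierstrass is
  applied on \<open>T\<close>, which meets every orbit and on which they do separate points.
  Invariance of both functions carries the estimate to the sphere.\<close>

lemma rot_invariant_approx:
  fixes F :: "real ^ 'n \<Rightarrow> real"
  assumes E: "equivp E" and F: "continuous_on (sphere 0 1) F" and inv: "rot_invariant E F" and \<eta>: "\<eta> > 0"
  obtains d P where "spoly d P" "rot_invariant E P" "\<And>x. x \<in> sphere 0 1 \<Longrightarrow> \<bar>F x - P x\<bar> < \<eta>"
proof -
  define rep where "rep i = (SOME j. E i j)" for i
  have rep: "E i (rep i)" for i
    unfolding rep_def using equivp_reflp[OF E] by (rule someI)
  have rep_eq: "rep i = rep j" if "E i j" for i j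
    using that E by (simp add: rep_def equivp_def)
  define T :: "(real ^ 'n) set" where "T = {y \<in> sphere 0 1. \<forall>i. rep i \<noteq> i \<longrightarrow> y $ i = 0 \<and> 0 \<le> y $ rep i}"
  have "closed {y :: real ^ 'n. y $ i = 0 \<and> 0 \<le> y $ rep i}" for i
    by (intro closed_Collect_conj closed_Collect_eq closed_Collect_le continuous_intros)
  then have "closed (\<Inter>i\<in>{i. rep i \<noteq> i}. {y :: real ^ 'n. y $ i = 0 \<and> 0 \<le> y $ rep i})" by blast
  moreover have "T = sphere 0 1 \<inter> (\<Inter>i\<in>{i. rep i \<noteq> i}. {y :: real ^ 'n. y $ i = 0 \<and> 0 \<le> y $ rep i})"
    by (auto simp: T_def)
  ultimately have T: "compact T" using compact_Int_closed[OF compact_sphere] by simp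
  let ?P = "\<lambda>f. (\<exists>d. spoly d f) \<and> rot_invariant E f"
  have "\<exists>g. ?P g \<and> (\<forall>x\<in>T. \<bar>F x - g x\<bar> < \<eta>)"
  proof (rule Stone_Weierstrass_HOL[OF T])
    show "?P (\<lambda>x. c)" for c by (auto simp: rot_invariant_def intro: spoly.const)
    show "continuous_on T f" if "?P f" for f using that spoly_continuous by blast
    show "?P (\<lambda>x. f x + g x)" if "?P f \<and> ?P g" for f g
    proof -
      from that obtain d e where "spoly d f" "spoly e g" by blast
      then have "spoly (max d e) (\<lambda>x. f x + g x)"
        by (intro spoly.add) (auto intro: spoly_mono[of d] spoly_mono[of e])
      then show ?thesis using that by (auto simp: rot_invariant_def)
    qed
    show "?P (\<lambda>x. f x * g x)" if "?P f \<and> ?P g" for f g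
      using that by (auto simp: rot_invariant_def intro: spoly_mult)
    show "continuous_on T F" by (rule continuous_on_subset[OF F]) (auto simp: T_def)
    show "\<exists>f. ?P f \<and> f x \<noteq> f y" if "x \<in> T \<and> y \<in> T \<and> x \<noteq> y" for x y
    proof -
      obtain i where i: "x $ i \<noteq> y $ i" using \<open>_ \<and> _ \<and> x \<noteq> y\<close> by (auto simp: vec_eq_iff)
      have x: "\<And>j. rep j \<noteq> j \<Longrightarrow> x $ j = 0 \<and> 0 \<le> x $ rep j" and y: "\<And>j. rep j \<noteq> j \<Longrightarrow> y $ j = 0 \<and> 0 \<le> y $ rep j"
        using that by (auto simp: T_def)
      \<comment> \<open>Points of \<open>T\<close> vanish off the representatives, so they can
        differ only at a representative.\<close>
      have ri: "rep i = i" using x[of i] y[of i] i by metis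
      show ?thesis
      proof (cases "\<exists>j. j \<noteq> i \<and> E i j")
        case False
        have "rot_invariant E (\<lambda>x. x $ i)"
          unfolding rot_invariant_def
        proof (intro allI ballI impI)
          fix k l t and x :: "real ^ 'n" assume kl: "k \<noteq> l" "E k l"
          then have "i \<noteq> k \<and> i \<noteq> l" using False E by (metis equivp_symp)
          then show "rot k l t x $ i = x $ i" using kl by (simp add: rot_nth)
        qed
        then show ?thesis using i spoly_nth[of i] by blast
      next
        case True
        then obtain j where j: "j \<noteq> i" "E i j" by blast
        have rj: "rep j = i" using rep_eq[OF j(2)] ri by simp
        \<comment> \<open>On \<open>T\<close> this squared block norm is the square of the
          representative's coordinate, which is nonnegative there and hence determined by
          it.\<close>
        define f where "f z = (\<Sum>j\<in>{j. E i j}. (z $ j)\<^sup>2)" for z :: "real ^ 'n"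
        have "rot_invariant E f"
          unfolding rot_invariant_def f_def
        proof (intro allI ballI impI)
          fix k l t and x :: "real ^ 'n" assume kl: "k \<noteq> l" "E k l"
          then have "E i k \<longleftrightarrow> E i l" using E by (metis equivp_symp equivp_transp)
          then show "(\<Sum>j\<in>{j. E i j}. (rot k l t x $ j)\<^sup>2) = (\<Sum>j\<in>{j. E i j}. (x $ j)\<^sup>2)"
            by (intro sum_squares_rot[OF kl(1)]) simp
        qed
        moreover have "spoly 2 f"
          unfolding f_def[abs_def] power2_eq_square
          using spoly_mult[OF spoly_nth spoly_nth] by (intro spoly_sum) (auto simp: numeral_2_eq_2)
        moreover have fz: "f z = (z $ i)\<^sup>2" if z: "\<And>j. rep j \<noteq> j \<Longrightarrow> z $ j = 0" for z
        proof -
          have "(\<Sum>j\<in>{j. E i j}. (z $ j)\<^sup>2) = (\<Sum>j\<in>{i}. (z $ j)\<^sup>2)"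
          proof (rule sum.mono_neutral_right)
            show "\<forall>j\<in>{j. E i j} - {i}. (z $ j)\<^sup>2 = 0"
            proof
              fix j assume "j \<in> {j. E i j} - {i}"
              then have "rep j \<noteq> j" using rep_eq[of i j] ri by auto
              then show "(z $ j)\<^sup>2 = 0" using z by simp
            qed
          qed (use equivp_reflp[OF E] in auto)
          then show ?thesis by (simp add: f_def)
        qed
        have "f x = (x $ i)\<^sup>2" "f y = (y $ i)\<^sup>2" using fz x y by blast+
        moreover have "0 \<le> x $ i" "0 \<le> y $ i" using x[of j] y[of j] rj j(1) by auto
        ultimately show ?thesis using i by (intro exI[of _ f]) (auto simp: power2_eq_iff_nonneg)
      qed
    qed
  qed (use \<eta> in auto)
  then obtain d g where g: "spoly d g" "rot_invariant E g" "\<And>x. x \<in> T \<Longrightarrow> \<bar>F x - g x\<bar> < \<eta>" by blast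
  have "\<bar>F x - g x\<bar> < \<eta>" if x: "x \<in> sphere 0 1" for x
  proof -
    obtain y where "y \<in> T" "F y = F x" "g y = g x"
      using rot_reduce[of E rep, OF E rep rep_eq x] inv g(2) unfolding T_def by blast
    then show ?thesis using g(3)[of y] by simp
  qed
  then show ?thesis using that g by blast
qed

subsection \<open>The inequality for continuous functions\<close>

lemma exp_sum_ln:
  assumes "finite Js" "\<And>J. J \<in> Js \<Longrightarrow> a J > (0::real)"
  shows "exp ((\<Sum>J\<in>Js. ln (a J)) / p) = (\<Prod>J\<in>Js. a J powr (1 / p))"
proof -
  have "exp ((\<Sum>J\<in>Js. ln (a J)) / p) = (\<Prod>J\<in>Js. exp (ln (a J) / p))"
    using assms(1) by (simp add: sum_divide_distrib exp_sum)
  also have "\<dots> = (\<Prod>J\<in>Js. a J powr (1 / p))"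
  proof (rule prod.cong[OF refl])
    fix J assume "J \<in> Js"
    then have "a J \<noteq> 0" using assms(2) by force
    then show "exp (ln (a J) / p) = a J powr (1 / p)" by (simp add: powr_def)
  qed
  finally show ?thesis .
qed

text \<open>Approximating f^p + 2 \<eta> within \<eta> gives a polynomial between f^p + \<eta> and
  f^p + 3 \<eta>: it is positive, dominates f^p, and its integral exceeds that of f^p by at most 3
  \<eta>.\<close>

lemma block_inequality_approx:
  fixes f :: "nat \<Rightarrow> real ^ ('n::{finite,wellorder}) \<Rightarrow> real"
  assumes fin: "finite Js" and p: "p > 0" and n2: "CARD('n) \<ge> 2"
    and E: "\<And>J. J \<in> Js \<Longrightarrow> equivp (E J)"
    and count: "\<And>k l. k \<noteq> l \<Longrightarrow> card {J\<in>Js. \<not> E J k l} \<le> c" and cp: "real c < p"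
    and cont: "\<And>J. J \<in> Js \<Longrightarrow> continuous_on (sphere 0 1) (f J)"
    and inv: "\<And>J. J \<in> Js \<Longrightarrow> rot_invariant (E J) (f J)"
    and nn: "\<And>J x. J \<in> Js \<Longrightarrow> x \<in> sphere 0 1 \<Longrightarrow> f J x \<ge> 0"
    and \<eta>: "\<eta> > 0"
  shows "(\<integral>x. (\<Prod>J\<in>Js. f J x) \<partial>sphere_measure)
     \<le> (\<Prod>J\<in>Js. ((\<integral>x. f J x powr p \<partial>sphere_measure) + 3 * \<eta>) powr (1 / p))"
proof -
  have cfp: "continuous_on (sphere 0 1) (\<lambda>x. f J x powr p)" if "J \<in> Js" for J
    by (rule continuous_on_powr'[OF cont[OF that] continuous_on_const]) (use p nn[OF that] in auto)
  have "\<exists>d P. spoly d P \<and> rot_invariant (E J) P \<and> (\<forall>x\<in>sphere 0 1. \<bar>f J x powr p + 2 * \<eta> - P x\<bar> < \<eta>)" if J: "J \<in> Js" for J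
  proof -
    have "continuous_on (sphere 0 1) (\<lambda>x. f J x powr p + 2 * \<eta>)" by (intro continuous_intros cfp J)
    moreover have "rot_invariant (E J) (\<lambda>x. f J x powr p + 2 * \<eta>)"
      using inv[OF J] by (simp add: rot_invariant_def)
    ultimately show ?thesis using rot_invariant_approx[OF E[OF J] _ _ \<eta>] by metis
  qed
  then obtain d P where P: "\<And>J. J \<in> Js \<Longrightarrow> spoly (d J) (P J)" "\<And>J. J \<in> Js \<Longrightarrow> rot_invariant (E J) (P J)"
    and near: "\<And>J x. J \<in> Js \<Longrightarrow> x \<in> sphere 0 1 \<Longrightarrow> \<bar>f J x powr p + 2 * \<eta> - P J x\<bar> < \<eta>" by metis
  have lo: "f J x powr p + \<eta> \<le> P J x" and hi: "P J x \<le> f J x powr p + 3 * \<eta>" if "J \<in> Js" "x \<in> sphere 0 1" for J x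
    using near[OF that] by (auto simp: abs_less_iff)
  have lo\<eta>: "\<eta> \<le> P J x" if "J \<in> Js" "x \<in> sphere 0 1" for J x
    using lo[OF that] powr_ge_zero[of "f J x" p] by linarith
  have Ppos: "P J x > 0" if "J \<in> Js" "x \<in> sphere 0 1" for J x using lo\<eta>[OF that] \<eta> by simp
  have cP: "continuous_on (sphere 0 1) (P J)" if "J \<in> Js" for J
    by (rule spoly_continuous[OF P(1)[OF that]])
  define A where "A J = (\<integral>x. P J x \<partial>sphere_measure)" for J
  have A: "\<eta> \<le> A J" if J: "J \<in> Js" for J
    using sphere_integral_mono[OF continuous_on_const cP[OF J], of \<eta>] lo\<eta>[OF J] unfolding A_def by simp
  have Apos: "A J > 0" if "J \<in> Js" for J using A[OF that] \<eta> by simp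
  define Q where "Q J x = (1 / A J) * P J x" for J x
  define D where "D = sum d Js"
  \<comment> \<open>One lower bound for all \<open>J\<close>: dividing by \<open>A J\<close>, which
    is below \<open>1 + sum A Js\<close>, leaves at least this much. The cap 1/2 is the one required
    by the first-order condition.\<close>
  define \<epsilon> where "\<epsilon> = min (1 / 2) (\<eta> / (1 + sum A Js))"
  have sA: "sum A Js \<ge> 0" by (intro sum_nonneg less_imp_le Apos)
  have \<epsilon>: "\<epsilon> > 0" using \<eta> sA by (auto simp: \<epsilon>_def intro!: divide_pos_pos)
  have \<epsilon>2: "\<epsilon> \<le> 1 / 2" unfolding \<epsilon>_def by (rule min.cobounded1)
  have feas: "feasible D \<epsilon> (E J) (Q J)" if J: "J \<in> Js" for J
    unfolding feasible_def
  proof (intro conjI ballI)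
    have "d J \<le> D" unfolding D_def using J fin by (intro member_le_sum) auto
    then show "spoly D (Q J)"
      unfolding Q_def[abs_def] by (intro spoly_cmult spoly_mono[OF _ P(1)[OF J]])
    show "(\<integral>x. Q J x \<partial>sphere_measure) = 1"
      using Apos[OF J] by (simp add: Q_def A_def[symmetric])
    show "rot_invariant (E J) (Q J)" using P(2)[OF J] by (simp add: rot_invariant_def Q_def)
    show "\<epsilon> \<le> Q J x" if x: "x \<in> sphere 0 1" for x
    proof -
      have "A J \<le> sum A Js" using J fin Apos by (intro member_le_sum less_imp_le) auto
      have "\<epsilon> \<le> \<eta> / (1 + sum A Js)" by (simp add: \<epsilon>_def)
      also have "\<dots> \<le> \<eta> / A J" using \<open>A J \<le> sum A Js\<close> Apos[OF J] \<eta> by (intro divide_left_mono) auto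
      also have "\<dots> \<le> Q J x" using lo\<eta>[OF J x] Apos[OF J] by (simp add: Q_def divide_right_mono)
      finally show ?thesis .
    qed
  qed
  have le1: "(\<integral>x. geo Js p Q x \<partial>sphere_measure) \<le> 1"
    by (rule block_inequality_feasible[OF fin \<epsilon> \<epsilon>2 p n2 count cp feas])
  have geoP: "geo Js p P x = exp ((\<Sum>J\<in>Js. ln (A J)) / p) * geo Js p Q x" if x: "x \<in> sphere 0 1" for x
  proof -
    have "ln (P J x) = ln (A J) + ln (Q J x)" if "J \<in> Js" for J
      using Apos[OF that] Ppos[OF that x] by (simp add: Q_def ln_div)
    then have "(\<Sum>J\<in>Js. ln (P J x)) = (\<Sum>J\<in>Js. ln (A J)) + (\<Sum>J\<in>Js. ln (Q J x))"
      by (simp add: sum.distrib)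
    then show ?thesis by (simp add: geo_def add_divide_distrib exp_add)
  qed
  have "(\<integral>x. (\<Prod>J\<in>Js. f J x) \<partial>sphere_measure) \<le> (\<integral>x. geo Js p P x \<partial>sphere_measure)"
  proof (rule sphere_integral_mono)
    show "continuous_on (sphere 0 1) (\<lambda>x. \<Prod>J\<in>Js. f J x)" by (intro continuous_on_prod cont)
    show "continuous_on (sphere 0 1) (geo Js p P)" by (intro continuous_on_geo cP Ppos)
    fix x :: "real ^ ('n::{finite,wellorder})" assume x: "x \<in> sphere 0 1"
    have "f J x \<le> P J x powr (1 / p)" if J: "J \<in> Js" for J
    proof -
      have "f J x = (f J x powr p) powr (1 / p)" using nn[OF J x] p by (simp add: powr_powr)
      also have "\<dots> \<le> P J x powr (1 / p)" using lo[OF J x] \<eta> p by (intro powr_mono2) auto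
      finally show ?thesis .
    qed
    then have "(\<Prod>J\<in>Js. f J x) \<le> (\<Prod>J\<in>Js. P J x powr (1 / p))"
      using nn x by (intro prod_mono) auto
    also have "\<dots> = geo Js p P x"
      unfolding geo_def using Ppos x by (intro exp_sum_ln[symmetric] fin) auto
    finally show "(\<Prod>J\<in>Js. f J x) \<le> geo Js p P x" .
  qed
  also have "\<dots> = (\<integral>x. exp ((\<Sum>J\<in>Js. ln (A J)) / p) * geo Js p Q x \<partial>sphere_measure)"
    by (rule sphere_integral_cong) (rule geoP)
  also have "\<dots> \<le> exp ((\<Sum>J\<in>Js. ln (A J)) / p)" using le1 by simp
  also have "\<dots> = (\<Prod>J\<in>Js. A J powr (1 / p))" by (intro exp_sum_ln fin Apos)
  also have "\<dots> \<le> (\<Prod>J\<in>Js. ((\<integral>x. f J x powr p \<partial>sphere_measure) + 3 * \<eta>) powr (1 / p))"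
  proof (intro prod_mono conjI powr_mono2)
    fix J assume J: "J \<in> Js"
    have "A J \<le> (\<integral>x. f J x powr p + 3 * \<eta> \<partial>sphere_measure)"
      unfolding A_def by (intro sphere_integral_mono cP J continuous_intros cfp hi)
    also have "\<dots> = (\<integral>x. f J x powr p \<partial>sphere_measure) + 3 * \<eta>"
      using integrable_continuous_sphere[OF cfp[OF J]] by simp
    finally show "A J \<le> (\<integral>x. f J x powr p \<partial>sphere_measure) + 3 * \<eta>" .
  qed (use Apos p in \<open>auto intro: less_imp_le\<close>)
  finally show ?thesis .
qed

text \<open>Limit \<eta> to 0. An integral on the right may be 0, so the limit uses continuity of
  \<open>powr\<close> at base 0 for a positive exponent.\<close>

lemma block_inequality:
  fixes f :: "nat \<Rightarrow> real ^ ('n::{finite,wellorder}) \<Rightarrow> real"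
  assumes fin: "finite Js" and p: "p > 0" and n2: "CARD('n) \<ge> 2"
    and E: "\<And>J. J \<in> Js \<Longrightarrow> equivp (E J)"
    and count: "\<And>k l. k \<noteq> l \<Longrightarrow> card {J\<in>Js. \<not> E J k l} \<le> c" and cp: "real c < p"
    and cont: "\<And>J. J \<in> Js \<Longrightarrow> continuous_on (sphere 0 1) (f J)"
    and inv: "\<And>J. J \<in> Js \<Longrightarrow> rot_invariant (E J) (f J)"
    and nn: "\<And>J x. J \<in> Js \<Longrightarrow> x \<in> sphere 0 1 \<Longrightarrow> f J x \<ge> 0"
  shows "(\<integral>x. (\<Prod>J\<in>Js. f J x) \<partial>sphere_measure)
     \<le> (\<Prod>J\<in>Js. (\<integral>x. f J x powr p \<partial>sphere_measure) powr (1 / p))"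
proof -
  let ?a = "\<lambda>J. \<integral>x. f J x powr p \<partial>sphere_measure"
  have a0: "?a J \<ge> 0" for J by (intro integral_nonneg_AE AE_I2) simp
  have h: "(\<lambda>n. 1 / real (Suc n)) \<longlonglongrightarrow> 0"
    using LIMSEQ_inverse_real_of_nat by (simp add: inverse_eq_divide)
  have "(\<lambda>n. \<Prod>J\<in>Js. (?a J + 3 * (1 / real (Suc n))) powr (1 / p)) \<longlonglongrightarrow> (\<Prod>J\<in>Js. (?a J + 3 * 0) powr (1 / p))"
    using p a0 by (intro tendsto_prod tendsto_powr' tendsto_intros h) (auto intro!: always_eventually add_nonneg_nonneg)
  then have "(\<integral>x. (\<Prod>J\<in>Js. f J x) \<partial>sphere_measure) \<le> (\<Prod>J\<in>Js. (?a J + 3 * 0) powr (1 / p))"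
    by (rule LIMSEQ_le_const) (intro exI[of _ 0] allI impI block_inequality_approx[OF assms], auto)
  then show ?thesis by simp
qed

subsection \<open>Smooth functions\<close>

lemma has_partial_deriv:
  assumes "(F has_derivative D) (at x)"
  shows "partial_deriv i F x = D (axis i 1)"
  unfolding partial_deriv_def using frechet_derivative_at[OF assms] by simp

lemma differentiable_cong_open:
  fixes F G :: "real ^ 'n \<Rightarrow> real"
  assumes "open S" "\<And>x. x \<in> S \<Longrightarrow> F x = G x" "x \<in> S" "F differentiable (at x)"
  shows "G differentiable (at x)" "partial_deriv i F x = partial_deriv i G x"
proof -
  obtain D where "(F has_derivative D) (at x)" using assms(4) by (auto simp: differentiable_def)
  moreover from this have "(G has_derivative D) (at x)"
    by (rule has_derivative_transform_within_open[OF _ assms(1,3,2)])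
  ultimately show "G differentiable (at x)" "partial_deriv i F x = partial_deriv i G x"
    by (auto simp: differentiable_def has_partial_deriv)
qed

lemma Ck_on_cong:
  assumes "open S"
  shows "(\<And>x. x \<in> S \<Longrightarrow> F x = G x) \<Longrightarrow> Ck_on k S F \<Longrightarrow> Ck_on k S G"
proof (induction k arbitrary: F G)
  case 0
  then show ?case by (simp cong: continuous_on_cong)
next
  case (Suc k)
  note d = differentiable_cong_open[OF assms Suc.prems(1)]
  have "G differentiable (at x)" if "x \<in> S" for x
    using d(1)[OF _ that] Suc.prems(2) that by auto
  moreover have "Ck_on k S (partial_deriv i G)" for i
    by (rule Suc.IH[of "partial_deriv i F"]) (use d(2) Suc.prems(2) in auto)
  ultimately show ?case by simp
qed

lemma Ck_on_continuous: "Ck_on k S F \<Longrightarrow> continuous_on S F"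
  by (cases k) (auto intro!: differentiable_imp_continuous_on differentiable_at_imp_differentiable_on)

lemma Ck_on_Suc: "Ck_on (Suc k) S F \<Longrightarrow> Ck_on k S F"
proof (induction k arbitrary: F)
  case 0
  then show ?case using Ck_on_continuous by (metis Ck_on.simps(1))
next
  case (Suc k)
  then show ?case by (metis Ck_on.simps(2))
qed

lemma Ck_on_const: "Ck_on k (S :: (real ^ 'n) set) (\<lambda>x. c)"
proof (induction k arbitrary: c)
  case (Suc k)
  have "partial_deriv i (\<lambda>x :: real ^ 'n. c) = (\<lambda>x. 0)" for i by (simp add: fun_eq_iff partial_deriv_def)
  then show ?case using Suc by simp
qed simp

lemma Ck_on_add:
  assumes "open S"
  shows "Ck_on k S F \<Longrightarrow> Ck_on k S G \<Longrightarrow> Ck_on k S (\<lambda>x. F x + G x)"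
proof (induction k arbitrary: F G)
  case (Suc k)
  have "Ck_on k S (partial_deriv i (\<lambda>x. F x + G x))" for i
  proof (rule Ck_on_cong[OF assms])
    show "Ck_on k S (\<lambda>x. partial_deriv i F x + partial_deriv i G x)" using Suc by simp
    show "partial_deriv i F x + partial_deriv i G x = partial_deriv i (\<lambda>x. F x + G x) x" if "x \<in> S" for x
      using has_partial_deriv[OF has_derivative_add[OF frechet_derivative_works[THEN iffD1] frechet_derivative_works[THEN iffD1]], of F x G] Suc.prems that
      by (simp add: partial_deriv_def)
  qed
  then show ?case using Suc.prems by simp
qed (simp add: continuous_on_add)

lemma Ck_on_mult:
  assumes "open S"
  shows "Ck_on k S F \<Longrightarrow> Ck_on k S G \<Longrightarrow> Ck_on k S (\<lambda>x. F x * G x)"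
proof (induction k arbitrary: F G)
  case (Suc k)
  have "Ck_on k S (partial_deriv i (\<lambda>x. F x * G x))" for i
  proof (rule Ck_on_cong[OF assms])
    show "Ck_on k S (\<lambda>x. F x * partial_deriv i G x + partial_deriv i F x * G x)"
      using Suc.prems by (intro Ck_on_add[OF assms] Suc.IH) (auto intro: Ck_on_Suc)
    show "F x * partial_deriv i G x + partial_deriv i F x * G x = partial_deriv i (\<lambda>x. F x * G x) x" if "x \<in> S" for x
      using has_partial_deriv[OF has_derivative_mult[OF frechet_derivative_works[THEN iffD1] frechet_derivative_works[THEN iffD1]], of F x G] Suc.prems that
      by (simp add: partial_deriv_def)
  qed
  then show ?case using Suc.prems by simp
qed (simp add: continuous_on_mult)

text \<open>The chain rule uses up one order, so \<open>\<phi>' (F x)\<close> is required only one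
  order lower. The derivatives of exp and inverse are expressed by these functions themselves, which
  lets an induction on \<open>k\<close> close.\<close>

lemma Ck_on_compose:
  assumes S: "open S" and F: "Ck_on k S F"
    and \<phi>: "\<And>x. x \<in> S \<Longrightarrow> (\<phi> has_real_derivative \<phi>' (F x)) (at (F x))"
    and \<phi>': "\<And>j. Suc j = k \<Longrightarrow> Ck_on j S (\<lambda>x. \<phi>' (F x))"
  shows "Ck_on k S (\<lambda>x. \<phi> (F x))"
proof (cases k)
  case 0
  have "continuous_on (F ` S) \<phi>"
    using \<phi> by (auto intro!: continuous_at_imp_continuous_on DERIV_isCont)
  then show ?thesis using F 0 continuous_on_compose[of S F \<phi>] by (simp add: o_def)
next
  case (Suc j)
  have d: "((\<lambda>x. \<phi> (F x)) has_derivative (\<lambda>h. \<phi>' (F x) * frechet_derivative F (at x) h)) (at x)" if x: "x \<in> S" for x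
  proof -
    have "(F has_derivative frechet_derivative F (at x)) (at x)"
      using F x by (simp add: Suc frechet_derivative_works[symmetric])
    from has_derivative_compose[OF this \<phi>[OF x, unfolded has_field_derivative_def]] show ?thesis .
  qed
  have "Ck_on j S (partial_deriv i (\<lambda>x. \<phi> (F x)))" for i
  proof (rule Ck_on_cong[OF S])
    show "Ck_on j S (\<lambda>x. \<phi>' (F x) * partial_deriv i F x)"
      using F \<phi>'[of j] by (intro Ck_on_mult[OF S]) (simp_all add: Suc)
    show "\<phi>' (F x) * partial_deriv i F x = partial_deriv i (\<lambda>x. \<phi> (F x)) x" if "x \<in> S" for x
      using has_partial_deriv[OF d[OF that]] by (simp add: partial_deriv_def)
  qed
  then show ?thesis using d Suc by (auto simp: differentiable_def)
qed

lemma Ck_on_exp: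
  assumes "open S"
  shows "Ck_on k S F \<Longrightarrow> Ck_on k S (\<lambda>x. exp (F x))"
proof (induction k)
  case 0
  then show ?case by (simp add: continuous_on_exp)
next
  case (Suc k)
  have "Ck_on k S (\<lambda>x. exp (F x))" by (rule Suc.IH[OF Ck_on_Suc[OF Suc.prems]])
  then show ?case
    by (intro Ck_on_compose[OF assms Suc.prems, where \<phi> = exp and \<phi>' = exp]) (simp_all add: DERIV_exp)
qed

lemma Ck_on_inverse:
  assumes "open S" "\<And>x. x \<in> S \<Longrightarrow> F x \<noteq> 0"
  shows "Ck_on k S F \<Longrightarrow> Ck_on k S (\<lambda>x. inverse (F x))"
proof (induction k)
  case 0
  then show ?case using assms(2) by (simp add: continuous_on_inverse)
next
  case (Suc k)
  have "Ck_on k S (\<lambda>x. -1 * (inverse (F x) * inverse (F x)))"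
    by (intro Ck_on_mult Ck_on_const assms(1) Suc.IH Ck_on_Suc[OF Suc.prems])
  then show ?case
    by (intro Ck_on_compose[OF assms(1) Suc.prems, where \<phi> = inverse and \<phi>' = "\<lambda>y. -1 * (inverse y * inverse y)"])
       (auto intro!: DERIV_inverse[THEN DERIV_cong] assms(2) simp: power2_eq_square)
qed

lemma Ck_on_spoly: "open S \<Longrightarrow> spoly d F \<Longrightarrow> Ck_on k S F"
proof (induction k arbitrary: d F)
  case 0
  then show ?case by (simp add: spoly_continuous)
next
  case (Suc k)
  have "spoly d F \<Longrightarrow> \<exists>G. spoly d G \<and> (\<forall>x. partial_deriv i F x = G x)" for i
  proof (induction rule: spoly.induct)
    case (const d c)
    then show ?case by (intro exI[of _ "\<lambda>_. 0"]) (simp add: spoly.const partial_deriv_def)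
  next
    case (add d F G)
    then obtain F' G' where "spoly d F'" "spoly d G'" "\<forall>x. partial_deriv i F x = F' x" "\<forall>x. partial_deriv i G x = G' x" by blast
    moreover have "partial_deriv i (\<lambda>x. F x + G x) x = partial_deriv i F x + partial_deriv i G x" for x
      using has_partial_deriv[OF has_derivative_add[OF frechet_derivative_works[THEN iffD1] frechet_derivative_works[THEN iffD1]], of F x G]
        spoly_differentiable add.hyps by (auto simp: partial_deriv_def)
    ultimately show ?case by (intro exI[of _ "\<lambda>x. F' x + G' x"]) (auto intro: spoly.add)
  next
    case (mult d F j)
    then obtain F' where F': "spoly d F'" "\<forall>x. partial_deriv i F x = F' x" by blast
    have "((\<lambda>x. x $ j) has_derivative (\<lambda>h. h $ j)) (at x)" for x :: "real ^ 'a"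
      using bounded_linear_imp_has_derivative[OF bounded_linear_vec_nth] .
    from has_partial_deriv[OF has_derivative_mult[OF this frechet_derivative_works[THEN iffD1]]]
    have "partial_deriv i (\<lambda>x. x $ j * F x) x = x $ j * F' x + (if i = j then 1 else 0) * F x" for x
      using spoly_differentiable[OF mult.hyps] F'(2) by (auto simp: partial_deriv_def axis_def)
    moreover have "spoly (Suc d) (\<lambda>x. x $ j * F' x + (if i = j then 1 else 0) * F x)"
      using mult.hyps F'(1) by (intro spoly.add spoly.mult spoly_cmult) (auto intro: spoly_Suc)
    ultimately show ?case by blast
  qed
  then have "Ck_on k S (partial_deriv i F)" for i
    using Suc by (metis ext)
  then show ?case using spoly_differentiable[OF Suc.prems(2)] by simp
qed

subsection \<open>Symmetric functions\<close>

lemma radial_extension_sphere: "x \<in> sphere 0 1 \<Longrightarrow> radial_extension f x = f x"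
  by (simp add: radial_extension_def sgn_div_norm)

lemma smooth_on_sphere_differentiable:
  assumes "smooth_on_sphere f" "x \<in> sphere 0 1"
  shows "radial_extension f differentiable (at x)"
proof -
  have "Ck_on (Suc 0) (- {0}) (radial_extension f)" using assms(1) unfolding smooth_on_sphere_def by blast
  then show ?thesis using assms(2) by auto
qed

lemma smooth_on_sphere_continuous:
  assumes "smooth_on_sphere f"
  shows "continuous_on (sphere 0 1) f"
proof -
  have "Ck_on 0 (- {0}) (radial_extension f)" using assms unfolding smooth_on_sphere_def by blast
  then have "continuous_on (sphere 0 1) (radial_extension f)"
    by (auto intro: continuous_on_subset)
  then show ?thesis
    by (rule continuous_on_eq) (rule radial_extension_sphere)
qed

lemma rotation_field_derivative:
  assumes f: "smooth_on_sphere f" and kl: "k \<noteq> l" and x: "x \<in> sphere 0 1"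
  shows "((\<lambda>t. f (rot k l t x)) has_real_derivative rotation_field k l f x) (at 0)"
proof -
  let ?D = "frechet_derivative (radial_extension f) (at x)"
  have lin: "linear ?D" by (intro linear_frechet_derivative smooth_on_sphere_differentiable f x)
  have "?D (rot_gen k l x) = rotation_field k l f x"
    by (simp add: rot_gen_def rotation_field_def partial_deriv_def linear_diff[OF lin] linear_cmul[OF lin])
  moreover have "(\<lambda>t. radial_extension f (rot k l t x)) = (\<lambda>t. f (rot k l t x))"
    using rot_in_sphere[OF kl x] by (simp add: radial_extension_sphere)
  ultimately show ?thesis
    using rot_differentiable[OF kl smooth_on_sphere_differentiable[OF f x]] by simp
qed

text \<open>A field vanishing on \<open>f\<close> at all points of the sphere makes \<open>f\<close>
  constant along its orbits. The fields carry increasing indices; a decreasing pair gives the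
  inverse rotation.\<close>

lemma symmetric_rot_invariant:
  assumes f: "symmetric_wrt A f" and E: "equivp E"
    and A: "\<And>k l. k < l \<Longrightarrow> E k l \<Longrightarrow> rotation_field k l \<in> A"
  shows "rot_invariant E (f :: real ^ ('n::{finite,wellorder}) \<Rightarrow> real)"
proof -
  have *: "f (rot k l t x) = f x" if "k < l" "E k l" "x \<in> sphere 0 1" for k l t x
  proof (rule rot_invariantI)
    show "((\<lambda>t. f (rot k l t x)) has_real_derivative 0) (at 0)" if "x \<in> sphere 0 1" for x
      using rotation_field_derivative[of f k l x] f A[OF \<open>k < l\<close> \<open>E k l\<close>] that \<open>k < l\<close> unfolding symmetric_wrt_def by force
  qed (use that in auto)
  show ?thesis
    unfolding rot_invariant_def
  proof (intro allI ballI impI)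
    fix k l t and x :: "real ^ ('n::{finite,wellorder})" assume kl: "k \<noteq> l" "E k l" and x: "x \<in> sphere 0 1"
    show "f (rot k l t x) = f x"
    proof (cases "k < l")
      case False
      then have "l < k" using kl(1) by simp
      moreover have "E l k" using kl(2) E by (metis equivp_symp)
      ultimately show ?thesis using * x rot_swap[of l k t x] by simp
    qed (use * kl x in auto)
  qed
qed

lemma rot_invariant_symmetric:
  assumes "smooth_on_sphere f" "rot_invariant E f"
    and "\<And>X. X \<in> A \<Longrightarrow> \<exists>k l. X = rotation_field k l \<and> k \<noteq> l \<and> E k l"
  shows "symmetric_wrt A f"
  unfolding symmetric_wrt_def
proof (intro conjI ballI assms(1))
  fix X and x :: "real ^ 'a" assume "X \<in> A" and x: "x \<in> sphere 0 1"
  then obtain k l where X: "X = rotation_field k l" "k \<noteq> l" "E k l" using assms(3) by blast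
  have "(\<lambda>t. f (rot k l t x)) = (\<lambda>t. f x)" using rot_invariantD[OF assms(2) X(2,3) x] by auto
  with rotation_field_derivative[OF assms(1) X(2) x] show "X f x = 0"
    unfolding X(1) by (metis DERIV_unique DERIV_const)
qed

subsection \<open>The norms\<close>

lemma Lp_norm_ennreal: "0 < r \<Longrightarrow> Lp_norm M (ennreal r) f = (\<integral>x. \<bar>f x\<bar> powr r \<partial>M) powr (1 / r)"
  by (simp add: Lp_norm_def)

text \<open>Jensen's inequality for a probability measure, derived from Young's inequality with
  second factor 1 after division by the integral \<open>m\<close>. The exponents may be below
  1.\<close>

lemma powr_integral_mono:
  fixes f :: "real ^ 'n \<Rightarrow> real"
  assumes f: "continuous_on (sphere 0 1) f" and nn: "\<And>x. x \<in> sphere 0 1 \<Longrightarrow> 0 \<le> f x" and r: "0 < r" "r \<le> q"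
  shows "(\<integral>x. f x powr r \<partial>sphere_measure) powr (1 / r) \<le> (\<integral>x. f x powr q \<partial>sphere_measure) powr (1 / q)"
proof (cases "r = q \<or> (\<integral>x. f x powr r \<partial>sphere_measure) = 0")
  case True
  then show ?thesis by auto
next
  case False
  define m where "m = (\<integral>x. f x powr r \<partial>sphere_measure)"
  have m: "m > 0" using False integral_nonneg_AE[of "\<lambda>x. f x powr r" sphere_measure] by (simp add: m_def less_le)
  define s where "s = q / r"
  have s: "s > 1" using False r by (simp add: s_def)
  have cpow: "continuous_on (sphere 0 1) (\<lambda>x. f x powr e)" if "e > 0" for e
    by (rule continuous_on_powr'[OF f continuous_on_const]) (use that nn in auto)
  have cr: "continuous_on (sphere 0 1) (\<lambda>x. f x powr r)" and cq: "continuous_on (sphere 0 1) (\<lambda>x. f x powr q)"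
    using r by (auto intro: cpow)
  have "f x powr r / m \<le> (f x powr q / m powr s) / s + (1 - 1 / s)" if x: "x \<in> sphere 0 1" for x
  proof -
    have "(f x powr r / m) * 1 \<le> (f x powr r / m) powr s / s + 1 powr (s / (s - 1)) / (s / (s - 1))"
      using s m by (intro Youngs_inequality) (auto simp: field_simps)
    moreover have "(f x powr r / m) powr s = f x powr q / m powr s"
      using m r nn[OF x] by (simp add: powr_divide powr_powr s_def)
    moreover have "1 powr (s / (s - 1)) / (s / (s - 1)) = 1 - 1 / s" using s by (simp add: field_simps)
    ultimately show ?thesis by simp
  qed
  then have "(\<integral>x. f x powr r / m \<partial>sphere_measure) \<le> (\<integral>x. (f x powr q / m powr s) / s + (1 - 1 / s) \<partial>sphere_measure)"
    using m s by (intro sphere_integral_mono continuous_intros cr cq) auto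
  also have "\<dots> = ((\<integral>x. f x powr q \<partial>sphere_measure) / m powr s) / s + (1 - 1 / s)"
    using integrable_continuous_sphere[OF cq] by simp
  finally have "1 \<le> ((\<integral>x. f x powr q \<partial>sphere_measure) / m powr s) / s + (1 - 1 / s)"
    using m by (simp add: m_def[symmetric])
  then have "1 \<le> (\<integral>x. f x powr q \<partial>sphere_measure) / m powr s" using s by (simp add: field_simps)
  then have "m powr s \<le> (\<integral>x. f x powr q \<partial>sphere_measure)" using m by (simp add: pos_le_divide_eq)
  then have "(m powr s) powr (1 / q) \<le> (\<integral>x. f x powr q \<partial>sphere_measure) powr (1 / q)"
    using r by (intro powr_mono2) auto
  then show ?thesis using r by (simp add: powr_powr s_def m_def)
qed

lemma Lp_norm_infinity_ge:
  fixes f :: "real ^ 'n \<Rightarrow> real"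
  assumes f: "continuous_on (sphere 0 1) f" and nn: "\<And>x. x \<in> sphere 0 1 \<Longrightarrow> 0 \<le> f x" and r: "0 < r"
  shows "(\<integral>x. f x powr r \<partial>sphere_measure) powr (1 / r) \<le> Lp_norm sphere_measure \<infinity> f"
proof -
  let ?\<sigma> = "sphere_measure :: (real ^ 'n) measure"
  let ?g = "\<lambda>x. ereal \<bar>f x\<bar>"
  obtain B where B: "\<And>x. x \<in> sphere 0 1 \<Longrightarrow> \<bar>f x\<bar> \<le> B" using continuous_sphere_bounded[OF f] by metis
  have meas: "?g \<in> borel_measurable ?\<sigma>" using measurable_continuous_sphere[OF f] by simp
  have le: "esssup ?\<sigma> ?g \<le> ereal B" by (rule esssup_I[OF meas]) (auto intro!: AE_I2 B)
  have ge: "esssup ?\<sigma> ?g \<ge> 0"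
  proof -
    have "esssup ?\<sigma> (\<lambda>x. 0 :: ereal) \<le> esssup ?\<sigma> ?g" by (rule esssup_mono) auto
    moreover have "emeasure ?\<sigma> (space ?\<sigma>) = 1" by (rule sph.emeasure_space_1)
    then have "esssup ?\<sigma> (\<lambda>x. 0 :: ereal) = 0" by (intro esssup_const) simp
    ultimately show ?thesis by simp
  qed
  \<comment> \<open>Finiteness matters: \<open>real_of_ereal\<close> would send an infinite value to
    0.\<close>
  obtain M where M: "esssup ?\<sigma> ?g = ereal M" "M \<ge> 0" using le ge by (cases "esssup ?\<sigma> ?g") auto
  have norm: "Lp_norm ?\<sigma> \<infinity> f = M" by (simp add: Lp_norm_def M)
  have "AE x in ?\<sigma>. ereal \<bar>f x\<bar> \<le> ereal M" using esssup_AE[of ?g ?\<sigma>] by (simp add: M)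
  then have "AE x in ?\<sigma>. f x powr r \<le> M powr r"
    using AE_space by eventually_elim (use nn r in \<open>auto intro!: powr_mono2\<close>)
  moreover have "continuous_on (sphere 0 1) (\<lambda>x. f x powr r)"
    by (rule continuous_on_powr'[OF f continuous_on_const]) (use r nn in auto)
  ultimately have "(\<integral>x. f x powr r \<partial>?\<sigma>) \<le> (\<integral>x. M powr r \<partial>?\<sigma>)"
    by (intro integral_mono_AE integrable_continuous_sphere continuous_on_const) auto
  then have "(\<integral>x. f x powr r \<partial>?\<sigma>) \<le> M powr r" by simp
  then have "(\<integral>x. f x powr r \<partial>?\<sigma>) powr (1 / r) \<le> (M powr r) powr (1 / r)"
    using r by (intro powr_mono2) (auto intro: integral_nonneg_AE)
  then show ?thesis unfolding norm using r M(2) by (simp add: powr_powr)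
qed

lemma Lp_norm_ge:
  fixes f :: "real ^ 'n \<Rightarrow> real"
  assumes f: "continuous_on (sphere 0 1) f" and nn: "\<And>x. x \<in> sphere 0 1 \<Longrightarrow> 0 \<le> f x" and r: "0 < r" "ennreal r \<le> q"
  shows "(\<integral>x. f x powr r \<partial>sphere_measure) powr (1 / r) \<le> Lp_norm sphere_measure q f"
proof (cases q)
  case top
  then show ?thesis using Lp_norm_infinity_ge[OF f nn r(1)] by (simp add: infinity_ennreal_def)
next
  case (real t)
  then have t: "r \<le> t" using r by simp
  have "(\<integral>x. \<bar>f x\<bar> powr t \<partial>sphere_measure) = (\<integral>x. f x powr t \<partial>sphere_measure)"
    by (rule sphere_integral_cong) (use nn in auto)
  then show ?thesis using powr_integral_mono[OF f nn r(1) t] t r(1) real by (simp add: Lp_norm_ennreal)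
qed

subsection \<open>Admissibility\<close>

text \<open>Lets exponents strictly above the recurrence number descend to it. The shift is at most
  1, so M^(r + 1) with M \<ge> 1 dominates.\<close>

lemma powr_integral_tendsto:
  fixes f :: "real ^ 'n \<Rightarrow> real"
  assumes f: "continuous_on (sphere 0 1) f" and nn: "\<And>x. x \<in> sphere 0 1 \<Longrightarrow> 0 \<le> f x" and r: "0 < r"
  shows "(\<lambda>n. (\<integral>x. f x powr (r + 1 / real (Suc n)) \<partial>sphere_measure) powr (1 / (r + 1 / real (Suc n))))
     \<longlonglongrightarrow> (\<integral>x. f x powr r \<partial>sphere_measure) powr (1 / r)"
proof -
  obtain B where B: "B \<ge> 0" "\<And>x. x \<in> sphere 0 1 \<Longrightarrow> \<bar>f x\<bar> \<le> B" using continuous_sphere_bounded[OF f] by metis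
  define M where "M = max 1 B"
  have h: "(\<lambda>n. 1 / real (Suc n)) \<longlonglongrightarrow> 0"
    using LIMSEQ_inverse_real_of_nat by (simp add: inverse_eq_divide)
  have rh: "(\<lambda>n. r + 1 / real (Suc n)) \<longlonglongrightarrow> r + 0" by (intro tendsto_intros h)
  have pos: "r + 1 / real (Suc n) > 0" for n using r by (simp add: add_pos_pos)
  have meas: "(\<lambda>x. f x powr e) \<in> borel_measurable sphere_measure" if "e > 0" for e
    by (intro measurable_continuous_sphere continuous_on_powr'[OF f continuous_on_const]) (use that nn in auto)
  have "(\<lambda>n. \<integral>x. f x powr (r + 1 / real (Suc n)) \<partial>sphere_measure) \<longlonglongrightarrow> (\<integral>x. f x powr r \<partial>sphere_measure)"
  proof (rule integral_dominated_convergence[where w = "\<lambda>_. M powr (r + 1)"])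
    show "AE x in sphere_measure. (\<lambda>n. f x powr (r + 1 / real (Suc n))) \<longlonglongrightarrow> f x powr r"
      using tendsto_powr'[OF tendsto_const rh] nn r by (intro AE_I2) (auto intro!: always_eventually)
    show "AE x in sphere_measure. norm (f x powr (r + 1 / real (Suc n))) \<le> M powr (r + 1)" for n
    proof (rule AE_I2)
      fix x :: "real ^ 'n" assume "x \<in> space sphere_measure"
      then have x: "x \<in> sphere 0 1" by simp
      have "f x powr (r + 1 / real (Suc n)) \<le> M powr (r + 1 / real (Suc n))"
        using B(2)[OF x] nn[OF x] pos[of n] by (intro powr_mono2) (auto simp: M_def)
      also have "\<dots> \<le> M powr (r + 1)" by (intro powr_mono) (auto simp: M_def)
      finally show "norm (f x powr (r + 1 / real (Suc n))) \<le> M powr (r + 1)" by simp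
    qed
  qed (use r pos meas in auto)
  moreover have "(\<lambda>n. 1 / (r + 1 / real (Suc n))) \<longlonglongrightarrow> 1 / (r + 0)"
    using r by (intro tendsto_divide tendsto_const rh) simp
  ultimately show ?thesis
    using r by (intro tendsto_powr') (auto intro!: always_eventually integral_nonneg_AE)
qed

lemma product_inequality_holds:
  fixes A :: "nat \<Rightarrow> ('n::{finite,wellorder}) vfield set"
  assumes n2: "CARD('n) \<ge> 2"
    and E: "\<And>J. J \<in> {1..Jmax} \<Longrightarrow> equivp (E J)"
    and A: "\<And>J k l. J \<in> {1..Jmax} \<Longrightarrow> k < l \<Longrightarrow> E J k l \<Longrightarrow> rotation_field k l \<in> A J"
    and count: "\<And>k l. k \<noteq> l \<Longrightarrow> card {J\<in>{1..Jmax}. \<not> E J k l} \<le> c"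
  shows "admissible_exponent Jmax A (of_nat c)"
  unfolding admissible_exponent_def product_inequality_def
proof (intro allI impI)
  fix p :: "nat \<Rightarrow> ennreal" and f :: "nat \<Rightarrow> real ^ ('n::{finite,wellorder}) \<Rightarrow> real"
  assume p: "\<forall>J\<in>{1..Jmax}. 0 < p J \<and> of_nat c \<le> p J"
    and f: "\<forall>J\<in>{1..Jmax}. symmetric_wrt (A J) (f J) \<and> (\<forall>x\<in>sphere 0 1. 0 \<le> f J x)"
  let ?Js = "{1..Jmax}"
  have cont: "continuous_on (sphere 0 1) (f J)" if "J \<in> ?Js" for J
    using f that smooth_on_sphere_continuous unfolding symmetric_wrt_def by blast
  have inv: "rot_invariant (E J) (f J)" if "J \<in> ?Js" for J
    using f that by (intro symmetric_rot_invariant[of "A J"] E A) auto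
  have nn: "0 \<le> f J x" if "J \<in> ?Js" "x \<in> sphere 0 1" for J x using f that by blast
  \<comment> \<open>An infinite exponent is replaced by a finite one that is still at least
    \<open>c\<close>.\<close>
  define q where "q J = (if p J = top then real c + 1 else enn2real (p J))" for J
  have q: "q J > 0 \<and> real c \<le> q J \<and> ennreal (q J) \<le> p J" if "J \<in> ?Js" for J
  proof (cases "p J")
    case (real t)
    moreover have "0 < p J \<and> of_nat c \<le> p J" using p that by blast
    ultimately have "0 < t" "real c \<le> t" by (simp_all add: ennreal_of_nat_eq_real_of_nat)
    then show ?thesis using real by (simp add: q_def)
  qed (simp add: q_def)
  \<comment> \<open>A common finite exponent, at most every \<open>p J\<close> and at least
    \<open>c\<close>. The entry \<open>c + 1\<close> makes the minimum well defined even when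
    \<open>Jmax = 0\<close>.\<close>
  define r where "r = Min (insert (real c + 1) (q ` ?Js))"
  have r: "r > 0" "real c \<le> r" using q by (auto simp: r_def)
  have rp: "ennreal r \<le> p J" if "J \<in> ?Js" for J
  proof -
    have "r \<le> q J" unfolding r_def using that by (intro Min_le) auto
    then show ?thesis using q[OF that] by (meson ennreal_leI order_trans)
  qed
  have "(\<integral>x. (\<Prod>J\<in>?Js. f J x) \<partial>sphere_measure)
     \<le> (\<Prod>J\<in>?Js. (\<integral>x. f J x powr (r + 1 / real (Suc n)) \<partial>sphere_measure) powr (1 / (r + 1 / real (Suc n))))" for n
  proof -
    have "0 < 1 / real (Suc n)" by simp
    then have "0 < r + 1 / real (Suc n)" "real c < r + 1 / real (Suc n)" using r by linarith+
    then show ?thesis by (intro block_inequality[OF _ _ n2 E count _ cont inv nn]) auto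
  qed
  moreover have "(\<lambda>n. \<Prod>J\<in>?Js. (\<integral>x. f J x powr (r + 1 / real (Suc n)) \<partial>sphere_measure) powr (1 / (r + 1 / real (Suc n))))
      \<longlonglongrightarrow> (\<Prod>J\<in>?Js. (\<integral>x. f J x powr r \<partial>sphere_measure) powr (1 / r))"
    by (intro tendsto_prod powr_integral_tendsto cont nn r)
  ultimately have "(\<integral>x. (\<Prod>J\<in>?Js. f J x) \<partial>sphere_measure) \<le> (\<Prod>J\<in>?Js. (\<integral>x. f J x powr r \<partial>sphere_measure) powr (1 / r))"
    by (intro LIMSEQ_le_const) auto
  also have "\<dots> \<le> (\<Prod>J\<in>?Js. Lp_norm sphere_measure (p J) (f J))"
    by (intro prod_mono conjI Lp_norm_ge cont nn r rp) auto
  finally show "(\<integral>x. (\<Prod>J=1..Jmax. f J x) \<partial>sphere_measure) \<le> (\<Prod>J=1..Jmax. Lp_norm sphere_measure (p J) (f J))" .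
qed

subsection \<open>Counting orthogonal tuples\<close>

text \<open>Models the supports of orthogonal tuples. The carrier \<open>U\<close> varies so that
  inductions can remove the first block; \<open>sorted_wrt\<close> of a symmetric relation is
  pairwise disjointness by position.\<close>

definition disjoint_lists :: "'a set \<Rightarrow> nat list \<Rightarrow> 'a set list set" where
  "disjoint_lists U a = {Ss. list_all2 (\<lambda>S x. S \<subseteq> U \<and> card S = x) Ss a \<and> sorted_wrt (\<lambda>S T. S \<inter> T = {}) Ss}"

lemma disjoint_lists_Nil [simp]: "disjoint_lists U [] = {[]}"
  by (auto simp: disjoint_lists_def)

lemma disjoint_lists_Cons:
  "disjoint_lists U (x # a) = (\<Union>S\<in>{S. S \<subseteq> U \<and> card S = x}. (#) S ` disjoint_lists (U - S) a)"
proof -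
  have *: "list_all2 (\<lambda>T x. T \<subseteq> U - S \<and> card T = x) Ts a
      \<longleftrightarrow> list_all2 (\<lambda>T x. T \<subseteq> U \<and> card T = x) Ts a \<and> (\<forall>T\<in>set Ts. S \<inter> T = {})" for S Ts
    by (induction Ts a rule: list_induct2') auto
  have "Ss \<in> disjoint_lists U (x # a)
      \<longleftrightarrow> (\<exists>S Ts. Ss = S # Ts \<and> S \<subseteq> U \<and> card S = x \<and> Ts \<in> disjoint_lists (U - S) a)" for Ss
    by (cases Ss) (auto simp: disjoint_lists_def *)
  then show ?thesis by blast
qed

lemma disjoint_lists_subset: "Ss \<in> disjoint_lists U a \<Longrightarrow> S \<in> set Ss \<Longrightarrow> S \<subseteq> U"
  by (fastforce simp: disjoint_lists_def list_all2_conv_all_nth in_set_conv_nth)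

lemma finite_disjoint_lists: "finite U \<Longrightarrow> finite (disjoint_lists U a)"
  by (induction a arbitrary: U) (auto simp: disjoint_lists_Cons)

text \<open>The first block can be chosen in \<open>card U choose x\<close> ways, after which
  induction applies to its complement. The product form avoids division of natural numbers.\<close>

lemma card_disjoint_lists:
  assumes "finite U" "sum_list a \<le> card U"
  shows "card (disjoint_lists U a) * ((\<Prod>x\<leftarrow>a. fact x) * fact (card U - sum_list a)) = fact (card U)"
  using assms
proof (induction a arbitrary: U)
  case (Cons x a)
  let ?X = "{S. S \<subseteq> U \<and> card S = x}"
  let ?Q = "(\<Prod>x\<leftarrow>a. fact x) * fact (card U - x - sum_list a) :: nat"
  have "card (disjoint_lists U (x # a)) = (\<Sum>S\<in>?X. card ((#) S ` disjoint_lists (U - S) a))"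
    unfolding disjoint_lists_Cons
    using Cons.prems by (intro card_UN_disjoint) (auto intro: finite_disjoint_lists)
  also have "\<dots> = (\<Sum>S\<in>?X. card (disjoint_lists (U - S) a))"
    by (intro sum.cong refl card_image) auto
  finally have "card (disjoint_lists U (x # a)) * ?Q = (\<Sum>S\<in>?X. card (disjoint_lists (U - S) a) * ?Q)"
    by (simp add: sum_distrib_right)
  also have "\<dots> = (\<Sum>S\<in>?X. fact (card U - x))"
  proof (rule sum.cong[OF refl])
    fix S assume S: "S \<in> ?X"
    then have "finite S" using Cons.prems finite_subset by auto
    then have "card (U - S) = card U - x" using S by (simp add: card_Diff_subset)
    then show "card (disjoint_lists (U - S) a) * ?Q = fact (card U - x)"
      using Cons.IH[of "U - S"] Cons.prems by simp
  qed
  also have "\<dots> = (card U choose x) * fact (card U - x)"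
    using n_subsets[OF Cons.prems(1)] by simp
  finally have "card (disjoint_lists U (x # a)) * ?Q * fact x = (card U choose x) * fact (card U - x) * fact x"
    by simp
  also have "\<dots> = fact (card U)"
    using binomial_fact_lemma[of x "card U"] Cons.prems by (simp add: mult_ac)
  finally show ?case by (simp add: mult_ac)
qed simp

definition same_block :: "'a set list \<Rightarrow> 'a \<Rightarrow> 'a \<Rightarrow> bool" where
  "same_block Ss k l \<longleftrightarrow> (\<exists>S\<in>set Ss. k \<in> S \<and> l \<in> S)"

text \<open>A block of size \<open>x\<close> has x (x - 1) ordered pairs of distinct elements, and
  disjoint blocks share no pair.\<close>

lemma card_same_block:
  assumes "finite U" "Ss \<in> disjoint_lists U a"
  shows "card {(k, l). k \<noteq> l \<and> same_block Ss k l} = (\<Sum>x\<leftarrow>a. x * (x - 1))"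
  using assms
proof (induction a arbitrary: U Ss)
  case Nil
  then show ?case by (simp add: same_block_def)
next
  case (Cons x a)
  then obtain S Ts where S: "S \<subseteq> U" "card S = x" and Ts: "Ts \<in> disjoint_lists (U - S) a" and Ss: "Ss = S # Ts"
    by (auto simp: disjoint_lists_Cons)
  have fin: "finite S" using S(1) Cons.prems(1) finite_subset by blast
  let ?A = "S \<times> S - (\<lambda>k. (k, k)) ` S" and ?B = "{(k, l). k \<noteq> l \<and> same_block Ts k l}"
  have sub: "?B \<subseteq> (U - S) \<times> (U - S)"
    using disjoint_lists_subset[OF Ts] by (auto simp: same_block_def)
  have "{(k, l). k \<noteq> l \<and> same_block Ss k l} = ?A \<union> ?B"
    by (auto simp: same_block_def Ss)
  also have "card (?A \<union> ?B) = card ?A + card ?B"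
    using sub fin Cons.prems(1) by (intro card_Un_disjoint) (auto intro: finite_subset)
  also have "card ?A = x * (x - 1)"
  proof -
    have "card ?A = card (S \<times> S) - card ((\<lambda>k. (k, k)) ` S)"
      using fin by (intro card_Diff_subset) auto
    also have "card ((\<lambda>k. (k, k)) ` S) = card S" by (intro card_image inj_onI) simp
    finally show ?thesis by (simp add: S(2) card_cartesian_product diff_mult_distrib2)
  qed
  also have "card ?B = (\<Sum>x\<leftarrow>a. x * (x - 1))"
    using Cons.IH[OF _ Ts] Cons.prems(1) by simp
  finally show ?case by simp
qed

lemma disjoint_lists_map_image:
  assumes "bij f" "Ss \<in> disjoint_lists UNIV a"
  shows "map ((`) f) Ss \<in> disjoint_lists UNIV a"
proof -
  have inj: "inj f" by (rule bij_is_inj[OF assms(1)])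
  have "card (f ` S) = card S" for S by (intro card_image inj_on_subset[OF inj]) simp
  moreover have "f ` S \<inter> f ` T = {} \<longleftrightarrow> S \<inter> T = {}" for S T
    using inj by (auto simp: inj_def)
  ultimately show ?thesis
    using assms(2) by (simp add: disjoint_lists_def list_all2_map1 sorted_wrt_map)
qed

lemma same_block_map_image: "inj f \<Longrightarrow> same_block (map ((`) f) Ss) (f k) (f l) \<longleftrightarrow> same_block Ss k l"
  by (auto simp: same_block_def inj_image_mem_iff)

text \<open>The symmetric group is doubly transitive: some permutation maps (k, l) to (k', l'), and
  it acts injectively on the lists. Exchanging the two pairs later gives equality.\<close>

lemma card_same_block_lists_le:
  fixes k l k' l' :: "'a::finite"
  assumes "k \<noteq> l" "k' \<noteq> l'"
  shows "card {Ss \<in> disjoint_lists UNIV a. same_block Ss k l} \<le> card {Ss \<in> disjoint_lists UNIV a. same_block Ss k' l'}"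
proof -
  obtain f :: "'a \<Rightarrow> 'a" where f: "bij f" "f k = k'" "f l = l'"
  proof -
    \<comment> \<open>First \<open>k\<close> is moved to \<open>k'\<close>; the second transposition
      then moves the image of \<open>l\<close> to \<open>l'\<close> and fixes
      \<open>k'\<close>.\<close>
    define g where "g = Transposition.transpose k k'"
    define h where "h = Transposition.transpose (g l) l'"
    have "g k = k'" by (simp add: g_def)
    moreover have "g l \<noteq> k'" using assms(1) by (auto simp: g_def Transposition.transpose_def)
    ultimately have "(h \<circ> g) k = k'" "(h \<circ> g) l = l'"
      using assms(2) by (auto simp: h_def Transposition.transpose_def)
    moreover have "bij (h \<circ> g)" unfolding h_def g_def by (intro bij_comp bij_transpose)
    ultimately show thesis using that by blast
  qed
  have inj: "inj f" by (rule bij_is_inj[OF f(1)])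
  show ?thesis
  proof (rule card_inj_on_le)
    show "inj_on (map ((`) f)) {Ss \<in> disjoint_lists UNIV a. same_block Ss k l}"
      by (rule inj_on_subset[OF inj_mapI[OF injI]]) (simp_all add: inj_image_eq_iff[OF inj])
    show "map ((`) f) ` {Ss \<in> disjoint_lists UNIV a. same_block Ss k l} \<subseteq> {Ss \<in> disjoint_lists UNIV a. same_block Ss k' l'}"
      using disjoint_lists_map_image[OF f(1)] same_block_map_image[OF inj, of _ k l] f by auto
    show "finite {Ss \<in> disjoint_lists UNIV a. same_block Ss k' l'}" by (simp add: finite_disjoint_lists)
  qed
qed

text \<open>Double counting of incidences between lists and ordered pairs of distinct indices: every
  pair is joined by equally many lists, and every list joins the number of pairs given by
  \<open>card_same_block\<close>.\<close>

lemma card_same_block_lists: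
  fixes k l :: "'a::finite"
  assumes "k \<noteq> l"
  shows "card {Ss \<in> disjoint_lists UNIV a. same_block Ss k l} * (CARD('a) * (CARD('a) - 1))
       = card (disjoint_lists (UNIV :: 'a set) a) * (\<Sum>x\<leftarrow>a. x * (x - 1))"
proof -
  let ?D = "disjoint_lists (UNIV :: 'a set) a"
  let ?P = "{(k :: 'a, l). k \<noteq> l}"
  have "?P = UNIV \<times> UNIV - (\<lambda>k. (k, k)) ` UNIV" by auto
  then have "card ?P = card (UNIV \<times> UNIV :: ('a \<times> 'a) set) - card ((\<lambda>k :: 'a. (k, k)) ` UNIV)"
    by (simp only:) (intro card_Diff_subset; simp)
  also have "card ((\<lambda>k :: 'a. (k, k)) ` UNIV) = CARD('a)" by (intro card_image inj_onI) simp
  finally have P: "card ?P = CARD('a) * (CARD('a) - 1)"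
    by (simp only: card_cartesian_product diff_mult_distrib2)
  have eq: "card {Ss \<in> ?D. same_block Ss k' l'} = card {Ss \<in> ?D. same_block Ss k l}" if "k' \<noteq> l'" for k' l'
    using card_same_block_lists_le[OF that assms] card_same_block_lists_le[OF assms that] by (rule antisym)
  have "(\<Sum>Ss\<in>?D. card {(k, l). k \<noteq> l \<and> same_block Ss k l}) = (\<Sum>Ss\<in>?D. \<Sum>kl\<in>?P. if same_block Ss (fst kl) (snd kl) then 1 else 0)"
  proof (rule sum.cong[OF refl])
    fix Ss
    have "{(k, l). k \<noteq> l \<and> same_block Ss k l} = {kl \<in> ?P. same_block Ss (fst kl) (snd kl)}" by auto
    then show "card {(k, l). k \<noteq> l \<and> same_block Ss k l} = (\<Sum>kl\<in>?P. if same_block Ss (fst kl) (snd kl) then 1 else 0)"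
      by (simp add: sum.If_cases Int_def)
  qed
  also have "\<dots> = (\<Sum>kl\<in>?P. \<Sum>Ss\<in>?D. if same_block Ss (fst kl) (snd kl) then 1 else 0)"
    by (rule sum.swap)
  also have "\<dots> = (\<Sum>kl\<in>?P. card {Ss \<in> ?D. same_block Ss k l})"
  proof (rule sum.cong[OF refl])
    fix kl assume "kl \<in> ?P"
    then have "card {Ss \<in> ?D. same_block Ss (fst kl) (snd kl)} = card {Ss \<in> ?D. same_block Ss k l}"
      by (intro eq) auto
    then show "(\<Sum>Ss\<in>?D. if same_block Ss (fst kl) (snd kl) then 1 else 0) = card {Ss \<in> ?D. same_block Ss k l}"
      by (simp add: sum.If_cases finite_disjoint_lists Int_def)
  qed
  finally have "(\<Sum>Ss\<in>?D. card {(k, l). k \<noteq> l \<and> same_block Ss k l}) = card ?P * card {Ss \<in> ?D. same_block Ss k l}"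
    by simp
  moreover have "(\<Sum>Ss\<in>?D. card {(k, l). k \<noteq> l \<and> same_block Ss k l}) = card ?D * (\<Sum>x\<leftarrow>a. x * (x - 1))"
    by (simp add: card_same_block[OF finite])
  ultimately show ?thesis by (simp only: P mult.commute)
qed

section \<open>Passage from multi-indices to their supports\<close>

definition mi_support :: "nat ^ 'n \<Rightarrow> 'n set" where
  "mi_support \<alpha> = {i. \<alpha> $ i = 1}"

lemma mi_length_support: "multi_index \<alpha> \<Longrightarrow> mi_length \<alpha> = card (mi_support \<alpha>)"
proof -
  assume "multi_index \<alpha>"
  then have "\<alpha> $ i = (if i \<in> mi_support \<alpha> then 1 else 0)" for i
    by (auto simp: multi_index_def mi_support_def)
  then have "mi_length \<alpha> = (\<Sum>i\<in>UNIV. if i \<in> mi_support \<alpha> then 1 else 0)"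
    unfolding mi_length_def by (rule sum.cong[OF refl])
  then show ?thesis by (simp add: sum.If_cases)
qed

lemma mi_orthogonal_support:
  assumes "multi_index \<alpha>" "multi_index \<beta>"
  shows "mi_orthogonal \<alpha> \<beta> \<longleftrightarrow> mi_support \<alpha> \<inter> mi_support \<beta> = {}"
proof -
  have "\<alpha> $ i * \<beta> $ i = 0 \<longleftrightarrow> i \<notin> mi_support \<alpha> \<inter> mi_support \<beta>" for i
    using assms unfolding multi_index_def mi_support_def by (cases "\<alpha> $ i = 0"; cases "\<beta> $ i = 0"; force)
  then show ?thesis by (auto simp: mi_orthogonal_def)
qed

lemma inj_on_mi_support: "inj_on mi_support (Collect multi_index)"
proof (rule inj_onI)
  fix \<alpha> \<beta> :: "nat ^ 'n" assume ab: "\<alpha> \<in> Collect multi_index" "\<beta> \<in> Collect multi_index" "mi_support \<alpha> = mi_support \<beta>"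
  have "\<alpha> $ i = \<beta> $ i" for i
  proof -
    have "\<alpha> $ i = 0 \<or> \<alpha> $ i = 1" "\<beta> $ i = 0 \<or> \<beta> $ i = 1" using ab(1,2) by (auto simp: multi_index_def)
    moreover have "\<alpha> $ i = 1 \<longleftrightarrow> \<beta> $ i = 1" using ab(3) by (auto simp: mi_support_def)
    ultimately show ?thesis by auto
  qed
  then show "\<alpha> = \<beta>" by (simp add: vec_eq_iff)
qed

lemma bij_betw_orthogonal_tuples:
  "bij_betw (map mi_support) (orthogonal_tuples a :: (nat ^ 'n) list set) (disjoint_lists UNIV a)"
proof -
  have mi: "\<alpha>s \<in> lists (Collect multi_index)" if "\<alpha>s \<in> orthogonal_tuples a" for \<alpha>s :: "(nat ^ 'n) list"
    using that by (auto simp: orthogonal_tuples_def in_set_conv_nth)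
  have "inj_on (map mi_support) (orthogonal_tuples a :: (nat ^ 'n) list set)"
  proof (rule inj_onI)
    fix \<alpha>s \<beta>s :: "(nat ^ 'n) list" assume "\<alpha>s \<in> orthogonal_tuples a" "\<beta>s \<in> orthogonal_tuples a"
      and eq: "map mi_support \<alpha>s = map mi_support \<beta>s"
    then have "set \<alpha>s \<union> set \<beta>s \<subseteq> Collect multi_index" using mi by auto
    then show "\<alpha>s = \<beta>s" by (rule map_inj_on[OF eq inj_on_subset[OF inj_on_mi_support]])
  qed
  moreover have "map mi_support ` (orthogonal_tuples a :: (nat ^ 'n) list set) = disjoint_lists UNIV a"
  proof (intro equalityI subsetI)
    fix Ss assume "Ss \<in> map mi_support ` (orthogonal_tuples a :: (nat ^ 'n) list set)"
    then obtain \<alpha>s :: "(nat ^ 'n) list" where \<alpha>s: "\<alpha>s \<in> orthogonal_tuples a" "Ss = map mi_support \<alpha>s" by blast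
    then have len: "length \<alpha>s = length a"
      and mi_nth: "\<And>i. i < length a \<Longrightarrow> multi_index (\<alpha>s ! i) \<and> mi_length (\<alpha>s ! i) = a ! i"
      and orth: "\<And>i j. i < length a \<Longrightarrow> j < length a \<Longrightarrow> i \<noteq> j \<Longrightarrow> mi_orthogonal (\<alpha>s ! i) (\<alpha>s ! j)"
      by (simp_all add: orthogonal_tuples_def)
    have "card (mi_support (\<alpha>s ! i)) = a ! i" if "i < length a" for i
      using mi_nth[OF that] mi_length_support by metis
    moreover have "mi_support (\<alpha>s ! i) \<inter> mi_support (\<alpha>s ! j) = {}" if "i < j" "j < length a" for i j
      using orth[of i j] mi_nth[of i] mi_nth[of j] that mi_orthogonal_support by auto
    ultimately show "Ss \<in> disjoint_lists UNIV a"
      unfolding \<alpha>s(2) by (simp add: disjoint_lists_def list_all2_conv_all_nth sorted_wrt_iff_nth_less len)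
  next
    fix Ss assume Ss: "Ss \<in> disjoint_lists (UNIV :: 'n set) a"
    define ind :: "'n set \<Rightarrow> nat ^ 'n" where "ind S = (\<chi> i. if i \<in> S then 1 else 0)" for S
    have supp: "mi_support (ind S) = S" for S by (simp add: mi_support_def ind_def)
    have ind: "multi_index (ind S)" for S by (simp add: multi_index_def ind_def)
    have disj: "Ss ! i \<inter> Ss ! j = {}" if "i < length Ss" "j < length Ss" "i \<noteq> j" for i j
    proof -
      have s: "sorted_wrt (\<lambda>S T. S \<inter> T = {}) Ss" using Ss by (simp add: disjoint_lists_def)
      show ?thesis
        using sorted_wrt_nth_less[OF s, of i j] sorted_wrt_nth_less[OF s, of j i] that
        by (cases i j rule: linorder_cases) (simp_all add: Int_commute)
    qed
    have "length Ss = length a" and cards: "\<And>i. i < length a \<Longrightarrow> card (Ss ! i) = a ! i"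
      using Ss by (simp_all add: disjoint_lists_def list_all2_conv_all_nth)
    then have "map ind Ss \<in> orthogonal_tuples a"
      using disj by (simp add: orthogonal_tuples_def mi_length_support[OF ind] supp mi_orthogonal_support[OF ind ind] ind)
    moreover have "Ss = map mi_support (map ind Ss)" by (simp add: supp o_def)
    ultimately show "Ss \<in> map mi_support ` (orthogonal_tuples a :: (nat ^ 'n) list set)" by blast
  qed
  ultimately show ?thesis by (simp add: bij_betw_def)
qed

definition in_block :: "(nat ^ 'n) list \<Rightarrow> 'n \<Rightarrow> 'n \<Rightarrow> bool" where
  "in_block \<alpha>s k l \<longleftrightarrow> (\<exists>i<length \<alpha>s. (\<alpha>s ! i) $ k = 1 \<and> (\<alpha>s ! i) $ l = 1)"

lemma in_block_same_block: "in_block \<alpha>s k l \<longleftrightarrow> same_block (map mi_support \<alpha>s) k l"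
  by (auto simp: in_block_def same_block_def mi_support_def set_conv_nth)

lemma in_block_sym: "in_block \<alpha>s k l \<Longrightarrow> in_block \<alpha>s l k"
  by (auto simp: in_block_def)

text \<open>The disjunct \<open>k = l\<close> provides reflexivity at indices lying in no block.
  Transitivity holds since orthogonality forbids two different blocks to share the middle
  index.\<close>

lemma equivp_in_block:
  assumes "\<alpha>s \<in> orthogonal_tuples a"
  shows "equivp (\<lambda>k l. k = l \<or> in_block \<alpha>s k l)"
proof (rule equivpI)
  have "in_block \<alpha>s k m" if "in_block \<alpha>s k l" "in_block \<alpha>s l m" for k l m
  proof -
    from that obtain i j where ij: "i < length \<alpha>s" "(\<alpha>s ! i) $ k = 1" "(\<alpha>s ! i) $ l = 1"
      "j < length \<alpha>s" "(\<alpha>s ! j) $ l = 1" "(\<alpha>s ! j) $ m = 1" by (auto simp: in_block_def)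
    have "i = j"
    proof (rule ccontr)
      assume "i \<noteq> j"
      then have "mi_orthogonal (\<alpha>s ! i) (\<alpha>s ! j)" using assms ij by (auto simp: orthogonal_tuples_def)
      then have "(\<alpha>s ! i) $ l * (\<alpha>s ! j) $ l = 0" by (simp add: mi_orthogonal_def)
      with ij show False by simp
    qed
    with ij show ?thesis by (auto simp: in_block_def)
  qed
  then show "transp (\<lambda>k l. k = l \<or> in_block \<alpha>s k l)" by (auto intro!: transpI)
  show "symp (\<lambda>k l. k = l \<or> in_block \<alpha>s k l)" using in_block_sym[of \<alpha>s] by (blast intro: sympI)
qed (simp add: reflp_def)

lemma finite_orthogonal_tuples: "finite (orthogonal_tuples a :: (nat ^ 'n) list set)"
  using bij_betw_finite[OF bij_betw_orthogonal_tuples[of a]] finite_disjoint_lists[OF finite] by blast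

lemma card_orthogonal_tuples:
  assumes "sum_list a \<le> CARD('n)"
  shows "card (orthogonal_tuples a :: (nat ^ 'n) list set) * ((\<Prod>x\<leftarrow>a. fact x) * fact (CARD('n) - sum_list a)) = fact CARD('n)"
  using card_disjoint_lists[of "UNIV :: 'n set" a] assms bij_betw_same_card[OF bij_betw_orthogonal_tuples[of a, where 'n = 'n]] by simp

lemma card_in_block:
  fixes k l :: "'n::finite"
  assumes "k \<noteq> l"
  shows "card {\<alpha>s \<in> orthogonal_tuples a. in_block \<alpha>s k l} * (CARD('n) * (CARD('n) - 1))
       = card (orthogonal_tuples a :: (nat ^ 'n) list set) * (\<Sum>x\<leftarrow>a. x * (x - 1))"
proof -
  let ?O = "orthogonal_tuples a :: (nat ^ 'n) list set"
  have "bij_betw (map mi_support) {\<alpha>s \<in> ?O. in_block \<alpha>s k l} (map mi_support ` {\<alpha>s \<in> ?O. in_block \<alpha>s k l})"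
    by (rule bij_betw_subset[OF bij_betw_orthogonal_tuples]) auto
  moreover have "map mi_support ` {\<alpha>s \<in> ?O. in_block \<alpha>s k l} = {Ss \<in> disjoint_lists UNIV a. same_block Ss k l}"
    using bij_betw_imp_surj_on[OF bij_betw_orthogonal_tuples[of a, where 'n = 'n]] by (auto simp: in_block_same_block)
  ultimately have "card {\<alpha>s \<in> ?O. in_block \<alpha>s k l} = card {Ss \<in> disjoint_lists UNIV a. same_block Ss k l}"
    by (simp add: bij_betw_same_card)
  then show ?thesis
    using card_same_block_lists[OF assms, of a] bij_betw_same_card[OF bij_betw_orthogonal_tuples[of a, where 'n = 'n]] by simp
qed

subsection \<open>Gaussian concentration on the sphere\<close>

lemma prod_Basis_cart: "(\<Prod>b\<in>(Basis :: (real ^ 'n) set). F b) = (\<Prod>i\<in>UNIV. F (axis i 1))"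
proof -
  have "(Basis :: (real ^ 'n) set) = range (\<lambda>i. axis i 1)" by (auto simp: Basis_vec_def)
  moreover have "inj (\<lambda>i :: 'n. axis i (1 :: real))" by (auto simp: inj_def axis_eq_axis)
  ultimately show ?thesis by (metis (no_types, lifting) comp_apply prod.cong prod.reindex)
qed

lemma nn_integral_lborel_cart:
  fixes h :: "'n::finite \<Rightarrow> real \<Rightarrow> ennreal"
  assumes "\<And>i. h i \<in> borel_measurable borel"
  shows "(\<integral>\<^sup>+ y. (\<Prod>i\<in>UNIV. h i (y $ i)) \<partial>lborel) = (\<Prod>i\<in>UNIV. \<integral>\<^sup>+ t. h i t \<partial>lborel)"
proof -
  define idx where "idx = inv (\<lambda>i :: 'n. axis i (1 :: real))"
  have idx: "idx (axis i 1) = i" for i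
    unfolding idx_def by (rule inv_f_f) (auto simp: inj_def axis_eq_axis)
  have "(\<integral>\<^sup>+ y. (\<Prod>b\<in>Basis. h (idx b) (y \<bullet> b)) \<partial>lborel) = (\<Prod>b\<in>(Basis :: (real ^ 'n) set). \<integral>\<^sup>+ t. h (idx b) t \<partial>lborel)"
    by (rule nn_integral_lborel_prod) (auto intro: assms)
  then show ?thesis by (simp add: prod_Basis_cart idx inner_axis)
qed

lemma powr_minus_half_sq:
  fixes x :: real
  assumes "x > 0"
  shows "x * (x powr (- 1 / 2))\<^sup>2 = 1"
proof -
  have "(x powr (- 1 / 2))\<^sup>2 = x powr (- 1 / 2 + - 1 / 2)" unfolding power2_eq_square by (rule powr_add[symmetric])
  also have "\<dots> = 1 / x" using assms by (simp add: powr_neg_one)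
  finally show ?thesis using assms by simp
qed

lemma nn_integral_gauss_scaled:
  assumes "\<mu> > 0"
  shows "(\<integral>\<^sup>+ t. ennreal (exp (- \<mu> * t\<^sup>2)) \<partial>lborel) = ennreal (\<mu> powr (- 1 / 2) * sqrt pi)"
proof -
  have "has_bochner_integral lborel (\<lambda>x::real. exp (- x\<^sup>2)) (sqrt pi)"
    using has_bochner_integral_even_function[OF gaussian_moment_0] by simp
  then have K: "(\<integral>\<^sup>+ t. ennreal (exp (- t\<^sup>2)) \<partial>lborel) = ennreal (sqrt pi)"
    by (simp add: has_bochner_integral_iff nn_integral_eq_integral)
  define c where "c = \<mu> powr (- 1 / 2)"
  have c: "c > 0" using assms by (simp add: c_def)
  have "\<mu> * c\<^sup>2 = 1"
    unfolding c_def by (rule powr_minus_half_sq[OF assms])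
  then have sq: "\<mu> * (c * t)\<^sup>2 = t\<^sup>2" for t by (simp add: power_mult_distrib mult.assoc[symmetric])
  have "(\<integral>\<^sup>+ t. ennreal (exp (- \<mu> * t\<^sup>2)) \<partial>lborel) = ennreal c * (\<integral>\<^sup>+ t. ennreal (exp (- \<mu> * (0 + c * t)\<^sup>2)) \<partial>lborel)"
    using c by (subst nn_integral_real_affine[where t = 0 and c = c]) auto
  also have "\<dots> = ennreal c * ennreal (sqrt pi)" by (simp add: sq K)
  also have "\<dots> = ennreal (c * sqrt pi)" using c by (simp add: ennreal_mult')
  finally show ?thesis by (simp add: c_def)
qed

text \<open>Dropping the restriction to the sphere adds at most the contribution of the origin, the
  only other value of \<open>sgn\<close>; an inequality suffices for the upper bound.\<close>

lemma nn_integral_sphere_le: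
  fixes g :: "real ^ 'n \<Rightarrow> ennreal"
  assumes [measurable]: "g \<in> borel_measurable borel"
  shows "(\<integral>\<^sup>+ x. g x \<partial>sphere_measure) \<le> (\<integral>\<^sup>+ y. g (sgn y) * indicator (ball 0 1) y \<partial>lborel) / emeasure lborel (ball (0 :: real ^ 'n) 1)"
proof -
  let ?u = "uniform_measure lborel (ball (0 :: real ^ 'n) 1)"
  have sgn: "sgn \<in> measurable ?u borel" by (simp cong: measurable_cong_sets)
  have "(\<integral>\<^sup>+ x. g x \<partial>sphere_measure) = (\<integral>\<^sup>+ x. g x * indicator (sphere 0 1) x \<partial>distr ?u borel sgn)"
    unfolding sphere_measure_def by (rule nn_integral_restrict_space) (simp add: borel_closed)
  also have "\<dots> \<le> (\<integral>\<^sup>+ x. g x \<partial>distr ?u borel sgn)"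
    by (intro nn_integral_mono) (auto simp: indicator_def)
  also have "\<dots> = (\<integral>\<^sup>+ y. g (sgn y) \<partial>?u)"
    by (rule nn_integral_distr[OF sgn]) simp
  also have "\<dots> = (\<integral>\<^sup>+ y. g (sgn y) * indicator (ball 0 1) y \<partial>lborel) / emeasure lborel (ball (0 :: real ^ 'n) 1)"
    by (rule nn_integral_uniform_measure) (auto intro: measurable_compose[OF borel_measurable_sgn])
  finally show ?thesis .
qed

lemma content_ball_cart_pos:
  "measure lborel (ball (0 :: real ^ 'n) 1) > 0"
  "emeasure lborel (ball (0 :: real ^ 'n) 1) = ennreal (measure lborel (ball (0 :: real ^ 'n) 1))"
  using emeasure_eq_ennreal_measure[of lborel "ball (0 :: real ^ 'n) 1"] emeasure_bounded_finite[of "ball (0 :: real ^ 'n) 1"]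
  by (auto simp: content_ball_pos)

text \<open>On the ball |y_l| \<le> |(sgn y)_l|, so the integrand is dominated by a product of
  one-dimensional functions: Gaussians for the coordinates in \<open>T\<close>, each contributing
  \<Lambda>^(-1/2), and indicators of [-1, 1] otherwise.\<close>

lemma gauss_sphere_upper:
  fixes T :: "'n::finite set"
  assumes c: "c > 0"
  shows "\<exists>C>0. \<forall>\<Lambda>\<ge>1. (\<integral>x. exp (- c * \<Lambda> * (\<Sum>l\<in>T. (x $ l)\<^sup>2)) \<partial>(sphere_measure :: (real ^ 'n) measure))
            \<le> C * \<Lambda> powr (- real (card T) / 2)"
proof -
  let ?V = "measure lborel (ball (0 :: real ^ 'n) 1)"
  \<comment> \<open>The one-dimensional integrals at \<Lambda> = 1: a Gaussian integral on
    \<open>T\<close>, the length of [-1, 1] elsewhere.\<close>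
  define u where "u i = (if i \<in> T then c powr (- 1 / 2) * sqrt pi else 2)" for i
  have u: "u i > 0" for i using c by (simp add: u_def)
  define C where "C = (\<Prod>i\<in>UNIV. u i) / ?V"
  have "C > 0" unfolding C_def using u content_ball_cart_pos(1) by (intro divide_pos_pos prod_pos) auto
  moreover have "(\<integral>x. exp (- c * \<Lambda> * (\<Sum>l\<in>T. (x $ l)\<^sup>2)) \<partial>(sphere_measure :: (real ^ 'n) measure))
            \<le> C * \<Lambda> powr (- real (card T) / 2)" if \<Lambda>: "\<Lambda> \<ge> 1" for \<Lambda>
  proof -
    define g where "g x = exp (- c * \<Lambda> * (\<Sum>l\<in>T. (x $ l)\<^sup>2))" for x :: "real ^ 'n"
    have cg: "continuous_on A g" for A unfolding g_def[abs_def] by (intro continuous_intros)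
    define h where "h i t = ennreal (if i \<in> T then exp (- (c * \<Lambda>) * t\<^sup>2) else indicator {-1..1} t)" for i :: 'n and t :: real
    have hm: "h i \<in> borel_measurable borel" for i unfolding h_def[abs_def] by (cases "i \<in> T") auto
    define w where "w i = (if i \<in> T then \<Lambda> powr (- 1 / 2) else 1)" for i
    have "(\<integral>\<^sup>+ t. h i t \<partial>lborel) = ennreal (u i * w i)" for i
    proof (cases "i \<in> T")
      case True
      then show ?thesis using c \<Lambda> nn_integral_gauss_scaled[of "c * \<Lambda>"]
        by (simp add: h_def u_def w_def powr_mult mult_ac)
    next
      case False
      have "(\<integral>\<^sup>+ t. indicator {-1..1::real} t \<partial>lborel) = (2 :: ennreal)"
        using nn_integral_indicator[of "{-1..1::real}" lborel] by simp
      then show ?thesis using False by (simp add: h_def u_def w_def ennreal_indicator)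
    qed
    then have int_h: "(\<Prod>i\<in>UNIV. \<integral>\<^sup>+ t. h i t \<partial>lborel) = ennreal ((\<Prod>i\<in>UNIV. u i) * \<Lambda> powr (- real (card T) / 2))"
    proof -
      have "(\<Prod>i\<in>UNIV. w i) = (\<Lambda> powr (- 1 / 2)) ^ card T"
        by (simp add: w_def prod.If_cases)
      also have "\<dots> = \<Lambda> powr (- real (card T) / 2)" using \<Lambda> by (simp add: powr_power)
      finally have "(\<Prod>i\<in>UNIV. u i * w i) = (\<Prod>i\<in>UNIV. u i) * \<Lambda> powr (- real (card T) / 2)" by (simp add: prod.distrib)
      moreover have "u i * w i \<ge> 0" for i using u[of i] by (simp add: w_def)
      ultimately show ?thesis using \<open>\<And>i. (\<integral>\<^sup>+ t. h i t \<partial>lborel) = _\<close> by (simp add: prod_ennreal)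
    qed
    have le: "ennreal (g (sgn y)) * indicator (ball 0 1) y \<le> (\<Prod>i\<in>UNIV. h i (y $ i))" for y :: "real ^ 'n"
    proof (cases "y \<in> ball 0 1")
      case True
      have y1: "\<bar>y $ i\<bar> \<le> 1" for i using component_le_norm_cart[of y i] True by simp
      have "(y $ l)\<^sup>2 \<le> (sgn y $ l)\<^sup>2" for l
      proof (cases "y = 0")
        case False
        have "\<bar>y $ l\<bar> \<le> \<bar>sgn y $ l\<bar>"
          using False True by (simp add: sgn_div_norm abs_mult field_simps mult_left_le_one_le mult_right_le_one_le)
        then show ?thesis by (simp add: abs_le_square_iff)
      qed simp
      then have "(\<Sum>l\<in>T. (y $ l)\<^sup>2) \<le> (\<Sum>l\<in>T. (sgn y $ l)\<^sup>2)" by (intro sum_mono)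
      then have "g (sgn y) \<le> exp (- (c * \<Lambda>) * (\<Sum>l\<in>T. (y $ l)\<^sup>2))"
        using c \<Lambda> by (simp add: g_def)
      also have "\<dots> = (\<Prod>l\<in>T. exp (- (c * \<Lambda>) * (y $ l)\<^sup>2))"
        by (simp add: sum_distrib_left exp_sum[symmetric] sum_negf)
      also have "\<dots> = (\<Prod>i\<in>UNIV. if i \<in> T then exp (- (c * \<Lambda>) * (y $ i)\<^sup>2) else indicator {-1..1} (y $ i))"
        using y1 by (intro prod.mono_neutral_cong_left) (auto simp: indicator_def abs_le_iff minus_le_iff)
      finally have "ennreal (g (sgn y)) \<le> ennreal (\<Prod>i\<in>UNIV. if i \<in> T then exp (- (c * \<Lambda>) * (y $ i)\<^sup>2) else indicator {-1..1} (y $ i))"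
        by (rule ennreal_leI)
      also have "\<dots> = (\<Prod>i\<in>UNIV. h i (y $ i))"
        unfolding h_def by (rule prod_ennreal[symmetric]) auto
      finally show ?thesis using True by simp
    qed simp
    have "ennreal (\<integral>x. g x \<partial>sphere_measure) = (\<integral>\<^sup>+ x. ennreal (g x) \<partial>sphere_measure)"
      by (rule nn_integral_eq_integral[symmetric, OF integrable_continuous_sphere[OF cg]]) (simp add: g_def)
    also have "\<dots> \<le> (\<integral>\<^sup>+ y. ennreal (g (sgn y)) * indicator (ball 0 1) y \<partial>lborel) / emeasure lborel (ball (0 :: real ^ 'n) 1)"
      by (rule nn_integral_sphere_le) (use borel_measurable_continuous_onI[OF cg] in simp)
    also have "\<dots> \<le> (\<integral>\<^sup>+ y. (\<Prod>i\<in>UNIV. h i (y $ i)) \<partial>lborel) / emeasure lborel (ball (0 :: real ^ 'n) 1)"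
      by (intro divide_right_mono_ennreal nn_integral_mono le)
    also have "\<dots> = ennreal ((\<Prod>i\<in>UNIV. u i) * \<Lambda> powr (- real (card T) / 2)) / ennreal ?V"
      unfolding nn_integral_lborel_cart[OF hm] int_h content_ball_cart_pos(2) ..
    also have "\<dots> = ennreal (C * \<Lambda> powr (- real (card T) / 2))"
    proof -
      have "(\<Prod>i\<in>UNIV. u i) * \<Lambda> powr (- real (card T) / 2) \<ge> 0"
        using u by (intro mult_nonneg_nonneg prod_nonneg) (auto intro: less_imp_le)
      from divide_ennreal[OF this content_ball_cart_pos(1)] show ?thesis by (simp add: C_def)
    qed
    finally show ?thesis
      using \<open>C > 0\<close> by (simp add: g_def ennreal_le_iff)
  qed
  ultimately show ?thesis by blast
qed

text \<open>On \<open>A\<close> all coordinates other than the m-th are at most \<Lambda>^(-1/2) in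
  modulus, so the exponent stays bounded. The measure of \<open>A\<close> is at least a constant
  times \<Lambda>^(-(n - 1)/2), as witnessed by a box in the ball that \<open>sgn\<close> maps into
  \<open>A\<close>.\<close>

lemma gauss_sphere_lower:
  fixes m :: "'n::finite"
  assumes c: "c \<ge> 0"
  shows "\<exists>C>0. \<forall>\<Lambda>\<ge>1. C * \<Lambda> powr (- real (CARD('n) - 1) / 2)
            \<le> (\<integral>x. exp (- c * \<Lambda> * (1 - (x $ m)\<^sup>2)) \<partial>(sphere_measure :: (real ^ 'n) measure))"
proof -
  let ?N = "real CARD('n)" and ?\<sigma> = "sphere_measure :: (real ^ 'n) measure"
  let ?V = "measure lborel (ball (0 :: real ^ 'n) 1)"
  have N: "?N \<ge> 1" by (simp add: Suc_le_eq)
  \<comment> \<open>The exponential bounds the integrand on \<open>A\<close> from below; 1/4 and 1/N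
    are the side lengths of the box below, the latter up to the factor \<delta>.\<close>
  define C where "C = exp (- c * ?N) * (1 / 4 * (1 / ?N) ^ (CARD('n) - 1) / ?V)"
  have "C > 0" using N content_ball_cart_pos(1)[where 'n = 'n] by (simp add: C_def)
  moreover have "C * \<Lambda> powr (- real (CARD('n) - 1) / 2) \<le> (\<integral>x. exp (- c * \<Lambda> * (1 - (x $ m)\<^sup>2)) \<partial>?\<sigma>)"
    if \<Lambda>: "\<Lambda> \<ge> 1" for \<Lambda>
  proof -
    define \<delta> where "\<delta> = \<Lambda> powr (- 1 / 2)"
    have \<delta>: "\<delta> > 0" using \<Lambda> by (simp add: \<delta>_def)
    have \<delta>1: "\<delta> \<le> 1" using powr_mono[of "- 1 / 2" 0 \<Lambda>] \<Lambda> by (simp add: \<delta>_def)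
    have \<delta>2: "\<Lambda> * \<delta>\<^sup>2 = 1" unfolding \<delta>_def using \<Lambda> by (intro powr_minus_half_sq) simp
    define A where "A = {x :: real ^ 'n. x \<in> sphere 0 1 \<and> (\<forall>l. l \<noteq> m \<longrightarrow> \<bar>x $ l\<bar> \<le> \<delta>)}"
    have "closed A"
      unfolding A_def
      by (intro closed_Collect_conj closed_Collect_all closed_Collect_imp closed_Collect_le continuous_intros)
         (auto intro!: closed_Collect_eq continuous_intros)
    then have Ab: "A \<in> sets borel" by simp
    have As: "A \<subseteq> sphere 0 1" by (auto simp: A_def)
    have A\<sigma>: "A \<in> sets ?\<sigma>" using Ab As by (auto simp: sets_sphere_measure sets_restrict_space)
    \<comment> \<open>The m-th coordinate is at least 1/2, so division by the norm at most doubles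
      the others: half-widths \<delta> / (2 N) stay below \<delta>. The box lies in the ball because
      (3/4)^2 + 1/4 < 1.\<close>
    define lo :: "real ^ 'n" where "lo = (\<chi> l. if l = m then 1 / 2 else - (\<delta> / (2 * ?N)))"
    define hi :: "real ^ 'n" where "hi = (\<chi> l. if l = m then 3 / 4 else \<delta> / (2 * ?N))"
    have sub: "cbox lo hi \<subseteq> ball 0 1 \<inter> sgn -` A"
    proof
      fix y assume "y \<in> cbox lo hi"
      then have ym: "1 / 2 \<le> y $ m" "y $ m \<le> 3 / 4" and yl: "\<And>l. l \<noteq> m \<Longrightarrow> \<bar>y $ l\<bar> \<le> \<delta> / (2 * ?N)"
        by (auto simp: mem_box_cart lo_def hi_def abs_le_iff minus_le_iff split: if_splits) (metis+)?
      have yl2: "(y $ l)\<^sup>2 \<le> (1 / (2 * ?N))\<^sup>2" if "l \<noteq> m" for l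
      proof -
        have "\<delta> / (2 * ?N) \<le> 1 / (2 * ?N)" using \<delta>1 N by (intro divide_right_mono) auto
        then have "\<bar>y $ l\<bar> \<le> 1 / (2 * ?N)" using yl[OF that] by linarith
        then show ?thesis using power_mono[of "\<bar>y $ l\<bar>" "1 / (2 * ?N)" 2] by simp
      qed
      have "(norm y)\<^sup>2 = (\<Sum>l\<in>UNIV. (y $ l)\<^sup>2)"
        by (simp add: norm_vec_def L2_set_def sum_nonneg)
      also have "\<dots> = (y $ m)\<^sup>2 + (\<Sum>l\<in>UNIV - {m}. (y $ l)\<^sup>2)" by (rule sum.remove) auto
      also have "(\<Sum>l\<in>UNIV - {m}. (y $ l)\<^sup>2) \<le> (\<Sum>l\<in>UNIV - {m}. (1 / (2 * ?N))\<^sup>2)" by (intro sum_mono yl2) auto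
      also have "\<dots> \<le> (\<Sum>l::'n\<in>UNIV. (1 / (2 * ?N))\<^sup>2)" by (intro sum_mono2) auto
      also have "\<dots> = 1 / (4 * ?N)" using N by (simp add: power2_eq_square field_simps)
      also have "\<dots> \<le> 1 / 4" using N by (simp add: field_simps)
      also have "(y $ m)\<^sup>2 \<le> (3 / 4)\<^sup>2" using ym by (intro power_mono) auto
      finally have "(norm y)\<^sup>2 < 1" by (simp add: power2_eq_square)
      then have "norm y < 1" by (simp add: power_less_one_iff)
      have n2: "norm y \<ge> 1 / 2" using component_le_norm_cart[of y m] ym by linarith
      have "\<bar>sgn y $ l\<bar> \<le> \<delta>" if "l \<noteq> m" for l
      proof -
        have "\<bar>sgn y $ l\<bar> = \<bar>y $ l\<bar> / norm y" by (simp add: sgn_div_norm abs_mult divide_inverse mult.commute)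
        also have "\<dots> \<le> (\<delta> / (2 * ?N)) / (1 / 2)" using yl[OF that] n2 \<delta> N by (intro frac_le) auto
        also have "\<dots> \<le> \<delta>" using \<delta> N by (simp add: field_simps)
        finally show ?thesis .
      qed
      moreover have "y \<noteq> 0" using n2 by auto
      ultimately show "y \<in> ball 0 1 \<inter> sgn -` A" using \<open>norm y < 1\<close> by (simp add: A_def norm_sgn)
    qed
    have ne: "cbox lo hi \<noteq> {}"
      using \<delta> N by (auto simp: interval_ne_empty_cart lo_def hi_def)
    have "measure lborel (cbox lo hi) = (\<Prod>l\<in>UNIV. hi $ l - lo $ l)"
      by (rule content_cbox_cart[OF ne])
    also have "\<dots> = (hi $ m - lo $ m) * (\<Prod>l\<in>UNIV - {m}. hi $ l - lo $ l)" by (rule prod.remove) auto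
    also have "(\<Prod>l\<in>UNIV - {m}. hi $ l - lo $ l) = (\<Prod>l\<in>UNIV - {m}. \<delta> / ?N)"
      by (rule prod.cong) (auto simp: hi_def lo_def)
    also have "\<dots> = (\<delta> / ?N) ^ (CARD('n) - 1)" by (simp add: card_Diff_singleton)
    finally have vol: "measure lborel (cbox lo hi) = 1 / 4 * (\<delta> / ?N) ^ (CARD('n) - 1)"
      by (simp add: hi_def lo_def)
    have "sgn -` A \<in> sets borel" using measurable_sets_borel[OF borel_measurable_sgn Ab] by simp
    then have "emeasure lborel (cbox lo hi) \<le> emeasure lborel (ball 0 1 \<inter> sgn -` A)"
      by (intro emeasure_mono sub) auto
    moreover have "emeasure lborel (cbox lo hi) = ennreal (measure lborel (cbox lo hi))"
      by (rule emeasure_eq_ennreal_measure) (use emeasure_lborel_cbox_finite[of lo hi] in simp)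
    ultimately have "ennreal (measure lborel (cbox lo hi)) / ennreal ?V \<le> emeasure ?\<sigma> A"
      unfolding emeasure_sphere_measure[OF Ab As] content_ball_cart_pos(2)
      by (intro divide_right_mono_ennreal) simp
    then have meas: "measure lborel (cbox lo hi) / ?V \<le> measure ?\<sigma> A"
      using content_ball_cart_pos(1)[where 'n = 'n]
      by (subst (asm) divide_ennreal) (auto simp: sph.emeasure_eq_measure)
    have lower: "exp (- c * ?N) * indicator A x \<le> exp (- c * \<Lambda> * (1 - (x $ m)\<^sup>2))" if x: "x \<in> sphere 0 1" for x
    proof (cases "x \<in> A")
      case True
      have "1 = (norm x)\<^sup>2" using x by simp
      also have "\<dots> = (\<Sum>l\<in>UNIV. (x $ l)\<^sup>2)" by (simp add: norm_vec_def L2_set_def sum_nonneg)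
      also have "\<dots> = (x $ m)\<^sup>2 + (\<Sum>l\<in>UNIV - {m}. (x $ l)\<^sup>2)" by (rule sum.remove) auto
      also have "(\<Sum>l\<in>UNIV - {m}. (x $ l)\<^sup>2) \<le> (\<Sum>l\<in>UNIV - {m}. \<delta>\<^sup>2)"
        using True \<delta> by (intro sum_mono) (auto simp: A_def abs_le_square_iff[symmetric])
      also have "\<dots> \<le> (\<Sum>l::'n\<in>UNIV. \<delta>\<^sup>2)" by (intro sum_mono2) auto
      finally have "1 - (x $ m)\<^sup>2 \<le> ?N * \<delta>\<^sup>2" by simp
      then have "c * \<Lambda> * (1 - (x $ m)\<^sup>2) \<le> c * \<Lambda> * (?N * \<delta>\<^sup>2)" using c \<Lambda> by (intro mult_left_mono) auto
      also have "\<dots> = c * ?N * (\<Lambda> * \<delta>\<^sup>2)" by (simp add: mult_ac)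
      finally show ?thesis using True by (simp add: \<delta>2)
    qed simp
    have pw: "\<Lambda> powr (- real k / 2) = \<delta> ^ k" for k
      using \<Lambda> by (simp add: \<delta>_def powr_power)
    have "C * \<Lambda> powr (- real (CARD('n) - 1) / 2) = exp (- c * ?N) * (1 / 4 * (\<delta> / ?N) ^ (CARD('n) - 1) / ?V)"
      unfolding pw by (simp add: C_def power_divide)
    also have "\<dots> \<le> exp (- c * ?N) * measure ?\<sigma> A"
      using meas vol by (intro mult_left_mono) auto
    also have "\<dots> = (\<integral>x. exp (- c * ?N) * indicator A x \<partial>?\<sigma>)" using A\<sigma> As by (simp add: Int_absorb1 Int_absorb2)
    also have "\<dots> \<le> (\<integral>x. exp (- c * \<Lambda> * (1 - (x $ m)\<^sup>2)) \<partial>?\<sigma>)"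
    proof (rule integral_mono)
      show "integrable ?\<sigma> (\<lambda>x. exp (- c * ?N) * indicator A x)"
        by (rule sph.integrable_const_bound[where B = "exp (- c * ?N)"]) (use A\<sigma> in \<open>auto simp: indicator_def\<close>)
      show "integrable ?\<sigma> (\<lambda>x. exp (- c * \<Lambda> * (1 - (x $ m)\<^sup>2)))"
        by (intro integrable_continuous_sphere continuous_intros)
    qed (use lower in simp)
    finally show ?thesis .
  qed
  ultimately show ?thesis by blast
qed

subsection \<open>Sharpness\<close>

text \<open>The radial extension of a sum of squares is a quotient of polynomials with denominator
  |x|^2, nonzero off the origin.\<close>

lemma smooth_sum_squares:
  fixes T :: "'n::finite set"
  shows "Ck_on k (- {0}) (\<lambda>x :: real ^ 'n. \<Sum>l\<in>T. (sgn x $ l)\<^sup>2)"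
proof (rule Ck_on_cong)
  have sq: "spoly 2 (\<lambda>x :: real ^ 'n. \<Sum>l\<in>T. (x $ l)\<^sup>2)" for T
    unfolding power2_eq_square
    using spoly_mult[OF spoly_nth spoly_nth] by (intro spoly_sum) (auto simp: numeral_2_eq_2)
  have nrm: "(norm x)\<^sup>2 = (\<Sum>l\<in>UNIV. (x $ l)\<^sup>2)" for x :: "real ^ 'n"
    by (simp add: norm_vec_def L2_set_def sum_nonneg)
  show "Ck_on k (- {0}) (\<lambda>x :: real ^ 'n. (\<Sum>l\<in>T. (x $ l)\<^sup>2) * inverse (\<Sum>l\<in>UNIV. (x $ l)\<^sup>2))"
    by (intro Ck_on_mult Ck_on_inverse Ck_on_spoly[OF _ sq]) (auto simp: nrm[symmetric])
  show "(\<Sum>l\<in>T. (x $ l)\<^sup>2) * inverse (\<Sum>l\<in>UNIV. (x $ l)\<^sup>2) = (\<Sum>l\<in>T. (sgn x $ l)\<^sup>2)" for x :: "real ^ 'n"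
    unfolding nrm[symmetric] sgn_div_norm
    by (simp add: sum_distrib_left power_mult_distrib power_inverse mult.commute)
qed auto

text \<open>The families consist of operators, so counting requires that different index pairs give
  different operators. For the test function x_l^2 at (e_k + e_l) / sqrt 2 the field of (k, l) has
  the value 1, and no other increasing pair does.\<close>

lemma rotation_field_inj:
  fixes k l k' l' :: "'n::{finite,wellorder}"
  assumes "k < l" "k' < l'" and eq: "rotation_field k l = rotation_field k' l'"
  shows "k = k' \<and> l = l'"
proof -
  define f where "f x = (x $ l) * (x $ l)" for x :: "real ^ ('n::{finite,wellorder})"
  have poly: "spoly (1 + 1) f" unfolding f_def[abs_def] by (rule spoly_mult[OF spoly_nth spoly_nth])
  have smooth: "smooth_on_sphere f"
    using smooth_sum_squares[of _ "{l}"] by (simp add: smooth_on_sphere_def radial_extension_def f_def power2_eq_square)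
  define x :: "real ^ ('n::{finite,wellorder})" where "x = (1 / sqrt 2) *\<^sub>R (axis k 1 + axis l 1)"
  have kl: "k \<noteq> l" using assms by simp
  have xn: "x $ i = (if i = k \<or> i = l then 1 / sqrt 2 else 0)" for i
    using kl by (auto simp: x_def axis_def)
  have x: "x \<in> sphere 0 1"
  proof -
    have "(\<Sum>i\<in>UNIV. (x $ i)\<^sup>2) = (\<Sum>i\<in>{k, l}. (x $ i)\<^sup>2)"
      by (rule sum.mono_neutral_right) (auto simp: xn)
    also have "\<dots> = 1" using kl by (simp add: xn power_divide)
    finally show ?thesis by (simp add: norm_vec_def L2_set_def)
  qed
  have rf: "rotation_field i j f x = 2 * x $ l * rot_gen i j x $ l" if "i \<noteq> j" for i j
  proof -
    have "rotation_field i j f x = rd i j f x"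
      using DERIV_unique[OF rotation_field_derivative[OF smooth that x] rd_rot_derivative[OF that poly]] .
    also have "\<dots> = 2 * x $ l * rot_gen i j x $ l"
      unfolding f_def rd_mult[OF spoly_nth spoly_nth] rd_linear[OF linear_vec_nth] by simp
    finally show ?thesis .
  qed
  have "rotation_field k l f x = 1"
    using kl by (simp add: rf rot_gen_def xn axis_def)
  then have "2 * x $ l * rot_gen k' l' x $ l = 1"
    using rf[of k' l'] assms(2) eq by simp
  then show ?thesis
    using assms by (auto simp: rot_gen_def xn axis_def split: if_splits)
qed

text \<open>All exponents are taken equal to some p < c. As each pair is separated exactly
  \<open>c\<close> times, the penalties of the test functions add up to c (1 - x_m^2) on the sphere,
  and comparing powers of \<open>s\<close> on both sides gives a contradiction.\<close>

lemma admissible_exponent_ge: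
  fixes A :: "nat \<Rightarrow> ('n::{finite,wellorder}) vfield set"
  assumes n2: "CARD('n) \<ge> 2"
    and E: "\<And>J. J \<in> {1..Jmax} \<Longrightarrow> equivp (E J)"
    and A: "\<And>J X. J \<in> {1..Jmax} \<Longrightarrow> X \<in> A J \<Longrightarrow> \<exists>k l. X = rotation_field k l \<and> k \<noteq> l \<and> E J k l"
    and count: "\<And>k l. k \<noteq> l \<Longrightarrow> card {J\<in>{1..Jmax}. \<not> E J k l} = c"
    and adm: "admissible_exponent Jmax A q"
  shows "of_nat c \<le> q"
proof (rule ccontr)
  assume "\<not> of_nat c \<le> q"
  then have q: "q < ennreal (real c)" by (simp add: ennreal_of_nat_eq_real_of_nat not_le)
  then obtain q' where q': "q = ennreal q'" "q' \<ge> 0" by (cases q) (auto simp: top_unique)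
  have "q' < real c" using q q' by (simp add: ennreal_less_iff)
  \<comment> \<open>Strictly below \<open>c\<close> but at least q', and positive even when q' is
    0.\<close>
  define p where "p = (q' + real c) / 2"
  have p: "p > 0" "p < real c" "q' \<le> p" using \<open>q' < real c\<close> q'(2) by (auto simp: p_def)
  let ?Js = "{1..Jmax}" and ?\<sigma> = "sphere_measure :: (real ^ ('n::{finite,wellorder})) measure"
  define m :: 'n where "m = (SOME i. True)"
  \<comment> \<open>The coordinates outside the class of \<open>m\<close>; these are the ones
    penalised by the J-th test function.\<close>
  define T where "T J = {l. \<not> E J m l}" for J
  define f where "f s J x = exp (- s * (\<Sum>l\<in>T J. (x $ l)\<^sup>2))" for s J and x :: "real ^ ('n::{finite,wellorder})"
  have sym: "symmetric_wrt (A J) (f s J)" if J: "J \<in> ?Js" for s J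
  proof (rule rot_invariant_symmetric[OF _ _ A[OF J]])
    show "smooth_on_sphere (f s J)"
      unfolding smooth_on_sphere_def radial_extension_def f_def
      by (intro allI Ck_on_exp Ck_on_mult Ck_on_const smooth_sum_squares) auto
    show "rot_invariant (E J) (f s J)"
      unfolding rot_invariant_def
    proof (intro allI ballI impI)
      fix k l t and x :: "real ^ ('n::{finite,wellorder})" assume kl: "k \<noteq> l" "E J k l"
      then have "k \<in> T J \<longleftrightarrow> l \<in> T J"
        using E[OF J] unfolding T_def by (metis (mono_tags) equivp_symp equivp_transp mem_Collect_eq)
      then show "f s J (rot k l t x) = f s J x"
        unfolding f_def by (simp only: sum_squares_rot[OF kl(1)])
    qed
  qed
  have weights: "(\<Sum>J\<in>?Js. \<Sum>l\<in>T J. g l) = real c * (\<Sum>l\<in>UNIV - {m}. g l)" for g :: "'n \<Rightarrow> real"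
  proof -
    have "(\<Sum>J\<in>?Js. \<Sum>l\<in>T J. g l) = (\<Sum>J\<in>?Js. \<Sum>l\<in>UNIV - {m}. if E J m l then 0 else g l)"
    proof (rule sum.cong[OF refl])
      fix J assume "J \<in> ?Js"
      then have "E J m m" using E equivp_reflp by metis
      then show "(\<Sum>l\<in>T J. g l) = (\<Sum>l\<in>UNIV - {m}. if E J m l then 0 else g l)"
        by (intro sum.mono_neutral_cong_left) (auto simp: T_def)
    qed
    also have "\<dots> = (\<Sum>l\<in>UNIV - {m}. \<Sum>J\<in>?Js. if E J m l then 0 else g l)" by (rule sum.swap)
    also have "\<dots> = (\<Sum>l\<in>UNIV - {m}. real c * g l)"
    proof (rule sum.cong[OF refl])
      fix l assume "l \<in> UNIV - {m}"
      then have "card {J\<in>?Js. \<not> E J m l} = c" by (intro count) auto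
      moreover have "(\<Sum>J\<in>?Js. if E J m l then 0 else g l) = (\<Sum>J\<in>{J\<in>?Js. \<not> E J m l}. g l)"
        by (rule sum.mono_neutral_cong_right) auto
      ultimately show "(\<Sum>J\<in>?Js. if E J m l then 0 else g l) = real c * g l" by simp
    qed
    finally show ?thesis by (simp add: sum_distrib_left)
  qed
  have prod_f: "(\<Prod>J\<in>?Js. f s J x) = exp (- real c * s * (1 - (x $ m)\<^sup>2))" if x: "x \<in> sphere 0 1" for s x
  proof -
    have "1 = (norm x)\<^sup>2" using x by simp
    also have "\<dots> = (\<Sum>l\<in>UNIV. (x $ l)\<^sup>2)" by (simp add: norm_vec_def L2_set_def sum_nonneg)
    also have "\<dots> = (x $ m)\<^sup>2 + (\<Sum>l\<in>UNIV - {m}. (x $ l)\<^sup>2)" by (rule sum.remove) auto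
    finally have 1: "(\<Sum>l\<in>UNIV - {m}. (x $ l)\<^sup>2) = 1 - (x $ m)\<^sup>2" by simp
    have "(\<Prod>J\<in>?Js. f s J x) = exp (\<Sum>J\<in>?Js. - s * (\<Sum>l\<in>T J. (x $ l)\<^sup>2))"
      unfolding f_def by (rule exp_sum[symmetric]) simp
    also have "(\<Sum>J\<in>?Js. - s * (\<Sum>l\<in>T J. (x $ l)\<^sup>2)) = - s * (real c * (1 - (x $ m)\<^sup>2))"
      unfolding sum_distrib_left[symmetric] weights 1 ..
    finally show ?thesis by (simp add: mult_ac)
  qed
  have ineq: "(\<integral>x. exp (- real c * s * (1 - (x $ m)\<^sup>2)) \<partial>?\<sigma>)
      \<le> (\<Prod>J\<in>?Js. (\<integral>x. exp (- p * s * (\<Sum>l\<in>T J. (x $ l)\<^sup>2)) \<partial>?\<sigma>) powr (1 / p))" for s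
  proof -
    have "product_inequality Jmax A (\<lambda>_. ennreal p)"
      using adm p q' unfolding admissible_exponent_def by (auto intro: ennreal_leI)
    then have "(\<forall>J\<in>?Js. symmetric_wrt (A J) (f s J) \<and> (\<forall>x\<in>sphere 0 1. 0 \<le> f s J x)) \<longrightarrow>
        (\<integral>x. (\<Prod>J\<in>?Js. f s J x) \<partial>?\<sigma>) \<le> (\<Prod>J\<in>?Js. Lp_norm ?\<sigma> (ennreal p) (f s J))"
      unfolding product_inequality_def by blast
    moreover have "0 \<le> f s J x" for J x by (simp add: f_def)
    ultimately have "(\<integral>x. (\<Prod>J\<in>?Js. f s J x) \<partial>?\<sigma>) \<le> (\<Prod>J\<in>?Js. Lp_norm ?\<sigma> (ennreal p) (f s J))"
      using sym by blast
    moreover have "(\<integral>x. (\<Prod>J\<in>?Js. f s J x) \<partial>?\<sigma>) = (\<integral>x. exp (- real c * s * (1 - (x $ m)\<^sup>2)) \<partial>?\<sigma>)"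
      by (rule sphere_integral_cong) (rule prod_f)
    moreover have "\<bar>f s J x\<bar> powr p = exp (- p * s * (\<Sum>l\<in>T J. (x $ l)\<^sup>2))" for J x
      by (simp add: f_def powr_def mult_ac)
    ultimately show ?thesis using p(1) by (simp add: Lp_norm_ennreal)
  qed
  obtain C1 where C1: "C1 > 0" "\<And>s. s \<ge> 1 \<Longrightarrow> C1 * s powr (- real (CARD('n) - 1) / 2)
      \<le> (\<integral>x. exp (- real c * s * (1 - (x $ m)\<^sup>2)) \<partial>?\<sigma>)"
    using gauss_sphere_lower[of "real c" m] by auto
  have "\<exists>C>0. \<forall>s\<ge>1. (\<integral>x. exp (- p * s * (\<Sum>l\<in>T J. (x $ l)\<^sup>2)) \<partial>?\<sigma>) \<le> C * s powr (- real (card (T J)) / 2)" for J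
    by (rule gauss_sphere_upper[OF p(1)])
  then obtain C2 where C2: "\<And>J. C2 J > 0" "\<And>J s. s \<ge> 1 \<Longrightarrow>
      (\<integral>x. exp (- p * s * (\<Sum>l\<in>T J. (x $ l)\<^sup>2)) \<partial>?\<sigma>) \<le> C2 J * s powr (- real (card (T J)) / 2)" by metis
  define C where "C = (\<Prod>J\<in>?Js. C2 J powr (1 / p))"
  have C: "C > 0" unfolding C_def using C2(1) by (intro prod_pos) (auto simp: less_imp_neq[THEN not_sym])
  \<comment> \<open>The difference of the decay rates of the two sides; positive because p < c and n
    \<ge> 2.\<close>
  define e where "e = real (CARD('n) - 1) / 2 * (real c / p - 1)"
  have e: "e > 0" using n2 p by (simp add: e_def)
  have bound: "s powr e \<le> C / C1" if s: "s \<ge> 1" for s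
  proof -
    have "C1 * s powr (- real (CARD('n) - 1) / 2)
        \<le> (\<Prod>J\<in>?Js. (\<integral>x. exp (- p * s * (\<Sum>l\<in>T J. (x $ l)\<^sup>2)) \<partial>?\<sigma>) powr (1 / p))"
      using C1(2)[OF s] ineq[of s] by linarith
    also have "\<dots> \<le> (\<Prod>J\<in>?Js. (C2 J * s powr (- real (card (T J)) / 2)) powr (1 / p))"
      using C2(2)[OF s] p(1) by (intro prod_mono conjI powr_mono2 integral_nonneg_AE AE_I2) auto
    also have "\<dots> = (\<Prod>J\<in>?Js. C2 J powr (1 / p) * s powr (- real (card (T J)) / (2 * p)))"
      using C2(1) s by (intro prod.cong refl) (simp add: powr_mult powr_powr)
    also have "\<dots> = C * s powr (\<Sum>J\<in>?Js. - real (card (T J)) / (2 * p))"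
      using s by (simp add: prod.distrib C_def powr_sum)
    also have "(\<Sum>J\<in>?Js. - real (card (T J)) / (2 * p)) = - (real c * real (CARD('n) - 1)) / (2 * p)"
      using weights[of "\<lambda>_. 1"] by (simp add: sum_divide_distrib[symmetric] sum_negf card_Diff_singleton)
    finally have *: "C1 * s powr (- real (CARD('n) - 1) / 2) \<le> C * s powr (- (real c * real (CARD('n) - 1)) / (2 * p))" .
    have ex: "- (real c * real (CARD('n) - 1)) / (2 * p) + (real c * real (CARD('n) - 1)) / (2 * p) = 0"
       "- real (CARD('n) - 1) / 2 + (real c * real (CARD('n) - 1)) / (2 * p) = e"
      using p(1) by (simp_all add: e_def field_simps)
    have "C1 * s powr (- real (CARD('n) - 1) / 2) * s powr ((real c * real (CARD('n) - 1)) / (2 * p))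
       \<le> C * s powr (- (real c * real (CARD('n) - 1)) / (2 * p)) * s powr ((real c * real (CARD('n) - 1)) / (2 * p))"
      using * by (rule mult_right_mono) simp
    then have "C1 * s powr e \<le> C"
      unfolding mult.assoc powr_add[symmetric] ex using s by simp
    then show ?thesis using C1(1) by (simp add: pos_le_divide_eq mult.commute)
  qed
  \<comment> \<open>Chosen so that \<open>s powr e\<close> exceeds the bound by exactly 1.\<close>
  define s where "s = (C / C1 + 1) powr (1 / e)"
  have CC: "C / C1 > 0" using C C1 by simp
  have "s \<ge> 1" unfolding s_def using CC e by (intro ge_one_powr_ge_zero) auto
  moreover have "s powr e = C / C1 + 1" using e CC by (simp add: s_def powr_powr)
  ultimately show False using bound[of s] by simp
qed

subsection \<open>The recurrence number\<close>

lemma rotation_field_in_tuple_fields: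
  assumes "k < l"
  shows "rotation_field k l \<in> tuple_fields \<alpha>s \<longleftrightarrow> in_block \<alpha>s k l"
proof
  assume "rotation_field k l \<in> tuple_fields \<alpha>s"
  then obtain k' l' where "rotation_field k l = rotation_field k' l'" "k' < l'" "in_block \<alpha>s k' l'"
    unfolding tuple_fields_def in_block_def by blast
  with rotation_field_inj[OF assms] show "in_block \<alpha>s k l" by blast
qed (use assms in \<open>auto simp: tuple_fields_def in_block_def\<close>)

text \<open>All fields recur equally often, so the maximum is this common value. For
  \<open>c = 0\<close> the union is empty, and the supremum of the empty set of naturals, which is
  0, still agrees.\<close>

lemma max_recurrence_eq:
  assumes "\<And>L. L \<in> rotation_fields \<Longrightarrow> card {J\<in>{1..Jmax}. L \<in> rotation_fields - A J} = c"
    and "(rotation_fields :: ('n::{finite,wellorder}) vfield set) \<noteq> {}"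
  shows "max_recurrence Jmax (A :: nat \<Rightarrow> 'n vfield set) = c"
proof (cases "c = 0")
  case True
  have "(\<Union>J\<in>{1..Jmax}. rotation_fields - A J) = {}"
  proof (rule ccontr)
    assume "(\<Union>J\<in>{1..Jmax}. rotation_fields - A J) \<noteq> {}"
    then obtain L J where "J \<in> {1..Jmax}" "L \<in> rotation_fields" "L \<in> rotation_fields - A J" by blast
    then have "{J\<in>{1..Jmax}. L \<in> rotation_fields - A J} \<noteq> {}" by blast
    then have "card {J\<in>{1..Jmax}. L \<in> rotation_fields - A J} \<noteq> 0" by simp
    with assms(1)[OF \<open>L \<in> rotation_fields\<close>] True show False by simp
  qed
  then show ?thesis using True by (simp only: max_recurrence_def image_empty Sup_nat_empty)
next
  case False
  obtain L :: "'n vfield" where L: "L \<in> rotation_fields" using assms(2) by blast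
  then have "{J\<in>{1..Jmax}. L \<in> rotation_fields - A J} \<noteq> {}"
    using assms(1)[OF L] False by (metis card.empty)
  then have "(\<Union>J\<in>{1..Jmax}. rotation_fields - A J) \<noteq> {}" by blast
  then have "(\<lambda>L. card {J\<in>{1..Jmax}. L \<in> rotation_fields - A J}) ` (\<Union>J\<in>{1..Jmax}. rotation_fields - A J) = {c}"
    using assms(1) by (auto simp del: atLeastAtMost_iff)
  then show ?thesis by (simp only: max_recurrence_def cSup_singleton)
qed

lemma real_prod_list_fact: "real (\<Prod>x\<leftarrow>a. fact x) = (\<Prod>x\<leftarrow>a. fact x)"
  by (induction a) auto

text \<open>Truncated subtraction is harmless: at \<open>x = 0\<close> both terms vanish.\<close>

lemma real_sum_list_pairs: "real (\<Sum>x\<leftarrow>a. x * (x - 1)) = (\<Sum>x\<leftarrow>a. real x * (real x - 1))"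
proof (induction a)
  case (Cons x a)
  then show ?case by (cases x) (auto simp: algebra_simps)
qed simp

theorem theorem3p1:
  fixes n R Jmax ptilde :: nat and a :: "nat list"
    and A :: "nat \<Rightarrow> ('n::{finite,wellorder}) vfield set"
  assumes "n = CARD('n)" and "n \<ge> 3"
    and "length a \<ge> 1" and "sorted_wrt (\<ge>) a" and "\<forall>x\<in>set a. x \<ge> 2"
    and "sum_list a \<le> n" and "R = n - sum_list a"
    and "balanced_family a Jmax A"
    and "ptilde = max_recurrence Jmax A"
  shows "real Jmax = fact n / ((\<Prod>x\<leftarrow>a. fact x) * fact R)
    \<and> real ptilde =
        fact (n - 2) * (real n * (real n - 1) - (\<Sum>x\<leftarrow>a. real x * (real x - 1)))
          / ((\<Prod>x\<leftarrow>a. fact x) * fact R)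
    \<and> admissible_exponent Jmax A (of_nat ptilde)
    \<and> (\<forall>q. admissible_exponent Jmax A q \<longrightarrow> of_nat ptilde \<le> q)"
proof -
  obtain \<alpha> where bij: "bij_betw \<alpha> {1..Jmax} (orthogonal_tuples a :: (nat ^ ('n::{finite,wellorder})) list set)"
    and A: "\<And>J. J \<in> {1..Jmax} \<Longrightarrow> A J = tuple_fields (\<alpha> J)"
    using assms(8) unfolding balanced_family_def by blast
  let ?O = "orthogonal_tuples a :: (nat ^ ('n::{finite,wellorder})) list set"
  have \<alpha>: "\<alpha> J \<in> ?O" if "J \<in> {1..Jmax}" for J using bij_betwE[OF bij] that by blast
  have Jmax: "Jmax = card ?O" using bij_betw_same_card[OF bij] by simp
  have n2: "CARD('n) \<ge> 2" using assms(1,2) by simp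
  \<comment> \<open>Same block in the J-th tuple, with every remaining index forming a class of its
    own.\<close>
  define E where "E J k l \<longleftrightarrow> k = l \<or> in_block (\<alpha> J) k l" for J k l
  have E: "equivp (E J)" if "J \<in> {1..Jmax}" for J
    unfolding E_def[abs_def] by (rule equivp_in_block[OF \<alpha>[OF that]])
  obtain u v :: 'n where uv: "u < v"
  proof -
    have "\<not> card (UNIV :: 'n set) \<le> Suc 0" using n2 by simp
    then obtain u v :: 'n where "u \<noteq> v" using card_le_Suc0_iff_eq[of "UNIV :: 'n set"] by auto
    then have "u < v \<or> v < u" by (rule neqE) auto
    then show thesis using that by blast
  qed
  \<comment> \<open>The number of tuples joining a pair; \<open>u\<close> and \<open>v\<close> are
    an arbitrary reference pair, as the count does not depend on it.\<close>
  define M where "M = card {\<alpha>s \<in> ?O. in_block \<alpha>s u v}"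
  have nn: "n * (n - 1) > 0" using assms(2) by simp
  have M: "M * (n * (n - 1)) = Jmax * (\<Sum>x\<leftarrow>a. x * (x - 1))"
    unfolding M_def Jmax assms(1) using uv by (intro card_in_block) simp
  have count_in: "card {J\<in>{1..Jmax}. in_block (\<alpha> J) k l} = M" if "k \<noteq> l" for k l
  proof -
    have "bij_betw \<alpha> {J\<in>{1..Jmax}. in_block (\<alpha> J) k l} {\<alpha>s \<in> ?O. in_block \<alpha>s k l}"
      unfolding bij_betw_def
    proof (intro conjI)
      show "inj_on \<alpha> {J\<in>{1..Jmax}. in_block (\<alpha> J) k l}"
        by (rule inj_on_subset[OF bij_betw_imp_inj_on[OF bij]]) blast
      show "\<alpha> ` {J\<in>{1..Jmax}. in_block (\<alpha> J) k l} = {\<alpha>s \<in> ?O. in_block \<alpha>s k l}"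
        unfolding bij_betw_imp_surj_on[OF bij, symmetric] by blast
    qed
    then have "card {J\<in>{1..Jmax}. in_block (\<alpha> J) k l} = card {\<alpha>s \<in> ?O. in_block \<alpha>s k l}"
      by (rule bij_betw_same_card)
    moreover have "card {\<alpha>s \<in> ?O. in_block \<alpha>s k l} * (n * (n - 1)) = Jmax * (\<Sum>x\<leftarrow>a. x * (x - 1))"
      unfolding Jmax assms(1) by (rule card_in_block[OF that])
    ultimately have "card {J\<in>{1..Jmax}. in_block (\<alpha> J) k l} * (n * (n - 1)) = M * (n * (n - 1))"
      by (simp only: M)
    with less_imp_neq[OF nn, symmetric] show ?thesis by (rule mult_right_cancel[THEN iffD1])
  qed
  \<comment> \<open>This is the recurrence number \<open>c\<close> of the general results, the same
    for every pair.\<close>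
  have count: "card {J\<in>{1..Jmax}. \<not> E J k l} = Jmax - M" if "k \<noteq> l" for k l
  proof -
    have "{J\<in>{1..Jmax}. \<not> E J k l} = {1..Jmax} - {J\<in>{1..Jmax}. in_block (\<alpha> J) k l}"
      using that by (auto simp: E_def)
    also have "card \<dots> = card {1..Jmax} - card {J\<in>{1..Jmax}. in_block (\<alpha> J) k l}"
      by (rule card_Diff_subset) auto
    finally show ?thesis by (simp only: count_in[OF that]) simp
  qed
  have AE: "rotation_field k l \<in> A J \<longleftrightarrow> E J k l" if "J \<in> {1..Jmax}" "k < l" for J k l
    using rotation_field_in_tuple_fields[OF that(2)] A[OF that(1)] that(2) by (auto simp: E_def)
  have ptilde: "ptilde = Jmax - M"
    unfolding assms(9)
  proof (rule max_recurrence_eq)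
    fix L :: "'n vfield" assume "L \<in> rotation_fields"
    then obtain k l where L: "L = rotation_field k l" "k < l" by (auto simp: rotation_fields_def)
    have "{J\<in>{1..Jmax}. L \<in> rotation_fields - A J} = {J\<in>{1..Jmax}. \<not> E J k l}"
      using AE[OF _ L(2)] \<open>L \<in> rotation_fields\<close> unfolding L(1) by blast
    then show "card {J\<in>{1..Jmax}. L \<in> rotation_fields - A J} = Jmax - M"
      using count[of k l] L(2) by simp
  next
    show "(rotation_fields :: 'n vfield set) \<noteq> {}" using uv by (auto simp: rotation_fields_def)
  qed
  let ?D = "(\<Prod>x\<leftarrow>a. fact x) * fact R :: real"
  have "(\<Prod>x\<leftarrow>b. fact x) > (0 :: real)" for b :: "nat list" by (induction b) auto
  then have D: "?D > 0" by simp
  have "Jmax * ((\<Prod>x\<leftarrow>a. fact x) * fact R) = fact n"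
    unfolding Jmax assms(7) assms(1) using assms(6) unfolding assms(1) by (rule card_orthogonal_tuples)
  then have "real Jmax * ?D = fact n"
    unfolding real_prod_list_fact[symmetric] by (metis of_nat_fact of_nat_mult)
  then have J: "real Jmax = fact n / ?D"
    by (rule nonzero_eq_divide_eq[OF less_imp_neq[OF D, symmetric], THEN iffD2])
  \<comment> \<open>Turns the truncated difference \<open>Jmax - M\<close> into a difference of
    reals.\<close>
  have "M \<le> Jmax"
    unfolding M_def Jmax by (intro card_mono finite_orthogonal_tuples) auto
  have rM: "real M * (real n * (real n - 1)) = real Jmax * (\<Sum>x\<leftarrow>a. real x * (real x - 1))"
    using arg_cong[OF M, of real] assms(2) by (simp add: real_sum_list_pairs[symmetric] of_nat_diff)
  have nn': "real n * (real n - 1) > 0" using assms(2) by simp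
  have "fact n = real n * (real n - 1) * fact (n - 2)"
    using assms(2) fact_reduce[of n, where 'a = real] fact_reduce[of "n - 1", where 'a = real]
    by (simp add: of_nat_diff numeral_2_eq_2)
  have "real ptilde * (real n * (real n - 1)) = real Jmax * (real n * (real n - 1) - (\<Sum>x\<leftarrow>a. real x * (real x - 1)))"
    using \<open>M \<le> Jmax\<close> rM by (simp add: ptilde of_nat_diff left_diff_distrib right_diff_distrib)
  also have "\<dots> = fact (n - 2) * (real n * (real n - 1) - (\<Sum>x\<leftarrow>a. real x * (real x - 1))) / ?D * (real n * (real n - 1))"
    unfolding J \<open>fact n = _\<close> by simp
  finally have "real ptilde = fact (n - 2) * (real n * (real n - 1) - (\<Sum>x\<leftarrow>a. real x * (real x - 1))) / ?D"
    by (rule mult_right_cancel[OF less_imp_neq[OF nn', symmetric], THEN iffD1])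
  moreover have "admissible_exponent Jmax A (of_nat ptilde)"
    unfolding ptilde by (rule product_inequality_holds[OF n2 E]) (use AE count in auto)
  moreover have "of_nat ptilde \<le> q" if "admissible_exponent Jmax A q" for q
    unfolding ptilde
  proof (rule admissible_exponent_ge[OF n2 E _ count that])
    fix J X assume J: "J \<in> {1..Jmax}" and "X \<in> A J"
    then obtain k l where "X = rotation_field k l" "k < l" "in_block (\<alpha> J) k l"
      using A[OF J] unfolding tuple_fields_def in_block_def by blast
    then show "\<exists>k l. X = rotation_field k l \<and> k \<noteq> l \<and> E J k l" by (auto simp: E_def)
  qed
  ultimately show ?thesis using J by blast
qed

end
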